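(* Let $G$ be a Lie group whose Lie algebra $\mathfrak g$ carries an invariant inner product $B$, with Cartan–Dirac structure $E_G$ and Cartan 3-form $\eta$. The multiplication map $\mathrm{Mult}:G\times G\to G$, $(a,b)\mapsto ab$, extends to a strong Dirac morphism \[(\mathrm{Mult},\varsigma):(G,E_G,\eta)\times(G,E_G,\eta)\to(G,E_G,\eta),\] with $\varsigma=-\frac12B(\theta^{L,1},\theta^{R,2})\in\Omega^2(G\times G)$. In terms of the trivialization $E_G=G\times\mathfrak g$, the map $\hat{\mathfrak a}:\mathrm{Mult}^*E_G\to E_G\times E_G$ associated with the strong Dirac morphism is given by the diagonal embedding $\mathfrak g\to\mathfrak g\times\mathfrak g$. Similarly, the inversion map $\mathrm{Inv}:G\to G$, $g\mapsto g^{-1}$ extends to a Dirac morphism \[(\mathrm{Inv},0):(G,E_G,\eta)\to(G,E_G^\top,-\eta).\]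
   Context: $B$ is an $\mathrm{Ad}$-invariant non-degenerate symmetric bilinear form on $\mathfrak g$; $\xi^L,\xi^R$ are the left-/right-invariant vector fields, $\theta^L,\theta^R$ the left-/right-Maurer–Cartan forms, $\eta=\frac1{12}B(\theta^L,[\theta^L,\theta^L])$. For a form $\beta$ on $G$, $\beta^i$ (or superscript $i$, as in $\theta^{L,1}$) is the pull-back to the $i$-th factor of $G\times G$; for $\mathfrak g$-valued 1-forms, $B(\alpha,\beta)(X,Y)=B(\alpha(X),\beta(Y))-B(\alpha(Y),\beta(X))$. $\mathbb{T}M=TM\oplus T^*M$ with form $\langle v_1\oplus\alpha_1,v_2\oplus\alpha_2\rangle=\alpha_1(v_2)+\alpha_2(v_1)$. For a closed 3-form $\eta$, the $\eta$-twisted Courant bracket is defined by $\varrho([\![x_1,x_2]\!]_\eta)=[[\mathrm d+\eta,\varrho(x_1)],\varrho(x_2)]$ on $\Omega(M)$, where $\varrho(v\oplus\alpha)=\alpha\wedge\cdot+\iota(v)$. A Dirac manifold $(M,E,\eta)$ is a manifold with a Lagrangian subbundle $E\subset\mathbb{T}M$ and closed 3-form $\eta$ such that $\Gamma(E)$ is closed under $[\![\cdot,\cdot]\!]_\eta$. For $\Phi:M\to M'$ and $\omega\in\Omega^2(M)$, write $v\oplus\alpha\sim_{(\Phi,\omega)}v'\oplus\alpha'$ (for $v\oplus\alpha\in\mathbb{T}_mM$, $v'\oplus\alpha'\in\mathbb{T}_{\Phi(m)}M'$) if $v'=(\mathrm d\Phi)_mv$ and $(\mathrm d\Phi)_m^*\alpha'=\alpha+\iota_v\omega_m$.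 $(\Phi,\omega):(M,E,\eta)\to(M',E',\eta')$ is a Dirac morphism if $\eta+\mathrm d\omega=\Phi^*\eta'$ and for all $m$, $E'_{\Phi(m)}=\{w':\exists w\in E_m,\ w\sim_{(\Phi,\omega)}w'\}$. It is strong if moreover no nonzero $w\in E_m$ satisfies $w\sim_{(\Phi,\omega)}0$; then $\hat{\mathfrak a}:\Phi^*E'\to E$ is the bundle map sending $w'\in E'_{\Phi(m)}$ to the unique $w\in E_m$ with $w\sim_{(\Phi,\omega)}w'$. The Cartan–Dirac structure $E_G\subset\mathbb{T}G$ (a Dirac structure relative to $\eta$) is spanned by the sections $\mathsf e(\xi)=(\xi^L-\xi^R)\oplus B(\frac{\theta^L+\theta^R}2,\xi)$, $\xi\in\mathfrak g$; these give the trivialization $E_G=G\times\mathfrak g$. $E_G^\top$ is the image of $E_G$ under $v\oplus\alpha\mapsto v\oplus(-\alpha)$. The product $(G,E_G,\eta)\times(G,E_G,\eta)$ is $(G\times G,E_G\times E_G,\eta^1+\eta^2)$. *)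

theory Defs
  imports "HOL-Analysis.Analysis"
begin

section \<open>Smooth maps between open subsets of vector spaces\<close>

text \<open>On finite-dimensional spaces and open sets, existence and continuity of all iterated
  directional derivatives up to order k is the usual C^k condition.\<close>

primrec Ck_on :: "nat \<Rightarrow> 'a::real_normed_vector set \<Rightarrow> ('a \<Rightarrow> 'b::real_normed_vector) \<Rightarrow> bool" where
  "Ck_on 0 S f \<longleftrightarrow> continuous_on S f"
| "Ck_on (Suc k) S f \<longleftrightarrow>
     (\<forall>x\<in>S. f differentiable (at x)) \<and> (\<forall>v. Ck_on k S (\<lambda>x. frechet_derivative f (at x) v))"

definition smooth_on :: "'a::real_normed_vector set \<Rightarrow> ('a \<Rightarrow> 'b::real_normed_vector) \<Rightarrow> bool" where
  "smooth_on S f \<longleftrightarrow> (\<forall>k. Ck_on k S f)"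

section \<open>Smooth manifolds\<close>

text \<open>A smooth structure is given by a smooth atlas indexed by the points of the manifold: it assigns
  to every point x a chart (domain and coordinate map) around x, any two charts being smoothly
  compatible. Every manifold has such an atlas (choose a chart around each point). The model
  space is a finite-dimensional real inner product space instead of a \<open>euclidean_space\<close>
  in order to admit dimension 0; its inner product plays no role.\<close>

type_synonym ('m, 'e) atlas = "'m \<Rightarrow> 'm set \<times> ('m \<Rightarrow> 'e)"

definition cdom :: "('m, 'e) atlas \<Rightarrow> 'm \<Rightarrow> 'm set" where
  "cdom M p = fst (M p)"

definition cmap :: "('m, 'e) atlas \<Rightarrow> 'm \<Rightarrow> 'm \<Rightarrow> 'e" where
  "cmap M p = snd (M p)"

definition cinv :: "('m, 'e) atlas \<Rightarrow> 'm \<Rightarrow> 'e \<Rightarrow> 'm" where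
  "cinv M p = inv_into (cdom M p) (cmap M p)"

definition smooth_manifold ::
    "('m::{t2_space, second_countable_topology}, 'e::real_inner) atlas \<Rightarrow> bool" where
  "smooth_manifold M \<longleftrightarrow>
     (\<exists>Bs::'e set. finite Bs \<and> span Bs = UNIV) \<and>
     (\<forall>p. p \<in> cdom M p \<and> open (cdom M p) \<and> open (cmap M p ` cdom M p) \<and>
          homeomorphism (cdom M p) (cmap M p ` cdom M p) (cmap M p) (cinv M p)) \<and>
     (\<forall>p q. smooth_on (cmap M p ` (cdom M p \<inter> cdom M q)) (cmap M q \<circ> cinv M p))"

definition smooth_map ::
    "('m::topological_space, 'e::real_inner) atlas \<Rightarrow> ('n::topological_space, 'f::real_inner) atlas
      \<Rightarrow> ('m \<Rightarrow> 'n) \<Rightarrow> bool" where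
  "smooth_map M N f \<longleftrightarrow> continuous_on UNIV f \<and>
     (\<forall>p q. smooth_on (cmap M p ` (cdom M p \<inter> f -` cdom N q)) (cmap N q \<circ> f \<circ> cinv M p))"

definition prod_atlas :: "('m, 'e) atlas \<Rightarrow> ('n, 'f) atlas \<Rightarrow> ('m \<times> 'n, 'e \<times> 'f) atlas" where
  "prod_atlas M N = (\<lambda>(p, q). (cdom M p \<times> cdom N q, map_prod (cmap M p) (cmap N q)))"

subsection \<open>Tangent spaces\<close>

text \<open>The tangent space at x is the model space, a tangent vector at x being represented by its
  coordinates in the chart assigned to x. The cotangent space at x consists of the linear
  functionals on the model space.\<close>

definition tangent_map ::
    "('m, 'e::real_normed_vector) atlas \<Rightarrow> ('n, 'f::real_normed_vector) atlas
      \<Rightarrow> ('m \<Rightarrow> 'n) \<Rightarrow> 'm \<Rightarrow> 'e \<Rightarrow> 'f" where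
  "tangent_map M N f x = frechet_derivative (cmap N (f x) \<circ> f \<circ> cinv M x) (at (cmap M x x))"

text \<open>Derivative at u of the change of coordinates from the chart p to the chart q.\<close>

definition transition :: "('m, 'e::real_normed_vector) atlas \<Rightarrow> 'm \<Rightarrow> 'm \<Rightarrow> 'e \<Rightarrow> 'e \<Rightarrow> 'e" where
  "transition M p q u = frechet_derivative (cmap M q \<circ> cinv M p) (at u)"

text \<open>Coordinate representation, in the chart p, of a vector field.\<close>

definition local_vf :: "('m, 'e::real_normed_vector) atlas \<Rightarrow> 'm \<Rightarrow> ('m \<Rightarrow> 'e) \<Rightarrow> 'e \<Rightarrow> 'e" where
  "local_vf M p X u = (let x = cinv M p u in transition M x p (cmap M x x) (X x))"

definition lie_bracket ::
    "('m, 'e::real_normed_vector) atlas \<Rightarrow> ('m \<Rightarrow> 'e) \<Rightarrow> ('m \<Rightarrow> 'e) \<Rightarrow> 'm \<Rightarrow> 'e" where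
  "lie_bracket M X Y x =
     frechet_derivative (local_vf M x Y) (at (cmap M x x)) (X x)
     - frechet_derivative (local_vf M x X) (at (cmap M x x)) (Y x)"

section \<open>Differential forms\<close>

text \<open>An inhomogeneous (possibly vector-valued) form assigns to a point x and a list of k tangent
  vectors at x the value of its degree k component on these vectors.\<close>

type_synonym ('m, 'e, 'v) form = "'m \<Rightarrow> 'e list \<Rightarrow> 'v"

definition homogeneous :: "nat \<Rightarrow> ('m, 'e, 'v::zero) form \<Rightarrow> bool" where
  "homogeneous k \<omega> \<longleftrightarrow> (\<forall>x vs. length vs \<noteq> k \<longrightarrow> \<omega> x vs = 0)"

definition alternating :: "('e::real_vector list \<Rightarrow> real) \<Rightarrow> bool" where
  "alternating \<phi> \<longleftrightarrow>
     (\<forall>vs i. i < length vs \<longrightarrow> linear (\<lambda>v. \<phi> (vs[i := v]))) \<and>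
     (\<forall>vs i j. i < j \<and> j < length vs \<and> vs ! i = vs ! j \<longrightarrow> \<phi> vs = 0)"

definition local_form ::
    "('m, 'e::real_normed_vector) atlas \<Rightarrow> 'm \<Rightarrow> ('m, 'e, 'v) form \<Rightarrow> 'e \<Rightarrow> 'e list \<Rightarrow> 'v" where
  "local_form M p \<omega> u vs = (let x = cinv M p u in \<omega> x (map (transition M p x u) vs))"

definition Forms :: "('m, 'e::real_normed_vector) atlas \<Rightarrow> ('m, 'e, real) form set" where
  "Forms M = {\<omega>. (\<forall>x. alternating (\<omega> x)) \<and>
     (\<forall>p vs. smooth_on (cmap M p ` cdom M p) (\<lambda>u. local_form M p \<omega> u vs))}"

definition kForms :: "nat \<Rightarrow> ('m, 'e::real_normed_vector) atlas \<Rightarrow> ('m, 'e, real) form set" where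
  "kForms k M = {\<omega> \<in> Forms M. homogeneous k \<omega>}"

text \<open>Exterior derivative, computed at x in the chart assigned to x.\<close>

definition ext_d ::
    "('m, 'e::real_normed_vector) atlas \<Rightarrow> ('m, 'e, real) form \<Rightarrow> ('m, 'e, real) form" where
  "ext_d M \<omega> x vs = (\<Sum>i<length vs. (-1) ^ i *
     frechet_derivative (\<lambda>u. local_form M x \<omega> u (take i vs @ drop (Suc i) vs)) (at (cmap M x x)) (vs ! i))"

text \<open>Wedge product by the shuffle formula, the values being multiplied by a bilinear map b. The set
  S consists of the positions of the arguments of the first factor; the sign is that of the
  corresponding shuffle.\<close>

definition wedge ::
    "('u \<Rightarrow> 'v \<Rightarrow> 'w::real_vector) \<Rightarrow> ('m, 'e, 'u) form \<Rightarrow> ('m, 'e, 'v) form \<Rightarrow> ('m, 'e, 'w) form" where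
  "wedge b \<phi> \<psi> x vs = (\<Sum>S\<in>Pow {..<length vs}.
     (-1) ^ card {(i, j). i < j \<and> i \<in> {..<length vs} - S \<and> j \<in> S} *\<^sub>R
       b (\<phi> x (nths vs S)) (\<psi> x (nths vs (- S))))"

definition one_form :: "('m \<Rightarrow> 'e \<Rightarrow> 'v::zero) \<Rightarrow> ('m, 'e, 'v) form" where
  "one_form \<alpha> x vs = (if length vs = 1 then \<alpha> x (hd vs) else 0)"

definition contract :: "('m \<Rightarrow> 'e) \<Rightarrow> ('m, 'e, 'v) form \<Rightarrow> ('m, 'e, 'v) form" where
  "contract X \<omega> x vs = \<omega> x (X x # vs)"

definition pullback ::
    "('m, 'e::real_normed_vector) atlas \<Rightarrow> ('n, 'f::real_normed_vector) atlas \<Rightarrow> ('m \<Rightarrow> 'n)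
      \<Rightarrow> ('n, 'f, 'v) form \<Rightarrow> ('m, 'e, 'v) form" where
  "pullback M N f \<omega> x vs = \<omega> (f x) (map (tangent_map M N f x) vs)"

section \<open>Dirac manifolds\<close>

text \<open>An element of the fibre of the Pontryagin bundle is a pair of a vector and a linear functional.\<close>

type_synonym 'e pont = "'e \<times> ('e \<Rightarrow> real)"

definition Pont :: "'e::real_vector pont set" where
  "Pont = {w. linear (snd w)}"

definition pairing :: "'e pont \<Rightarrow> 'e pont \<Rightarrow> real" where
  "pairing w1 w2 = snd w1 (fst w2) + snd w2 (fst w1)"

definition lagrangian :: "'e::real_vector pont set \<Rightarrow> bool" where
  "lagrangian W \<longleftrightarrow> W = {w \<in> Pont. \<forall>w'\<in>W. pairing w w' = 0}"

definition smooth_section_on ::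
    "('m::topological_space, 'e::real_inner) atlas \<Rightarrow> 'm set \<Rightarrow> ('m \<Rightarrow> 'e pont) \<Rightarrow> bool" where
  "smooth_section_on M U s \<longleftrightarrow> (\<forall>x\<in>U. s x \<in> Pont) \<and>
     (\<forall>p. smooth_on (cmap M p ` (cdom M p \<inter> U)) (local_vf M p (\<lambda>x. fst (s x))) \<and>
          (\<forall>v. smooth_on (cmap M p ` (cdom M p \<inter> U))
                 (\<lambda>u. local_form M p (one_form (\<lambda>x. snd (s x))) u [v])))"

definition sections ::
    "('m::topological_space, 'e::real_inner) atlas \<Rightarrow> ('m \<Rightarrow> 'e pont set) \<Rightarrow> ('m \<Rightarrow> 'e pont) set" where
  "sections M E = {s. smooth_section_on M UNIV s \<and> (\<forall>x. s x \<in> E x)}"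

text \<open>A smooth subbundle has, near every point, a frame s 0, ..., s (n - 1) of smooth sections.\<close>

definition smooth_subbundle ::
    "('m::topological_space, 'e::real_inner) atlas \<Rightarrow> ('m \<Rightarrow> 'e pont set) \<Rightarrow> bool" where
  "smooth_subbundle M E \<longleftrightarrow>
     (\<forall>p. \<exists>U (n::nat) s. open U \<and> p \<in> U \<and> (\<forall>i<n. smooth_section_on M U (s i)) \<and>
       (\<forall>x\<in>U. bij_betw
          (\<lambda>c. (\<Sum>i<n. c i *\<^sub>R fst (s i x), \<lambda>v. \<Sum>i<n. c i * snd (s i x) v))
          ({..<n} \<rightarrow>\<^sub>E UNIV) (E x)))"

definition clifford :: "('m \<Rightarrow> 'e pont) \<Rightarrow> ('m, 'e, real) form \<Rightarrow> ('m, 'e, real) form" where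
  "clifford s \<phi> x vs =
     wedge (*) (one_form (\<lambda>y. snd (s y))) \<phi> x vs + contract (\<lambda>y. fst (s y)) \<phi> x vs"

definition twisted_d ::
    "('m, 'e::real_normed_vector) atlas \<Rightarrow> ('m, 'e, real) form
      \<Rightarrow> ('m, 'e, real) form \<Rightarrow> ('m, 'e, real) form" where
  "twisted_d M \<eta> \<phi> x vs = ext_d M \<phi> x vs + wedge (*) \<eta> \<phi> x vs"

text \<open>The brackets in the definition of the Courant bracket are graded commutators of operators on
  forms. Since \<open>twisted_d\<close> and \<open>clifford\<close> are odd, the inner one is an anticommutator and the
  outer one a commutator.\<close>

definition commutator ::
    "(('m, 'e, real) form \<Rightarrow> ('m, 'e, real) form) \<Rightarrow> (('m, 'e, real) form \<Rightarrow> ('m, 'e, real) form)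
      \<Rightarrow> ('m, 'e, real) form \<Rightarrow> ('m, 'e, real) form" where
  "commutator P Q \<phi> x vs = P (Q \<phi>) x vs - Q (P \<phi>) x vs"

definition anticommutator ::
    "(('m, 'e, real) form \<Rightarrow> ('m, 'e, real) form) \<Rightarrow> (('m, 'e, real) form \<Rightarrow> ('m, 'e, real) form)
      \<Rightarrow> ('m, 'e, real) form \<Rightarrow> ('m, 'e, real) form" where
  "anticommutator P Q \<phi> x vs = P (Q \<phi>) x vs + Q (P \<phi>) x vs"

text \<open>The section s3 is the \<open>\<eta>\<close>-twisted Courant bracket of s1 and s2.\<close>

definition is_courant_bracket ::
    "('m, 'e::real_normed_vector) atlas \<Rightarrow> ('m, 'e, real) form
      \<Rightarrow> ('m \<Rightarrow> 'e pont) \<Rightarrow> ('m \<Rightarrow> 'e pont) \<Rightarrow> ('m \<Rightarrow> 'e pont) \<Rightarrow> bool" where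
  "is_courant_bracket M \<eta> s1 s2 s3 \<longleftrightarrow>
     (\<forall>\<phi>\<in>Forms M. clifford s3 \<phi> =
        commutator (anticommutator (twisted_d M \<eta>) (clifford s1)) (clifford s2) \<phi>)"

definition closed_form :: "('m, 'e::real_normed_vector) atlas \<Rightarrow> ('m, 'e, real) form \<Rightarrow> bool" where
  "closed_form M \<omega> \<longleftrightarrow> ext_d M \<omega> = (\<lambda>x vs. 0)"

definition dirac_manifold ::
    "('m::{t2_space, second_countable_topology}, 'e::real_inner) atlas
      \<Rightarrow> ('m \<Rightarrow> 'e pont set) \<Rightarrow> ('m, 'e, real) form \<Rightarrow> bool" where
  "dirac_manifold M E \<eta> \<longleftrightarrow> smooth_manifold M \<and>
     smooth_subbundle M E \<and> (\<forall>x. lagrangian (E x)) \<and>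
     \<eta> \<in> kForms 3 M \<and> closed_form M \<eta> \<and>
     (\<forall>s1\<in>sections M E. \<forall>s2\<in>sections M E. \<exists>s3\<in>sections M E. is_courant_bracket M \<eta> s1 s2 s3)"

subsection \<open>Dirac morphisms\<close>

definition dirac_related ::
    "('m, 'e::real_normed_vector) atlas \<Rightarrow> ('n, 'f::real_normed_vector) atlas \<Rightarrow> ('m \<Rightarrow> 'n)
      \<Rightarrow> ('m, 'e, real) form \<Rightarrow> 'm \<Rightarrow> 'e pont \<Rightarrow> 'f pont \<Rightarrow> bool" where
  "dirac_related M M' \<Phi> \<omega> m w w' \<longleftrightarrow>
     fst w' = tangent_map M M' \<Phi> m (fst w) \<and>
     (\<forall>v. snd w' (tangent_map M M' \<Phi> m v) = snd w v + \<omega> m [fst w, v])"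

definition dirac_morphism ::
    "('m::{t2_space, second_countable_topology}, 'e::real_inner) atlas
      \<Rightarrow> ('m \<Rightarrow> 'e pont set) \<Rightarrow> ('m, 'e, real) form
      \<Rightarrow> ('n::{t2_space, second_countable_topology}, 'f::real_inner) atlas
      \<Rightarrow> ('n \<Rightarrow> 'f pont set) \<Rightarrow> ('n, 'f, real) form
      \<Rightarrow> ('m \<Rightarrow> 'n) \<Rightarrow> ('m, 'e, real) form \<Rightarrow> bool" where
  "dirac_morphism M E \<eta> M' E' \<eta>' \<Phi> \<omega> \<longleftrightarrow>
     dirac_manifold M E \<eta> \<and> dirac_manifold M' E' \<eta>' \<and>
     smooth_map M M' \<Phi> \<and> \<omega> \<in> kForms 2 M \<and>
     (\<lambda>x vs. \<eta> x vs + ext_d M \<omega> x vs) = pullback M M' \<Phi> \<eta>' \<and>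
     (\<forall>m. E' (\<Phi> m) = {w' \<in> Pont. \<exists>w\<in>E m. dirac_related M M' \<Phi> \<omega> m w w'})"

definition strong_dirac_morphism ::
    "('m::{t2_space, second_countable_topology}, 'e::real_inner) atlas
      \<Rightarrow> ('m \<Rightarrow> 'e pont set) \<Rightarrow> ('m, 'e, real) form
      \<Rightarrow> ('n::{t2_space, second_countable_topology}, 'f::real_inner) atlas
      \<Rightarrow> ('n \<Rightarrow> 'f pont set) \<Rightarrow> ('n, 'f, real) form
      \<Rightarrow> ('m \<Rightarrow> 'n) \<Rightarrow> ('m, 'e, real) form \<Rightarrow> bool" where
  "strong_dirac_morphism M E \<eta> M' E' \<eta>' \<Phi> \<omega> \<longleftrightarrow>
     dirac_morphism M E \<eta> M' E' \<eta>' \<Phi> \<omega> \<and>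
     (\<forall>m. \<forall>w\<in>E m. dirac_related M M' \<Phi> \<omega> m w (0, \<lambda>v. 0) \<longrightarrow> w = (0, \<lambda>v. 0))"

text \<open>The bundle map associated with a strong Dirac morphism, as a map from the fibre of \<open>E'\<close> at
  \<open>\<Phi> m\<close> to the fibre of E at m.\<close>

definition dirac_hat ::
    "('m, 'e::real_normed_vector) atlas \<Rightarrow> ('m \<Rightarrow> 'e pont set) \<Rightarrow> ('n, 'f::real_normed_vector) atlas
      \<Rightarrow> ('m \<Rightarrow> 'n) \<Rightarrow> ('m, 'e, real) form \<Rightarrow> 'm \<Rightarrow> 'f pont \<Rightarrow> 'e pont" where
  "dirac_hat M E M' \<Phi> \<omega> m w' = (THE w. w \<in> E m \<and> dirac_related M M' \<Phi> \<omega> m w w')"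

definition pont_prod :: "'e pont \<Rightarrow> 'f pont \<Rightarrow> ('e \<times> 'f) pont" where
  "pont_prod w1 w2 = ((fst w1, fst w2), \<lambda>v. snd w1 (fst v) + snd w2 (snd v))"

definition bundle_prod ::
    "('m \<Rightarrow> 'e pont set) \<Rightarrow> ('n \<Rightarrow> 'f pont set) \<Rightarrow> 'm \<times> 'n \<Rightarrow> ('e \<times> 'f) pont set" where
  "bundle_prod E F = (\<lambda>(p, q). {pont_prod w1 w2 | w1 w2. w1 \<in> E p \<and> w2 \<in> F q})"

definition bundle_transpose :: "('m \<Rightarrow> 'e pont set) \<Rightarrow> 'm \<Rightarrow> 'e pont set" where
  "bundle_transpose E x = (\<lambda>w. (fst w, \<lambda>v. - snd w v)) ` E x"

section \<open>Lie groups\<close>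

record ('g, 'e) lie_group =
  mfd :: "('g, 'e) atlas"
  mul :: "'g \<Rightarrow> 'g \<Rightarrow> 'g"
  unit :: 'g
  inver :: "'g \<Rightarrow> 'g"

definition is_lie_group ::
    "('g::{t2_space, second_countable_topology}, 'e::real_inner) lie_group \<Rightarrow> bool" where
  "is_lie_group G \<longleftrightarrow> group (mul G) (unit G) (inver G) \<and> smooth_manifold (mfd G) \<and>
     smooth_map (prod_atlas (mfd G) (mfd G)) (mfd G) (\<lambda>(a, b). mul G a b) \<and>
     smooth_map (mfd G) (mfd G) (inver G)"

text \<open>The Lie algebra is the tangent space at the unit, i.e. the model space, with the bracket of
  left-invariant vector fields.\<close>

definition left_inv_field :: "('g, 'e::real_normed_vector) lie_group \<Rightarrow> 'e \<Rightarrow> 'g \<Rightarrow> 'e" where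
  "left_inv_field G \<xi> g = tangent_map (mfd G) (mfd G) (\<lambda>h. mul G g h) (unit G) \<xi>"

definition right_inv_field :: "('g, 'e::real_normed_vector) lie_group \<Rightarrow> 'e \<Rightarrow> 'g \<Rightarrow> 'e" where
  "right_inv_field G \<xi> g = tangent_map (mfd G) (mfd G) (\<lambda>h. mul G h g) (unit G) \<xi>"

definition lie_alg_bracket :: "('g, 'e::real_normed_vector) lie_group \<Rightarrow> 'e \<Rightarrow> 'e \<Rightarrow> 'e" where
  "lie_alg_bracket G \<xi> \<zeta> =
     lie_bracket (mfd G) (left_inv_field G \<xi>) (left_inv_field G \<zeta>) (unit G)"

definition Ad :: "('g, 'e::real_normed_vector) lie_group \<Rightarrow> 'g \<Rightarrow> 'e \<Rightarrow> 'e" where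
  "Ad G g = tangent_map (mfd G) (mfd G) (\<lambda>h. mul G (mul G g h) (inver G g)) (unit G)"

definition left_MC :: "('g, 'e::real_normed_vector) lie_group \<Rightarrow> 'g \<Rightarrow> 'e \<Rightarrow> 'e" where
  "left_MC G g = tangent_map (mfd G) (mfd G) (\<lambda>h. mul G (inver G g) h) g"

definition right_MC :: "('g, 'e::real_normed_vector) lie_group \<Rightarrow> 'g \<Rightarrow> 'e \<Rightarrow> 'e" where
  "right_MC G g = tangent_map (mfd G) (mfd G) (\<lambda>h. mul G h (inver G g)) g"

definition invariant_inner_product ::
    "('g, 'e::real_normed_vector) lie_group \<Rightarrow> ('e \<Rightarrow> 'e \<Rightarrow> real) \<Rightarrow> bool" where
  "invariant_inner_product G B \<longleftrightarrow> bilinear B \<and>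
     (\<forall>\<xi> \<zeta>. B \<xi> \<zeta> = B \<zeta> \<xi>) \<and>
     (\<forall>\<xi>. (\<forall>\<zeta>. B \<xi> \<zeta> = 0) \<longrightarrow> \<xi> = 0) \<and>
     (\<forall>g \<xi> \<zeta>. B (Ad G g \<xi>) (Ad G g \<zeta>) = B \<xi> \<zeta>)"

definition cartan_3form ::
    "('g, 'e::real_normed_vector) lie_group \<Rightarrow> ('e \<Rightarrow> 'e \<Rightarrow> real) \<Rightarrow> ('g, 'e, real) form" where
  "cartan_3form G B = (\<lambda>g vs. 1 / 12 *
     wedge B (one_form (left_MC G))
       (wedge (lie_alg_bracket G) (one_form (left_MC G)) (one_form (left_MC G))) g vs)"

definition cartan_section ::
    "('g, 'e::real_normed_vector) lie_group \<Rightarrow> ('e \<Rightarrow> 'e \<Rightarrow> real) \<Rightarrow> 'e \<Rightarrow> 'g \<Rightarrow> 'e pont" where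
  "cartan_section G B \<xi> g =
     (left_inv_field G \<xi> g - right_inv_field G \<xi> g,
      \<lambda>v. B ((1 / 2) *\<^sub>R (left_MC G g v + right_MC G g v)) \<xi>)"

text \<open>The sections \<open>cartan_section G B \<xi>\<close> depend linearly on \<open>\<xi>\<close>, so their values at g form the
  subspace which they span.\<close>

definition cartan_dirac ::
    "('g, 'e::real_normed_vector) lie_group \<Rightarrow> ('e \<Rightarrow> 'e \<Rightarrow> real) \<Rightarrow> 'g \<Rightarrow> 'e pont set" where
  "cartan_dirac G B g = range (\<lambda>\<xi>. cartan_section G B \<xi> g)"

abbreviation mfd2 :: "('g, 'e) lie_group \<Rightarrow> ('g \<times> 'g, 'e \<times> 'e) atlas" where
  "mfd2 G \<equiv> prod_atlas (mfd G) (mfd G)"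

definition sum_3form ::
    "('g, 'e::real_normed_vector) lie_group \<Rightarrow> ('e \<Rightarrow> 'e \<Rightarrow> real)
      \<Rightarrow> ('g \<times> 'g, 'e \<times> 'e, real) form" where
  "sum_3form G B = (\<lambda>x vs.
     pullback (mfd2 G) (mfd G) fst (cartan_3form G B) x vs
     + pullback (mfd2 G) (mfd G) snd (cartan_3form G B) x vs)"

definition mult_2form ::
    "('g, 'e::real_normed_vector) lie_group \<Rightarrow> ('e \<Rightarrow> 'e \<Rightarrow> real)
      \<Rightarrow> ('g \<times> 'g, 'e \<times> 'e, real) form" where
  "mult_2form G B = (\<lambda>x vs. - (1 / 2) *
     wedge B (pullback (mfd2 G) (mfd G) fst (one_form (left_MC G)))
             (pullback (mfd2 G) (mfd G) snd (one_form (right_MC G))) x vs)"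

end

theory Submission
  imports Defs
begin

text \<open>In the left trivialization an element of \<open>E\<^sub>G\<close> with parameter \<open>\<xi>\<close> is the pair of
  \<open>\<xi> - Ad g\<^sup>-\<^sup>1 \<xi>\<close> and \<open>B(\<theta>\<^sup>L, \<xi> + Ad g\<^sup>-\<^sup>1 \<xi>) / 2\<close>, and \<open>\<eta>(X, Y, Z) = B(\<theta>\<^sup>L X, [\<theta>\<^sup>L Y, \<theta>\<^sup>L Z]) / 2\<close>;
  everything is then linear algebra with an invariant form, plus two facts of first order: the
  Maurer-Cartan equation, and \<open>d(Ad \<zeta>) = Ad [\<theta>\<^sup>L, \<zeta>]\<close>. The latter comes from the symmetry of the mixed
  second derivative of the multiplication at the unit; differentiating the identities satisfied by Ad, it
  yields the Jacobi identity and the invariance of B under ad.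

  Evaluating the commutators that define the Courant bracket in a chart gives the usual formula for it,
  and for the sections with parameters f1, f2 this formula is the section with parameter
  \<open>[f1, f2] + V1 f2 - V2 f1\<close>, where V1, V2 are the vector parts. So \<open>E\<^sub>G\<close> is a Dirac structure. The same
  theorem applies to the Lie group \<open>G \<times> G\<close> with the form \<open>B \<oplus> B\<close>, which is the product, and to
  \<open>G\<close> with \<open>- B\<close>, which gives the transpose of \<open>E\<^sub>G\<close> with \<open>- \<eta>\<close>.

  For the multiplication, a pair of sections with parameters \<open>\<xi>, \<zeta>\<close> evaluates, after adding the
  contribution of the 2-form, to \<open>B(\<psi>, \<xi> - \<zeta>)\<close> on the vectors tangent to the fibres, so it is related to
  something only if \<open>\<xi> = \<zeta>\<close>.\<close>

text \<open>The bracket condition speaks of all smooth sections, and the bracket is not linear over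
  functions. Hence brackets are computed for parameters that vary from point to point, and the
  parameter of a given section is recovered smoothly by inverting B (\<open>param\<close>). Tangent
  vectors at x are coordinates in the chart assigned to x, so a field cannot be differentiated as it
  stands. It is read in one fixed chart, at whose centre the reading changes nothing; the
  first-order identities are taken at such centres. The derivative \<open>dMC\<close> of the
  Maurer-Cartan form obtained in this way depends on the chart, but its antisymmetric part does not,
  and only this part survives in the results. The bracket is tested on forms of all degrees at once.
  Signs are therefore not counted in shuffles but produced by peeling off the first argument:
  contraction is a graded derivation. Statements about right translations come from those about left
  translations by passing to the opposite group.\<close>

abbreviation fderiv :: "('a::real_normed_vector \<Rightarrow> 'b::real_normed_vector) \<Rightarrow> 'a \<Rightarrow> 'a \<Rightarrow> 'b" where
  "fderiv f x \<equiv> frechet_derivative f (at x)"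

section \<open>Calculus of smooth maps\<close>

lemma fderiv_eq: "(f has_derivative f') (at x) \<Longrightarrow> fderiv f x = f'"
  by (rule frechet_derivative_at [symmetric])

lemma fderiv_worksD: "f differentiable (at x) \<Longrightarrow> (f has_derivative fderiv f x) (at x)"
  by (simp add: frechet_derivative_works)

lemma differentiable_cong_open:
  assumes "open S" "x \<in> S" "\<And>y. y \<in> S \<Longrightarrow> f y = g y"
  shows "f differentiable (at x) \<longleftrightarrow> g differentiable (at x)"
proof -
  have "(f has_derivative D) (at x) \<longleftrightarrow> (g has_derivative D) (at x)" for D
    using assms has_derivative_transform_within_open[of f D x UNIV S g]
      has_derivative_transform_within_open[of g D x UNIV S f] by auto
  then show ?thesis by (auto simp: differentiable_def)
qed

lemma fderiv_cong_open:
  assumes "open S" "x \<in> S" "\<And>y. y \<in> S \<Longrightarrow> f y = g y"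
  shows "fderiv f x = fderiv g x"
proof -
  have "(f has_derivative D) (at x) \<longleftrightarrow> (g has_derivative D) (at x)" for D
    using assms has_derivative_transform_within_open[of f D x UNIV S g]
      has_derivative_transform_within_open[of g D x UNIV S f] by auto
  then show ?thesis by (simp add: frechet_derivative_def)
qed

text \<open>Openness of S turns equality on S into equality near each of its points, so that it
  passes to the derivatives.\<close>

lemma Ck_on_cong:
  assumes "open S" "\<And>x. x \<in> S \<Longrightarrow> f x = g x" "Ck_on k S f"
  shows "Ck_on k S g"
  using assms(2,3)
proof (induction k arbitrary: f g)
  case 0
  then show ?case using continuous_on_cong[of S S f g] by simp
next
  case (Suc k)
  have "g differentiable (at x)" if "x \<in> S" for x
    using differentiable_cong_open[OF assms(1) that, of f g] Suc that by auto
  moreover have "Ck_on k S (\<lambda>x. fderiv g x v)" for v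
    using Suc.IH[of "\<lambda>x. fderiv f x v" "\<lambda>x. fderiv g x v"] Suc.prems
      fderiv_cong_open[OF assms(1), of _ f g] by auto
  ultimately show ?case by simp
qed

lemma Ck_on_subset: "Ck_on k S f \<Longrightarrow> T \<subseteq> S \<Longrightarrow> Ck_on k T f"
  by (induction k arbitrary: f) (auto intro: continuous_on_subset)

lemma Ck_on_SucD: "Ck_on (Suc k) S f \<Longrightarrow> Ck_on k S f"
proof (induction k arbitrary: f)
  case 0
  then show ?case
    by (auto intro!: continuous_at_imp_continuous_on differentiable_imp_continuous_within)
next
  case (Suc k)
  then show ?case by simp
qed

text \<open>The sets T may leave S, since only the behaviour near the points of S matters. This
  allows smoothness to be checked in charts that cover only part of a domain.\<close>

lemma Ck_on_local:
  assumes "\<And>x. x \<in> S \<Longrightarrow> \<exists>T. open T \<and> x \<in> T \<and> Ck_on k T f"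
  shows "Ck_on k S f"
  using assms
proof (induction k arbitrary: f)
  case 0
  then show ?case
    by (auto intro!: continuous_at_imp_continuous_on) (metis continuous_on_eq_continuous_at)
next
  case (Suc k)
  have "f differentiable (at x)" if "x \<in> S" for x using Suc.prems[OF that] by auto
  moreover have "Ck_on k S (\<lambda>x. fderiv f x v)" for v
    by (rule Suc.IH) (use Suc.prems in fastforce)
  ultimately show ?case by simp
qed

lemma Ck_on_const [intro]: "Ck_on k S (\<lambda>x. c)"
  by (induction k arbitrary: c) auto

lemma Ck_on_bounded_linear_compose:
  assumes "open S" "bounded_linear L"
  shows "Ck_on k S f \<Longrightarrow> Ck_on k S (\<lambda>x. L (f x))"
proof (induction k arbitrary: f)
  case 0
  then show ?case using assms(2) by (simp add: bounded_linear.continuous_on)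
next
  case (Suc k)
  have d: "((\<lambda>x. L (f x)) has_derivative (\<lambda>v. L (fderiv f x v))) (at x)" if "x \<in> S" for x
    using bounded_linear.has_derivative[OF assms(2) fderiv_worksD[of f x]] Suc.prems that by auto
  have "Ck_on k S (\<lambda>x. fderiv (\<lambda>x. L (f x)) x v)" for v
    by (rule Ck_on_cong[OF assms(1), of "\<lambda>x. L (fderiv f x v)"])
      (use Suc fderiv_eq[OF d] in auto)
  then show ?case using d by (auto simp: differentiable_def)
qed

lemma Ck_on_add:
  assumes "open S" "Ck_on k S f" "Ck_on k S g"
  shows "Ck_on k S (\<lambda>x. f x + g x)"
  using assms(2,3)
proof (induction k arbitrary: f g)
  case 0
  then show ?case by (simp add: continuous_on_add)
next
  case (Suc k)
  have d: "((\<lambda>x. f x + g x) has_derivative (\<lambda>v. fderiv f x v + fderiv g x v)) (at x)"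
    if "x \<in> S" for x
    using has_derivative_add[OF fderiv_worksD[of f x] fderiv_worksD[of g x]] Suc.prems that by auto
  have "Ck_on k S (\<lambda>x. fderiv (\<lambda>x. f x + g x) x v)" for v
    by (rule Ck_on_cong[OF assms(1), of "\<lambda>x. fderiv f x v + fderiv g x v"])
      (use Suc fderiv_eq[OF d] in auto)
  then show ?case using d by (auto simp: differentiable_def)
qed

lemma Ck_on_bounded_bilinear:
  assumes "open S" "bounded_bilinear b"
  shows "Ck_on k S f \<Longrightarrow> Ck_on k S g \<Longrightarrow> Ck_on k S (\<lambda>x. b (f x) (g x))"
proof (induction k arbitrary: f g)
  case 0
  then show ?case using assms(2) by (simp add: bounded_bilinear.continuous_on)
next
  case (Suc k)
  let ?d = "\<lambda>x v. b (f x) (fderiv g x v) + b (fderiv f x v) (g x)"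
  have d: "((\<lambda>x. b (f x) (g x)) has_derivative ?d x) (at x)" if "x \<in> S" for x
    using bounded_bilinear.FDERIV[OF assms(2) fderiv_worksD[of f x] fderiv_worksD[of g x]]
      Suc.prems that by auto
  have "Ck_on k S (\<lambda>x. fderiv (\<lambda>x. b (f x) (g x)) x v)" for v
  proof (rule Ck_on_cong[OF assms(1), of "\<lambda>x. ?d x v"])
    show "Ck_on k S (\<lambda>x. ?d x v)"
      by (intro Ck_on_add assms(1) Suc.IH Ck_on_SucD[of k S f] Ck_on_SucD[of k S g] Suc.prems)
        (use Suc.prems in simp_all)
  qed (use fderiv_eq[OF d] in auto)
  then show ?case using d by (auto simp: differentiable_def)
qed

lemma Ck_on_sum:
  assumes "open S" "\<And>i. i \<in> I \<Longrightarrow> Ck_on k S (f i)"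
  shows "Ck_on k S (\<lambda>x. \<Sum>i\<in>I. f i x)"
  using assms(2) by (induction I rule: infinite_finite_induct) (auto intro: Ck_on_add assms(1))

lemma Ck_on_ident: "open S \<Longrightarrow> Ck_on k S (\<lambda>x. x)"
  by (cases k) auto

lemma smooth_on_cong:
  "smooth_on S f \<Longrightarrow> open S \<Longrightarrow> (\<And>x. x \<in> S \<Longrightarrow> f x = g x) \<Longrightarrow> smooth_on S g"
  unfolding smooth_on_def by (blast intro: Ck_on_cong)

lemma smooth_on_subset: "smooth_on S f \<Longrightarrow> T \<subseteq> S \<Longrightarrow> smooth_on T f"
  unfolding smooth_on_def by (blast intro: Ck_on_subset)

lemma smooth_on_local:
  assumes "\<And>x. x \<in> S \<Longrightarrow> \<exists>T. open T \<and> x \<in> T \<and> smooth_on T f"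
  shows "smooth_on S f"
  unfolding smooth_on_def
proof
  show "Ck_on k S f" for k
    by (rule Ck_on_local) (metis assms smooth_on_def)
qed

lemma smooth_on_const: "smooth_on S (\<lambda>x. c)"
  unfolding smooth_on_def by blast

lemma smooth_on_ident: "open S \<Longrightarrow> smooth_on S (\<lambda>x. x)"
  unfolding smooth_on_def by (blast intro: Ck_on_ident)

lemma smooth_on_bounded_linear_compose:
  "bounded_linear L \<Longrightarrow> open S \<Longrightarrow> smooth_on S f \<Longrightarrow> smooth_on S (\<lambda>x. L (f x))"
  unfolding smooth_on_def by (blast intro: Ck_on_bounded_linear_compose)

lemma smooth_on_bounded_linear: "bounded_linear L \<Longrightarrow> open S \<Longrightarrow> smooth_on S L"
  by (rule smooth_on_bounded_linear_compose[OF _ _ smooth_on_ident])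

lemma smooth_on_bounded_bilinear:
  "bounded_bilinear b \<Longrightarrow> open S \<Longrightarrow> smooth_on S f \<Longrightarrow> smooth_on S g \<Longrightarrow> smooth_on S (\<lambda>x. b (f x) (g x))"
  unfolding smooth_on_def by (blast intro: Ck_on_bounded_bilinear)

lemma smooth_on_add:
  "open S \<Longrightarrow> smooth_on S f \<Longrightarrow> smooth_on S g \<Longrightarrow> smooth_on S (\<lambda>x. f x + g x)"
  unfolding smooth_on_def by (blast intro: Ck_on_add)

lemma smooth_on_sum:
  "open S \<Longrightarrow> (\<And>i. i \<in> I \<Longrightarrow> smooth_on S (f i)) \<Longrightarrow> smooth_on S (\<lambda>x. \<Sum>i\<in>I. f i x)"
  unfolding smooth_on_def by (blast intro: Ck_on_sum)

lemma smooth_on_diff: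
  assumes "open S" "smooth_on S f" "smooth_on S g"
  shows "smooth_on S (\<lambda>x. f x - g x)"
  using smooth_on_add[OF assms(1,2) smooth_on_bounded_linear_compose[OF _ assms(1,3), of uminus]]
    bounded_linear_minus[OF bounded_linear_ident] by simp

lemma smooth_on_Pair:
  assumes "open S" "smooth_on S f" "smooth_on S g"
  shows "smooth_on S (\<lambda>x. (f x, g x))"
proof -
  have "smooth_on S (\<lambda>x. (f x, 0) + (0, g x))"
    by (intro smooth_on_add assms smooth_on_bounded_linear_compose[of "\<lambda>x. (x, 0)"]
        smooth_on_bounded_linear_compose[of "\<lambda>x. (0, x)"] bounded_linear_Pair
        bounded_linear_ident bounded_linear_zero)
  then show ?thesis by simp
qed

lemma smooth_on_differentiable: "smooth_on S f \<Longrightarrow> x \<in> S \<Longrightarrow> f differentiable (at x)"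
  unfolding smooth_on_def using Ck_on.simps(2) by blast

lemma smooth_on_has_derivative:
  "smooth_on S f \<Longrightarrow> x \<in> S \<Longrightarrow> (f has_derivative fderiv f x) (at x)"
  by (simp add: fderiv_worksD smooth_on_differentiable)

lemma smooth_on_fderiv: "smooth_on S f \<Longrightarrow> smooth_on S (\<lambda>x. fderiv f x v)"
  unfolding smooth_on_def using Ck_on.simps(2) by blast

lemma smooth_on_continuous_on: "smooth_on S f \<Longrightarrow> continuous_on S f"
  unfolding smooth_on_def using Ck_on.simps(1) by blast

section \<open>Finite-dimensional inner product spaces\<close>

definition fin_dim :: "'a::real_inner itself \<Rightarrow> bool" where
  "fin_dim _ \<longleftrightarrow> (\<exists>Bs::'a set. finite Bs \<and> span Bs = UNIV)"

text \<open>A chosen orthonormal basis: the model space is only known to have a finite spanning set,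
  and its dimension may be 0. Coordinates in this basis reduce families of linear maps to finitely
  many columns.\<close>

definition onb :: "'a::real_inner set" where
  "onb = (SOME E. finite E \<and> (\<forall>e\<in>E. \<forall>e'\<in>E. e \<bullet> e' = (if e = e' then 1 else 0)) \<and> span E = UNIV)"

lemma onb:
  assumes "fin_dim TYPE('a::real_inner)"
  shows "finite (onb::'a set)" "\<And>e e'::'a. e \<in> onb \<Longrightarrow> e' \<in> onb \<Longrightarrow> e \<bullet> e' = (if e = e' then 1 else 0)"
    "span (onb::'a set) = UNIV"
proof -
  obtain Bs :: "'a set" where "finite Bs" "span Bs = UNIV" using assms by (auto simp: fin_dim_def)
  then obtain C :: "'a set" where C: "finite C" "span C = UNIV" "pairwise orthogonal C"
    using basis_orthogonal[of Bs] by auto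
  \<comment> \<open>The orthogonal spanning set may contain 0, which cannot be normalized and
    contributes nothing to the span.\<close>
  let ?E = "(\<lambda>c. (1 / norm c) *\<^sub>R c) ` (C - {0})"
  have "finite ?E" using C by simp
  moreover have "e \<bullet> e' = (if e = e' then 1 else 0)" if "e \<in> ?E" "e' \<in> ?E" for e e'
  proof -
    from that obtain c c' where c: "c \<in> C" "c \<noteq> 0" "e = (1 / norm c) *\<^sub>R c"
      "c' \<in> C" "c' \<noteq> 0" "e' = (1 / norm c') *\<^sub>R c'" by auto
    have 1: "e \<bullet> e = 1" using c by (simp add: dot_square_norm power2_eq_square)
    show ?thesis
    proof (cases "c = c'")
      case False
      then have "e \<bullet> e' = 0" using C(3) c by (auto simp: pairwise_def orthogonal_def)
      then show ?thesis using 1 by auto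
    qed (use c 1 in auto)
  qed
  moreover have "span ?E = UNIV"
  proof -
    have "C \<subseteq> span ?E"
    proof
      fix c assume c: "c \<in> C"
      show "c \<in> span ?E"
      proof (cases "c = 0")
        case False
        have "norm c *\<^sub>R ((1 / norm c) *\<^sub>R c) \<in> span ?E"
          by (intro span_scale span_base) (use c False in auto)
        then show ?thesis using False by simp
      qed (simp add: span_zero)
    qed
    then show ?thesis using C(2) by (metis span_mono span_span top.extremum_uniqueI)
  qed
  ultimately have "\<exists>E::'a set. finite E \<and> (\<forall>e\<in>E. \<forall>e'\<in>E. e \<bullet> e' = (if e = e' then 1 else 0)) \<and> span E = UNIV"
    by blast
  from someI_ex[OF this, folded onb_def]
  show "finite (onb::'a set)" "\<And>e e'::'a. e \<in> onb \<Longrightarrow> e' \<in> onb \<Longrightarrow> e \<bullet> e' = (if e = e' then 1 else 0)"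
    "span (onb::'a set) = UNIV" by auto
qed

lemma onb_expansion:
  assumes "fin_dim TYPE('a::real_inner)"
  shows "(\<Sum>e\<in>onb. (w \<bullet> e) *\<^sub>R e) = (w::'a)"
proof -
  have "w \<in> span onb" using onb(3)[OF assms] by simp
  then show ?thesis
  proof (induction rule: span_induct_alt)
    case base
    then show ?case by simp
  next
    case (step c x y)
    have "(\<Sum>e\<in>onb. (x \<bullet> e) *\<^sub>R e) = (\<Sum>e\<in>onb. if e = x then x else 0)"
      by (rule sum.cong) (use onb(2)[OF assms] step(1) in auto)
    also have "\<dots> = x" using step(1) onb(1)[OF assms] by simp
    finally show ?case using step
      by (simp add: inner_add_left scaleR_add_left sum.distrib scaleR_sum_right[symmetric]
          scaleR_scaleR[symmetric] del: scaleR_scaleR)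
  qed
qed

lemma linear_onb_expansion:
  assumes "fin_dim TYPE('a::real_inner)" "linear (f :: 'a \<Rightarrow> 'b::real_vector)"
  shows "f w = (\<Sum>e\<in>onb. (w \<bullet> e) *\<^sub>R f e)"
proof -
  have "f w = f (\<Sum>e\<in>onb. (w \<bullet> e) *\<^sub>R e)" by (simp add: onb_expansion[OF assms(1)])
  also have "\<dots> = (\<Sum>e\<in>onb. (w \<bullet> e) *\<^sub>R f e)"
    by (simp add: linear_sum[OF assms(2)] linear_cmul[OF assms(2)])
  finally show ?thesis .
qed

lemma bounded_linear_fin_dim:
  assumes "fin_dim TYPE('a::real_inner)" "linear (f :: 'a \<Rightarrow> 'b::real_normed_vector)"
  shows "bounded_linear f"
proof -
  have "bounded_linear (\<lambda>w. \<Sum>e\<in>onb. (w \<bullet> e) *\<^sub>R f e)"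
    by (intro bounded_linear_sum bounded_linear_scaleR_left[THEN bounded_linear_compose]
        bounded_linear_inner_left)
  then show ?thesis by (simp flip: linear_onb_expansion[OF assms])
qed

lemma bounded_bilinear_fin_dim:
  assumes "fin_dim TYPE('a::real_inner)" "fin_dim TYPE('b::real_inner)"
    "bilinear (f :: 'a \<Rightarrow> 'b \<Rightarrow> 'c::real_normed_vector)"
  shows "bounded_bilinear f"
proof -
  have l: "linear (\<lambda>x. f x y)" "linear (f x)" for x y using assms(3) by (auto simp: bilinear_def)
  have eq: "f x y = (\<Sum>e\<in>onb. \<Sum>e'\<in>onb. ((x \<bullet> e) * (y \<bullet> e')) *\<^sub>R f e e')" for x y
    by (subst linear_onb_expansion[OF assms(1) l(1)], subst linear_onb_expansion[OF assms(2) l(2)])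
      (simp add: scaleR_sum_right)
  have bl: "bounded_linear (f x)" "bounded_linear (\<lambda>x. f x y)" for x y
    using bounded_linear_fin_dim assms l by blast+
  let ?K = "\<Sum>e\<in>(onb::'a set). \<Sum>e'\<in>(onb::'b set). norm e * norm e' * norm (f e e')"
  have "norm (f x y) \<le> norm x * norm y * ?K" for x y
  proof -
    have "norm (f x y) \<le> (\<Sum>e\<in>onb. \<Sum>e'\<in>onb. norm (((x \<bullet> e) * (y \<bullet> e')) *\<^sub>R f e e'))"
      unfolding eq[of x y] by (intro order_trans[OF norm_sum] sum_mono norm_sum)
    also have "\<dots> \<le> (\<Sum>e\<in>onb. \<Sum>e'\<in>onb. (norm x * norm y) * (norm e * norm e' * norm (f e e')))"
    proof (intro sum_mono)
      fix e :: 'a and e' :: 'b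
      have "\<bar>x \<bullet> e\<bar> * \<bar>y \<bullet> e'\<bar> \<le> (norm x * norm e) * (norm y * norm e')"
        by (intro mult_mono Cauchy_Schwarz_ineq2) auto
      then have "\<bar>x \<bullet> e\<bar> * \<bar>y \<bullet> e'\<bar> * norm (f e e') \<le> (norm x * norm e) * (norm y * norm e') * norm (f e e')"
        by (rule mult_right_mono) simp
      then show "norm (((x \<bullet> e) * (y \<bullet> e')) *\<^sub>R f e e') \<le> norm x * norm y * (norm e * norm e' * norm (f e e'))"
        by (simp add: abs_mult mult_ac)
    qed
    finally show ?thesis by (simp add: sum_distrib_left)
  qed
  then have bd: "\<exists>K. \<forall>x y. norm (f x y) \<le> norm x * norm y * K" by blast
  show ?thesis
    by (intro bounded_bilinear.intro bd linear_add[OF l(1)] linear_add[OF l(2)]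
      linear_cmul[OF l(1)] linear_cmul[OF l(2)])
qed

lemma fin_dim_prod:
  assumes "fin_dim TYPE('a::real_inner)" "fin_dim TYPE('b::real_inner)"
  shows "fin_dim TYPE('a \<times> 'b)"
proof -
  let ?E = "(onb::'a set) \<times> {0::'b} \<union> {0::'a} \<times> (onb::'b set)"
  have "(x, y) \<in> span ?E" for x :: 'a and y :: 'b
  proof -
    have "(x, y) = (\<Sum>e\<in>onb. (x \<bullet> e) *\<^sub>R (e, 0)) + (\<Sum>e\<in>onb. (y \<bullet> e) *\<^sub>R (0, e))"
      by (simp add: prod_eq_iff fst_sum snd_sum onb_expansion assms)
    also have "\<dots> \<in> span ?E"
      by (intro span_add span_sum span_scale span_base) auto
    finally show ?thesis .
  qed
  then have "span ?E = UNIV" by auto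
  moreover have "finite ?E" using onb(1)[OF assms(1)] onb(1)[OF assms(2)] by auto
  ultimately show ?thesis unfolding fin_dim_def by blast
qed

text \<open>The chain rule gives a derivative of f at a moving point, applied to a moving vector.
  Expanding that vector in \<open>onb\<close> leaves products of scalar functions with columns
  \<open>fderiv f (g x) e\<close> for fixed e, and to these columns the induction hypothesis
  applies.\<close>

lemma Ck_on_compose:
  fixes g :: "'a::real_normed_vector \<Rightarrow> 'b::real_inner"
  assumes "fin_dim TYPE('b)" "open S" "open T" "g ` S \<subseteq> T"
  shows "Ck_on k T f \<Longrightarrow> Ck_on k S g \<Longrightarrow> Ck_on k S (\<lambda>x. f (g x))"
proof (induction k arbitrary: f)
  case 0
  then show ?case using assms(4) by (auto intro: continuous_on_compose2)
next
  case (Suc k)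
  have d: "((\<lambda>x. f (g x)) has_derivative (\<lambda>v. fderiv f (g x) (fderiv g x v))) (at x)" if "x \<in> S" for x
    using diff_chain_at[OF fderiv_worksD[of g x] fderiv_worksD[of f "g x"]] Suc.prems that assms(4)
    by (auto simp: o_def)
  have lin: "linear (fderiv f (g x))" if "x \<in> S" for x
    using Suc.prems(1) that assms(4) by (auto intro!: linear_frechet_derivative)
  have "Ck_on k S (\<lambda>x. fderiv (\<lambda>x. f (g x)) x v)" for v
  proof (rule Ck_on_cong[OF assms(2), of "\<lambda>x. \<Sum>e\<in>onb. (fderiv g x v \<bullet> e) *\<^sub>R fderiv f (g x) e"])
    show "Ck_on k S (\<lambda>x. \<Sum>e\<in>onb. (fderiv g x v \<bullet> e) *\<^sub>R fderiv f (g x) e)"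
      using Suc.prems
      by (intro Ck_on_sum Ck_on_bounded_bilinear[OF _ bounded_bilinear_scaleR]
          Ck_on_bounded_linear_compose[OF _ bounded_linear_inner_left] assms Suc.IH Ck_on_SucD[of k S g])
        auto
    fix x assume "x \<in> S"
    then show "(\<Sum>e\<in>onb. (fderiv g x v \<bullet> e) *\<^sub>R fderiv f (g x) e) = fderiv (\<lambda>x. f (g x)) x v"
      using fderiv_eq[OF d] linear_onb_expansion[OF assms(1) lin] by simp
  qed
  then show ?case using d by (auto simp: differentiable_def)
qed

lemma smooth_on_compose:
  fixes g :: "'a::real_normed_vector \<Rightarrow> 'b::real_inner"
  assumes "fin_dim TYPE('b)" "smooth_on T f" "smooth_on S g" "open S" "open T" "g ` S \<subseteq> T"
  shows "smooth_on S (\<lambda>x. f (g x))"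
  using assms Ck_on_compose unfolding smooth_on_def by blast

text \<open>Smoothness of f is only known on constant vectors; the expansion of the moving argument
  in \<open>onb\<close> reduces the claim to these.\<close>

lemma smooth_on_linear_apply:
  fixes a :: "'a::real_normed_vector \<Rightarrow> 'b::real_inner"
  assumes fd: "fin_dim TYPE('b)" and S: "open S" and "\<And>x. x \<in> S \<Longrightarrow> linear (f x)"
    "\<And>v. smooth_on S (\<lambda>x. f x v)" "smooth_on S a"
  shows "smooth_on S (\<lambda>x. f x (a x))"
proof (rule smooth_on_cong[OF _ S, of "\<lambda>x. \<Sum>e\<in>onb. (a x \<bullet> e) *\<^sub>R f x e"])
  show "smooth_on S (\<lambda>x. \<Sum>e\<in>onb. (a x \<bullet> e) *\<^sub>R f x e)"
    by (intro smooth_on_sum S smooth_on_bounded_bilinear[OF bounded_bilinear_scaleR]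
        smooth_on_bounded_linear_compose[OF bounded_linear_inner_left] assms)
  show "(\<Sum>e\<in>onb. (a x \<bullet> e) *\<^sub>R f x e) = f x (a x)" if "x \<in> S" for x
    by (rule linear_onb_expansion[OF fd assms(3)[OF that], symmetric])
qed

text \<open>Product rule for the evaluation of a matrix-valued function, of which only the columns are
  known to be differentiable.\<close>

lemma has_derivative_linear_apply:
  fixes a :: "'a::real_normed_vector \<Rightarrow> 'b::real_inner"
  assumes fd: "fin_dim TYPE('b)" and S: "open S" "x \<in> S" and lin: "\<And>y. y \<in> S \<Longrightarrow> linear (f y)"
    and f: "\<And>v. (\<lambda>y. f y v) differentiable (at x)" and a: "(a has_derivative a') (at x)"
  shows "((\<lambda>y. f y (a y)) has_derivative (\<lambda>w. fderiv (\<lambda>y. f y (a x)) x w + f x (a' w))) (at x)"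
proof (rule has_derivative_transform_within_open[OF _ S])
  let ?g = "\<lambda>y. \<Sum>e\<in>onb. (a y \<bullet> e) *\<^sub>R f y e"
  let ?g' = "\<lambda>w. \<Sum>e\<in>onb. (a x \<bullet> e) *\<^sub>R fderiv (\<lambda>y. f y e) x w + (a' w \<bullet> e) *\<^sub>R f x e"
  have g: "(?g has_derivative ?g') (at x)"
    by (intro has_derivative_sum has_derivative_scaleR has_derivative_inner_left a fderiv_worksD[OF f])
  have "((\<lambda>y. \<Sum>e\<in>onb. (a x \<bullet> e) *\<^sub>R f y e) has_derivative (\<lambda>w. \<Sum>e\<in>onb. (a x \<bullet> e) *\<^sub>R fderiv (\<lambda>y. f y e) x w)) (at x)"
    by (intro has_derivative_sum has_derivative_scaleR_right fderiv_worksD[OF f])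
  then have "((\<lambda>y. f y (a x)) has_derivative (\<lambda>w. \<Sum>e\<in>onb. (a x \<bullet> e) *\<^sub>R fderiv (\<lambda>y. f y e) x w)) (at x)"
    by (rule has_derivative_transform_within_open[OF _ S]) (rule linear_onb_expansion[OF fd lin, symmetric])
  from fderiv_eq[OF this] have "?g' = (\<lambda>w. fderiv (\<lambda>y. f y (a x)) x w + f x (a' w))"
    by (simp add: sum.distrib fun_eq_iff linear_onb_expansion[OF fd lin[OF S(2)], symmetric])
  then show "(?g has_derivative (\<lambda>w. fderiv (\<lambda>y. f y (a x)) x w + f x (a' w))) (at x)"
    using g by simp
  show "?g y = f y (a y)" if "y \<in> S" for y
    by (rule linear_onb_expansion[OF fd lin[OF that], symmetric])
qed

section \<open>Symmetry of second derivatives\<close>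

lemma second_difference_mvt:
  fixes g :: "'a::real_normed_vector \<Rightarrow> real"
  assumes S: "\<And>s t. 0 \<le> s \<Longrightarrow> s \<le> h \<Longrightarrow> 0 \<le> t \<Longrightarrow> t \<le> h \<Longrightarrow> x + s *\<^sub>R v + t *\<^sub>R w \<in> S"
    and g: "smooth_on S g" and h: "h > 0"
  obtains s t where "0 < s" "s < h" "0 < t" "t < h"
    "g (x + h *\<^sub>R v + h *\<^sub>R w) - g (x + h *\<^sub>R v) - g (x + h *\<^sub>R w) + g x
       = h * (h * fderiv (\<lambda>y. fderiv g y v) (x + s *\<^sub>R v + t *\<^sub>R w) w)"
proof -
  have d: "((\<lambda>s. f (y + s *\<^sub>R a)) has_real_derivative fderiv f (y + s *\<^sub>R a) a) (at s)"
    if "smooth_on S f" "y + s *\<^sub>R a \<in> S" for f :: "'a \<Rightarrow> real" and y a s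
  proof -
    have f: "(f has_derivative fderiv f (y + s *\<^sub>R a)) (at (y + s *\<^sub>R a))"
      using that by (rule smooth_on_has_derivative)
    have "((\<lambda>s. y + s *\<^sub>R a) has_derivative (\<lambda>s. s *\<^sub>R a)) (at s)"
      by (auto intro!: derivative_eq_intros)
    from diff_chain_at[OF this f] have "((\<lambda>s. f (y + s *\<^sub>R a)) has_derivative (\<lambda>r. fderiv f (y + s *\<^sub>R a) (r *\<^sub>R a))) (at s)"
      by (simp add: o_def)
    also have "(\<lambda>r. fderiv f (y + s *\<^sub>R a) (r *\<^sub>R a)) = (*) (fderiv f (y + s *\<^sub>R a) a)"
      using linear_cmul[OF linear_frechet_derivative[OF smooth_on_differentiable[OF that]]] by (simp add: fun_eq_iff)
    finally show ?thesis by (simp add: has_field_derivative_def)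
  qed
  \<comment> \<open>The difference in direction w, as a function on the segment in direction v: one
    mean value theorem is applied to it, and a second one in direction w to the resulting
    derivative.\<close>
  let ?G = "\<lambda>s. g ((x + h *\<^sub>R w) + s *\<^sub>R v) - g (x + s *\<^sub>R v)"
  have "(?G has_real_derivative fderiv g ((x + h *\<^sub>R w) + s *\<^sub>R v) v - fderiv g (x + s *\<^sub>R v) v) (at s)"
    if "0 \<le> s" "s \<le> h" for s
    using S[OF that, of h] S[OF that, of 0] h by (intro DERIV_diff d g) (auto simp: add_ac)
  from MVT2[OF h this] obtain s where s: "0 < s" "s < h"
    "?G h - ?G 0 = h * (fderiv g ((x + h *\<^sub>R w) + s *\<^sub>R v) v - fderiv g (x + s *\<^sub>R v) v)" by auto
  have "((\<lambda>t. fderiv g ((x + s *\<^sub>R v) + t *\<^sub>R w) v) has_real_derivative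
      fderiv (\<lambda>y. fderiv g y v) ((x + s *\<^sub>R v) + t *\<^sub>R w) w) (at t)"
    if "0 \<le> t" "t \<le> h" for t
    using S[OF _ _ that, of s] s by (intro d smooth_on_fderiv g) auto
  from MVT2[OF h this] obtain t where t: "0 < t" "t < h"
    "fderiv g ((x + s *\<^sub>R v) + h *\<^sub>R w) v - fderiv g (x + s *\<^sub>R v) v
       = h * fderiv (\<lambda>y. fderiv g y v) ((x + s *\<^sub>R v) + t *\<^sub>R w) w" by auto
  show ?thesis by (rule that[of s t]) (use s t in \<open>auto simp: algebra_simps\<close>)
qed

text \<open>The second difference is symmetric in v and w. Hence the two mixed derivatives agree at
  two points of an arbitrarily small parallelogram, and continuity forces agreement at x.\<close>

lemma fderiv_symmetric_real:
  fixes g :: "'a::real_normed_vector \<Rightarrow> real"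
  assumes S: "open S" "x \<in> S" and g: "smooth_on S g"
  shows "fderiv (\<lambda>y. fderiv g y v) x w = fderiv (\<lambda>y. fderiv g y w) x v"
proof (rule ccontr)
  let ?a = "\<lambda>y. fderiv (\<lambda>y. fderiv g y v) y w" and ?b = "\<lambda>y. fderiv (\<lambda>y. fderiv g y w) y v"
  assume ne: "?a x \<noteq> ?b x"
  define \<epsilon> where "\<epsilon> = \<bar>?a x - ?b x\<bar> / 2"
  have \<epsilon>: "\<epsilon> > 0" using ne by (simp add: \<epsilon>_def)
  have "continuous (at x) ?a" "continuous (at x) ?b"
    using S smooth_on_continuous_on[OF smooth_on_fderiv[OF smooth_on_fderiv[OF g]]]
    by (auto simp: continuous_on_eq_continuous_at)
  then obtain d1 d2 where d: "d1 > 0" "d2 > 0" "\<And>y. dist y x < d1 \<Longrightarrow> dist (?a y) (?a x) < \<epsilon>"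
    "\<And>y. dist y x < d2 \<Longrightarrow> dist (?b y) (?b x) < \<epsilon>"
    using \<epsilon> unfolding continuous_at_eps_delta by metis
  obtain d3 where d3: "d3 > 0" "ball x d3 \<subseteq> S" using S openE by blast
  define \<delta> where "\<delta> = Min {d1, d2, d3}"
  have \<delta>: "\<delta> > 0" "\<delta> \<le> d1" "\<delta> \<le> d2" "\<delta> \<le> d3" using d d3 by (auto simp: \<delta>_def)
  \<comment> \<open>This keeps the whole parallelogram within \<delta> of x; the summand 1 covers
    the case that v and w both vanish.\<close>
  define h where "h = \<delta> / (norm v + norm w + 1)"
  have nv: "norm v + norm w + 1 > 0" by (smt (verit) norm_ge_zero)
  have h: "h > 0" using \<delta> nv by (simp add: h_def)
  have near: "dist (x + s *\<^sub>R v + t *\<^sub>R w) x < \<delta>" if "0 \<le> s" "s \<le> h" "0 \<le> t" "t \<le> h" for s t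
  proof -
    have "dist (x + s *\<^sub>R v + t *\<^sub>R w) x = norm (s *\<^sub>R v + t *\<^sub>R w)" by (simp add: dist_norm algebra_simps)
    also have "\<dots> \<le> s * norm v + t * norm w" using norm_triangle_ineq[of "s *\<^sub>R v" "t *\<^sub>R w"] that by simp
    also have "\<dots> \<le> h * norm v + h * norm w" using that by (intro add_mono mult_right_mono) auto
    also have "\<dots> < h * (norm v + norm w + 1)" using h by (simp add: algebra_simps)
    also have "\<dots> = \<delta>" using nv by (simp add: h_def)
    finally show ?thesis .
  qed
  have inS: "x + s *\<^sub>R v + t *\<^sub>R w \<in> S" if "0 \<le> s" "s \<le> h" "0 \<le> t" "t \<le> h" for s t
    using near[OF that] \<delta> d3 by (auto simp: dist_commute)
  have inS': "x + s *\<^sub>R w + t *\<^sub>R v \<in> S" if "0 \<le> s" "s \<le> h" "0 \<le> t" "t \<le> h" for s t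
    using inS[OF that(3,4,1,2)] by (simp add: add_ac)
  obtain s t where st: "0 < s" "s < h" "0 < t" "t < h"
    "g (x + h *\<^sub>R v + h *\<^sub>R w) - g (x + h *\<^sub>R v) - g (x + h *\<^sub>R w) + g x
       = h * (h * ?a (x + s *\<^sub>R v + t *\<^sub>R w))"
    using second_difference_mvt[OF inS g h] by blast
  obtain s' t' where st': "0 < s'" "s' < h" "0 < t'" "t' < h"
    "g (x + h *\<^sub>R w + h *\<^sub>R v) - g (x + h *\<^sub>R w) - g (x + h *\<^sub>R v) + g x
       = h * (h * ?b (x + s' *\<^sub>R w + t' *\<^sub>R v))"
    using second_difference_mvt[OF inS' g h] by blast
  have "?a (x + s *\<^sub>R v + t *\<^sub>R w) = ?b (x + s' *\<^sub>R w + t' *\<^sub>R v)"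
    using st(5) st'(5) h by (simp add: add_ac diff_diff_eq)
  moreover have "dist (?a (x + s *\<^sub>R v + t *\<^sub>R w)) (?a x) < \<epsilon>"
    using near[of s t] st \<delta> by (intro d(3)) auto
  moreover have "dist (?b (x + s' *\<^sub>R w + t' *\<^sub>R v)) (?b x) < \<epsilon>"
    using near[of t' s'] st' \<delta> by (intro d(4)) (auto simp: add_ac)
  ultimately show False by (simp add: \<epsilon>_def dist_real_def abs_if split: if_splits)
qed

text \<open>Inner products with fixed vectors reduce the claim to real-valued functions.\<close>

lemma fderiv_symmetric:
  fixes f :: "'a::real_normed_vector \<Rightarrow> 'b::real_inner"
  assumes S: "open S" "x \<in> S" and f: "smooth_on S f"
  shows "fderiv (\<lambda>y. fderiv f y v) x w = fderiv (\<lambda>y. fderiv f y w) x v"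
proof -
  have i: "fderiv (\<lambda>y. k y \<bullet> b) y u = fderiv k y u \<bullet> b"
    if "smooth_on S k" "y \<in> S" for b y u and k :: "'a \<Rightarrow> 'b"
    using fderiv_eq[OF has_derivative_inner_left[OF smooth_on_has_derivative[OF that]]] by simp
  have ii: "fderiv (\<lambda>y. fderiv (\<lambda>y. f y \<bullet> b) y v) x w = fderiv (\<lambda>y. fderiv f y v) x w \<bullet> b" for b v w
    using fderiv_cong_open[OF S, of "\<lambda>y. fderiv (\<lambda>y. f y \<bullet> b) y v" "\<lambda>y. fderiv f y v \<bullet> b"]
      i[OF f] i[OF smooth_on_fderiv[OF f] S(2)] by simp
  have sm: "smooth_on S (\<lambda>y. f y \<bullet> b)" for b
    by (rule smooth_on_bounded_linear_compose[OF bounded_linear_inner_left S(1) f])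
  have "fderiv (\<lambda>y. fderiv f y v) x w \<bullet> b = fderiv (\<lambda>y. fderiv f y w) x v \<bullet> b" for b
    using fderiv_symmetric_real[OF S sm, of b v w] unfolding ii .
  then have "(fderiv (\<lambda>y. fderiv f y v) x w - fderiv (\<lambda>y. fderiv f y w) x v) \<bullet> b = 0" for b
    by (simp add: inner_diff_left)
  then show ?thesis using inner_eq_zero_iff right_minus_eq by blast
qed

section \<open>Manifolds in charts\<close>

abbreviation cimg :: "('m, 'e) atlas \<Rightarrow> 'm \<Rightarrow> 'e set" where
  "cimg M p \<equiv> cmap M p ` cdom M p"

abbreviation rep :: "('m, 'e) atlas \<Rightarrow> ('n, 'f) atlas \<Rightarrow> 'm \<Rightarrow> 'n \<Rightarrow> ('m \<Rightarrow> 'n) \<Rightarrow> 'e \<Rightarrow> 'f" where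
  "rep M N p q f \<equiv> cmap N q \<circ> f \<circ> cinv M p"

abbreviation rdom :: "('m, 'e) atlas \<Rightarrow> ('n, 'f) atlas \<Rightarrow> 'm \<Rightarrow> 'n \<Rightarrow> ('m \<Rightarrow> 'n) \<Rightarrow> 'e set" where
  "rdom M N p q f \<equiv> cmap M p ` (cdom M p \<inter> f -` cdom N q)"

text \<open>\<open>tangent_map\<close> uses the charts assigned to a point and to its image, which
  change with the point. Derivatives that have to vary smoothly are read in fixed charts p and q
  instead.\<close>

definition lderiv :: "('m, 'e::real_normed_vector) atlas \<Rightarrow> ('n, 'f::real_normed_vector) atlas
    \<Rightarrow> 'm \<Rightarrow> 'n \<Rightarrow> ('m \<Rightarrow> 'n) \<Rightarrow> 'e \<Rightarrow> 'e \<Rightarrow> 'f" where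
  "lderiv M N p q f u = fderiv (rep M N p q f) u"

lemma tangent_map_lderiv: "tangent_map M N f x = lderiv M N x (f x) f (cmap M x x)"
  by (simp add: tangent_map_def lderiv_def)

lemma transition_lderiv: "transition M p q u = lderiv M M p q (\<lambda>x. x) u"
  by (simp add: transition_def lderiv_def o_def)

context
  fixes M :: "('m::{t2_space, second_countable_topology}, 'e::real_inner) atlas"
  assumes M: "smooth_manifold M"
begin

lemma manifold_fin_dim: "fin_dim TYPE('e)"
  using M by (auto simp: smooth_manifold_def fin_dim_def)

lemma chart_centre [simp]: "p \<in> cdom M p"
  and open_cdom: "open (cdom M p)"
  and open_cimg: "open (cimg M p)"
  using M by (auto simp: smooth_manifold_def)

lemma chart_homeo: "homeomorphism (cdom M p) (cimg M p) (cmap M p) (cinv M p)"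
  using M unfolding smooth_manifold_def by blast

lemma cinv_cmap [simp]: "x \<in> cdom M p \<Longrightarrow> cinv M p (cmap M p x) = x"
  using chart_homeo by (simp add: homeomorphism_def)

lemma cmap_cinv [simp]: "u \<in> cimg M p \<Longrightarrow> cmap M p (cinv M p u) = u"
  by auto

lemma cinv_in_cdom [simp]: "u \<in> cimg M p \<Longrightarrow> cinv M p u \<in> cdom M p"
  using chart_homeo by auto

lemma rdom_iff: "u \<in> rdom M N p q f \<longleftrightarrow> u \<in> cimg M p \<and> f (cinv M p u) \<in> cdom N q"
  by (auto simp: image_iff)

lemma rdom_ident_iff: "u \<in> cmap M p ` (cdom M p \<inter> cdom M q) \<longleftrightarrow> u \<in> cimg M p \<and> cinv M p u \<in> cdom M q"
  by (auto simp: image_iff)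

lemma continuous_on_cinv: "continuous_on (cimg M p) (cinv M p)"
  using chart_homeo by (simp add: homeomorphism_def)

lemma continuous_on_cmap: "continuous_on (cdom M p) (cmap M p)"
  using chart_homeo by (simp add: homeomorphism_def)

lemma open_vimage_cinv:
  assumes "open T" shows "open {u \<in> cimg M p. cinv M p u \<in> T}"
  using continuous_open_preimage[OF continuous_on_cinv open_cimg assms]
  by (simp add: vimage_def Int_def conj_commute)

lemma smooth_map_ident: "smooth_map M M (\<lambda>x. x)"
  using M by (auto simp: smooth_map_def smooth_manifold_def o_def)

end

context
  fixes M N
  assumes M: "smooth_manifold M" and N: "smooth_manifold N"
begin

lemma open_rdom:
  assumes "smooth_map M N f" shows "open (rdom M N p q f)"
proof -
  have "open (f -` cdom N q)"
    using assms open_cdom[OF N] by (auto simp: smooth_map_def continuous_on_open_vimage)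
  from open_vimage_cinv[OF M this, of p] show ?thesis
    by (rule back_subst[of "open"]) (auto simp: M)
qed

lemma smooth_on_rep: "smooth_map M N f \<Longrightarrow> smooth_on (rdom M N p q f) (rep M N p q f)"
  by (simp add: smooth_map_def)

lemma rep_has_derivative:
  assumes "smooth_map M N f" "u \<in> rdom M N p q f"
  shows "(rep M N p q f has_derivative lderiv M N p q f u) (at u)"
  unfolding lderiv_def using smooth_on_has_derivative[OF smooth_on_rep] assms by blast

lemma lderiv_linear:
  "smooth_map M N f \<Longrightarrow> u \<in> rdom M N p q f \<Longrightarrow> linear (lderiv M N p q f u)"
  using rep_has_derivative has_derivative_linear by blast

lemma lderiv_smooth: "smooth_map M N f \<Longrightarrow> smooth_on (rdom M N p q f) (\<lambda>u. lderiv M N p q f u v)"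
  unfolding lderiv_def by (intro smooth_on_fderiv smooth_on_rep)

lemma tangent_map_linear: "smooth_map M N f \<Longrightarrow> linear (tangent_map M N f x)"
  unfolding tangent_map_lderiv by (rule lderiv_linear) (auto simp: M N)

lemma smooth_map_const: "smooth_map M N (\<lambda>x. c)"
  unfolding smooth_map_def by (auto simp: o_def intro: smooth_on_const)

lemma lderiv_const: "lderiv M N p q (\<lambda>x. c) u = (\<lambda>v. 0)"
  unfolding lderiv_def by (simp add: o_def)

end

context
  fixes M N K
  assumes M: "smooth_manifold M" and N: "smooth_manifold N" and K: "smooth_manifold K"
begin

lemma smooth_map_compose:
  assumes f: "smooth_map M N f" and g: "smooth_map N K g"
  shows "smooth_map M K (\<lambda>x. g (f x))"
proof -
  have cont: "continuous_on UNIV (\<lambda>x. g (f x))"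
    using f g unfolding smooth_map_def by (auto intro: continuous_on_compose2)
  have "smooth_on (rdom M K p r (\<lambda>x. g (f x))) (rep M K p r (\<lambda>x. g (f x)))" for p r
  proof (rule smooth_on_local)
    fix u assume u: "u \<in> rdom M K p r (\<lambda>x. g (f x))"
    \<comment> \<open>The chart assigned to the image point serves as intermediate chart. It is only
      good near u, which is why smoothness is proved locally.\<close>
    let ?q = "f (cinv M p u)"
    have "open ((\<lambda>x. g (f x)) -` cdom K r)"
      using cont open_cdom[OF K] by (simp add: continuous_on_open_vimage)
    from open_vimage_cinv[OF M this, of p] have o: "open (rdom M K p r (\<lambda>x. g (f x)))"
      by (rule back_subst[of "open"]) (auto simp: M)
    let ?T = "rdom M N p ?q f \<inter> rdom M K p r (\<lambda>x. g (f x))"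
    have T: "open ?T" using o open_rdom[OF M N f] by blast
    have "smooth_on ?T (\<lambda>u. rep N K ?q r g (rep M N p ?q f u))"
    proof (rule smooth_on_compose[OF manifold_fin_dim[OF N] smooth_on_rep[OF N K g] _ T open_rdom[OF N K g]])
      show "smooth_on ?T (rep M N p ?q f)" by (rule smooth_on_subset[OF smooth_on_rep[OF M N f]]) auto
      show "rep M N p ?q f ` ?T \<subseteq> rdom N K ?q r g"
        by (intro image_subsetI, simp only: Int_iff rdom_iff[OF M] rdom_iff[OF N]) (auto simp: M N)
    qed
    then have "smooth_on ?T (rep M K p r (\<lambda>x. g (f x)))"
      by (rule smooth_on_cong[OF _ T]) (simp only: Int_iff rdom_iff[OF M], simp add: M N)
    moreover have "u \<in> ?T" using u by (simp add: rdom_iff[OF M] N)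
    ultimately show "\<exists>T. open T \<and> u \<in> T \<and> smooth_on T (rep M K p r (\<lambda>x. g (f x)))" using T by blast
  qed
  then show ?thesis using cont by (simp add: smooth_map_def)
qed

lemma lderiv_compose:
  assumes f: "smooth_map M N f" and g: "smooth_map N K g"
    and u: "u \<in> rdom M N p q f" "g (f (cinv M p u)) \<in> cdom K r"
  shows "lderiv M K p r (\<lambda>x. g (f x)) u v = lderiv N K q r g (rep M N p q f u) (lderiv M N p q f u v)"
proof -
  have "rep M N p q f u \<in> rdom N K q r g" using u by (auto simp: M)
  from diff_chain_at[OF rep_has_derivative[OF M N f u(1)] rep_has_derivative[OF N K g this]]
  have "(rep M K p r (\<lambda>x. g (f x)) has_derivative (\<lambda>v. lderiv N K q r g (rep M N p q f u) (lderiv M N p q f u v))) (at u)"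
    unfolding o_def[of _ "lderiv M N p q f u"]
    by (rule has_derivative_transform_within_open[OF _ open_rdom[OF M N f] u(1)]) (auto simp: M N)
  from fderiv_eq[OF this] show ?thesis by (simp add: lderiv_def)
qed

lemma tangent_map_compose:
  assumes f: "smooth_map M N f" and g: "smooth_map N K g"
  shows "tangent_map M K (\<lambda>x. g (f x)) x v = tangent_map N K g (f x) (tangent_map M N f x v)"
  unfolding tangent_map_lderiv
  by (subst lderiv_compose[OF f g, of _ x "f x"]) (auto simp: M N K)

end

context
  fixes M N
  assumes M: "smooth_manifold M" and N: "smooth_manifold N"
begin

text \<open>A change of chart is the derivative of the identity map, so this and the counterpart for
  the target chart are instances of the chain rule.\<close>

lemma lderiv_transition_right:
  assumes f: "smooth_map M N f" and u: "u \<in> rdom M N p q f" and p': "cinv M p u \<in> cdom M p'"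
  shows "lderiv M N p' q f (cmap M p' (cinv M p u)) (transition M p p' u v) = lderiv M N p q f u v"
  unfolding transition_lderiv
  by (subst lderiv_compose[OF M M N smooth_map_ident[OF M] f, of u p p', simplified])
     (use u p' in \<open>auto simp: M rdom_iff[OF M] rdom_ident_iff[OF M] rdom_ident_iff[OF N]\<close>)

lemma lderiv_transition_left:
  assumes f: "smooth_map M N f" and u: "u \<in> rdom M N p q f" and q': "f (cinv M p u) \<in> cdom N q'"
  shows "transition N q q' (rep M N p q f u) (lderiv M N p q f u v) = lderiv M N p q' f u v"
  unfolding transition_lderiv
  by (subst lderiv_compose[OF M N N f smooth_map_ident[OF N], of u p q, simplified])
     (use u q' in \<open>auto simp: M rdom_iff[OF M] rdom_ident_iff[OF M] rdom_ident_iff[OF N]\<close>)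

lemma tangent_map_transition:
  assumes f: "smooth_map M N f" and u: "u \<in> cimg M p"
  shows "tangent_map M N f (cinv M p u) (transition M p (cinv M p u) u v) = lderiv M N p (f (cinv M p u)) f u v"
  unfolding tangent_map_lderiv
  by (rule lderiv_transition_right[OF f]) (use u in \<open>auto simp: M N rdom_iff[OF M] rdom_ident_iff[OF M] rdom_ident_iff[OF N]\<close>)

lemma transition_self: "u \<in> cimg M p \<Longrightarrow> transition M p p u v = v"
proof -
  assume u: "u \<in> cimg M p"
  have "((\<lambda>u. u) has_derivative (\<lambda>v. v)) (at u)" by simp
  then have "((cmap M p \<circ> cinv M p) has_derivative (\<lambda>v. v)) (at u)"
    by (rule has_derivative_transform_within_open[OF _ open_cimg[OF M] u]) (simp add: M)
  from fderiv_eq[OF this] show ?thesis by (simp add: transition_def)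
qed

lemma transition_centre [simp]: "transition M p p (cmap M p p) v = v"
  by (rule transition_self) (simp add: M)

lemma tangent_map_ident: "tangent_map M M (\<lambda>x. x) x v = v"
  using transition_centre by (simp add: tangent_map_lderiv transition_lderiv)

lemma tangent_map_const: "tangent_map M N (\<lambda>x. c) x v = 0"
  by (simp add: tangent_map_lderiv lderiv_const[OF M N])

lemma transition_linear:
  assumes "u \<in> cimg M p" "cinv M p u \<in> cdom M q"
  shows "linear (transition M p q u)"
  unfolding transition_lderiv by (rule lderiv_linear[OF M M smooth_map_ident[OF M]])
    (use assms in \<open>auto simp: rdom_iff[OF M] rdom_ident_iff[OF M] rdom_ident_iff[OF N]\<close>)

lemma transition_compose:
  assumes "u \<in> cimg M p" "cinv M p u \<in> cdom M q" "cinv M p u \<in> cdom M r"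
  shows "transition M q r (cmap M q (cinv M p u)) (transition M p q u v) = transition M p r u v"
  unfolding transition_lderiv
  by (subst lderiv_compose[OF M M M smooth_map_ident[OF M] smooth_map_ident[OF M], of u p q r v, simplified])
     (use assms in \<open>auto simp: rdom_iff[OF M] rdom_ident_iff[OF M] rdom_ident_iff[OF N]\<close>)

lemma transition_inverse:
  assumes "u \<in> cimg M p" "cinv M p u \<in> cdom M q"
  shows "transition M q p (cmap M q (cinv M p u)) (transition M p q u v) = v"
  by (subst transition_compose) (use assms in \<open>auto simp: M transition_self\<close>)

lemma local_vf_eq: "local_vf M p X u = transition M (cinv M p u) p (cmap M (cinv M p u) (cinv M p u)) (X (cinv M p u))"
  by (simp add: local_vf_def Let_def)

lemma local_vf_centre [simp]: "local_vf M p X (cmap M p p) = X p"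
  by (simp add: local_vf_eq M)

lemma local_form_centre [simp]: "local_form M p \<omega> (cmap M p p) vs = \<omega> p vs"
proof -
  have "map (transition M p p (cmap M p p)) vs = vs" by (rule map_idI) simp
  then show ?thesis by (simp add: local_form_def M)
qed

end

section \<open>Products of manifolds\<close>

lemma cdom_prod [simp]: "cdom (prod_atlas M N) (p, q) = cdom M p \<times> cdom N q"
  by (simp add: prod_atlas_def cdom_def)

lemma cmap_prod [simp]: "cmap (prod_atlas M N) (p, q) = map_prod (cmap M p) (cmap N q)"
  by (simp add: prod_atlas_def cmap_def)

lemma cimg_prod: "cimg (prod_atlas M N) (p, q) = cimg M p \<times> cimg N q"
  by (force simp: image_iff)

context
  fixes M N
  assumes M: "smooth_manifold M" and N: "smooth_manifold N"
begin

lemma cinv_prod: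
  assumes "u \<in> cimg M p" "v \<in> cimg N q"
  shows "cinv (prod_atlas M N) (p, q) (u, v) = (cinv M p u, cinv N q v)"
proof -
  have inj: "inj_on (cmap M p) (cdom M p)" "inj_on (cmap N q) (cdom N q)"
    by (metis inj_onI cinv_cmap M) (metis inj_onI cinv_cmap N)
  have "inj_on (map_prod (cmap M p) (cmap N q)) (cdom M p \<times> cdom N q)"
    using map_prod_inj_on[OF inj] .
  from inv_into_f_f[OF this, of "(cinv M p u, cinv N q v)"] assms show ?thesis
    by (simp add: cinv_def[of "prod_atlas M N"] M N)
qed

lemma smooth_manifold_prod: "smooth_manifold (prod_atlas M N)"
proof -
  note fd = fin_dim_prod[OF manifold_fin_dim[OF M] manifold_fin_dim[OF N], unfolded fin_dim_def]
  have ch: "p \<in> cdom (prod_atlas M N) p \<and> open (cdom (prod_atlas M N) p) \<and> open (cimg (prod_atlas M N) p) \<and>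
      homeomorphism (cdom (prod_atlas M N) p) (cimg (prod_atlas M N) p) (cmap (prod_atlas M N) p) (cinv (prod_atlas M N) p)" for p
  proof (cases p)
    case (Pair a b)
    have 1: "continuous_on (cdom M a \<times> cdom N b) (map_prod (cmap M a) (cmap N b))"
      unfolding map_prod_def split_beta
      by (intro continuous_on_Pair continuous_on_compose2[OF continuous_on_cmap[OF M]]
          continuous_on_compose2[OF continuous_on_cmap[OF N]] continuous_on_fst continuous_on_snd continuous_on_id) auto
    have "continuous_on (cimg M a \<times> cimg N b) (\<lambda>u. (cinv M a (fst u), cinv N b (snd u)))"
      by (intro continuous_on_Pair continuous_on_compose2[OF continuous_on_cinv[OF M]]
          continuous_on_compose2[OF continuous_on_cinv[OF N]] continuous_on_fst continuous_on_snd continuous_on_id) auto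
    then have 2: "continuous_on (cimg M a \<times> cimg N b) (cinv (prod_atlas M N) (a, b))"
      by (rule continuous_on_eq) (auto simp: cinv_prod)
    have "homeomorphism (cdom M a \<times> cdom N b) (cimg M a \<times> cimg N b) (map_prod (cmap M a) (cmap N b)) (cinv (prod_atlas M N) (a, b))"
      using 1 2 by (intro homeomorphismI) (auto simp: cinv_prod M N)
    then show ?thesis
      unfolding Pair cimg_prod by (simp add: M N open_Times open_cdom open_cimg)
  qed
  have sm: "smooth_on (cmap (prod_atlas M N) p ` (cdom (prod_atlas M N) p \<inter> cdom (prod_atlas M N) q))
      (cmap (prod_atlas M N) q \<circ> cinv (prod_atlas M N) p)" for p q
  proof -
    obtain a b c d where pq: "p = (a, b)" "q = (c, d)" by (metis surj_pair)
    let ?S1 = "rdom M M a c (\<lambda>x. x)" and ?S2 = "rdom N N b d (\<lambda>x. x)"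
    let ?S = "?S1 \<times> ?S2"
    have o: "open ?S1" "open ?S2" using open_rdom M N smooth_map_ident by blast+
    then have S: "open ?S" by (rule open_Times)
    have "smooth_on ?S1 (cmap M c \<circ> cinv M a)" "smooth_on ?S2 (cmap N d \<circ> cinv N b)"
      using M N by (auto simp: smooth_manifold_def)
    then have "smooth_on ?S (\<lambda>u. ((cmap M c \<circ> cinv M a) (fst u), (cmap N d \<circ> cinv N b) (snd u)))"
      by (intro smooth_on_Pair S smooth_on_compose[OF manifold_fin_dim[OF M] _ smooth_on_bounded_linear[OF bounded_linear_fst S] S o(1)]
        smooth_on_compose[OF manifold_fin_dim[OF N] _ smooth_on_bounded_linear[OF bounded_linear_snd S] S o(2)]) (auto simp: o_def)
    then have "smooth_on ?S (cmap (prod_atlas M N) q \<circ> cinv (prod_atlas M N) p)"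
      by (rule smooth_on_cong[OF _ S]) (auto simp: pq cinv_prod)
    moreover have "?S = cmap (prod_atlas M N) p ` (cdom (prod_atlas M N) p \<inter> cdom (prod_atlas M N) q)"
      unfolding pq by (force simp: image_iff)
    ultimately show ?thesis by simp
  qed
  show ?thesis unfolding smooth_manifold_def using fd ch sm by blast
qed

lemma smooth_map_fst: "smooth_map (prod_atlas M N) M fst"
proof -
  have "smooth_on (rdom (prod_atlas M N) M (a, b) c fst) (rep (prod_atlas M N) M (a, b) c fst)" for a b c
  proof -
    let ?S = "cmap M a ` (cdom M a \<inter> cdom M c) \<times> cimg N b"
    have o: "open (cmap M a ` (cdom M a \<inter> cdom M c))"
      using open_rdom[OF M M smooth_map_ident[OF M], of a c] by simp
    have S: "open ?S" using o open_cimg[OF N] by (intro open_Times)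
    have "smooth_on ?S (\<lambda>u. rep M M a c (\<lambda>x. x) (fst u))"
      using smooth_on_rep[OF M M smooth_map_ident[OF M], of a c] unfolding o_def
      by (intro smooth_on_compose[OF manifold_fin_dim[OF M] _ smooth_on_bounded_linear[OF bounded_linear_fst S] S o]) auto
    then have "smooth_on ?S (rep (prod_atlas M N) M (a, b) c fst)"
      by (rule smooth_on_cong[OF _ S]) (auto simp: cinv_prod M)
    moreover have "?S = rdom (prod_atlas M N) M (a, b) c fst" by (force simp: image_iff)
    ultimately show ?thesis by simp
  qed
  then show ?thesis by (auto simp: smooth_map_def intro: continuous_on_fst continuous_on_id)
qed

lemma smooth_map_snd: "smooth_map (prod_atlas M N) N snd"
proof -
  have "smooth_on (rdom (prod_atlas M N) N (a, b) c snd) (rep (prod_atlas M N) N (a, b) c snd)" for a b c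
  proof -
    let ?S = "cimg M a \<times> cmap N b ` (cdom N b \<inter> cdom N c)"
    have o: "open (cmap N b ` (cdom N b \<inter> cdom N c))"
      using open_rdom[OF N N smooth_map_ident[OF N], of b c] by simp
    have S: "open ?S" using o open_cimg[OF M] by (intro open_Times)
    have "smooth_on ?S (\<lambda>u. rep N N b c (\<lambda>x. x) (snd u))"
      using smooth_on_rep[OF N N smooth_map_ident[OF N], of b c] unfolding o_def
      by (intro smooth_on_compose[OF manifold_fin_dim[OF N] _ smooth_on_bounded_linear[OF bounded_linear_snd S] S o]) auto
    then have "smooth_on ?S (rep (prod_atlas M N) N (a, b) c snd)"
      by (rule smooth_on_cong[OF _ S]) (auto simp: cinv_prod N)
    moreover have "?S = rdom (prod_atlas M N) N (a, b) c snd" by (force simp: image_iff)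
    ultimately show ?thesis by simp
  qed
  then show ?thesis by (auto simp: smooth_map_def intro: continuous_on_snd continuous_on_id)
qed

end

context
  fixes M N K
  assumes M: "smooth_manifold M" and N: "smooth_manifold N" and K: "smooth_manifold K"
begin

lemma smooth_map_Pair:
  assumes f: "smooth_map K M f" and g: "smooth_map K N g"
  shows "smooth_map K (prod_atlas M N) (\<lambda>x. (f x, g x))"
proof -
  have "smooth_on (rdom K (prod_atlas M N) r (a, b) (\<lambda>x. (f x, g x))) (rep K (prod_atlas M N) r (a, b) (\<lambda>x. (f x, g x)))" for r a b
  proof -
    let ?S = "rdom K M r a f \<inter> rdom K N r b g"
    have S: "open ?S" by (intro open_Int open_rdom M N K f g)
    have "smooth_on ?S (\<lambda>u. (rep K M r a f u, rep K N r b g u))"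
      by (intro smooth_on_Pair S smooth_on_subset[OF smooth_on_rep[OF K M f]] smooth_on_subset[OF smooth_on_rep[OF K N g]]) auto
    moreover have "?S = rdom K (prod_atlas M N) r (a, b) (\<lambda>x. (f x, g x))"
      by (rule set_eqI) (simp only: Int_iff rdom_iff[OF K], auto)
    ultimately show ?thesis by (simp add: o_def)
  qed
  then show ?thesis using f g by (auto simp: smooth_map_def intro: continuous_on_Pair)
qed

lemma lderiv_Pair:
  assumes f: "smooth_map K M f" and g: "smooth_map K N g"
    and u: "u \<in> rdom K M r a f" "u \<in> rdom K N r b g"
  shows "lderiv K (prod_atlas M N) r (a, b) (\<lambda>x. (f x, g x)) u v = (lderiv K M r a f u v, lderiv K N r b g u v)"
  using fderiv_eq[OF has_derivative_Pair[OF rep_has_derivative[OF K M f u(1)] rep_has_derivative[OF K N g u(2)]]]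
  by (simp add: lderiv_def o_def)

lemma tangent_map_Pair:
  assumes "smooth_map K M f" "smooth_map K N g"
  shows "tangent_map K (prod_atlas M N) (\<lambda>x. (f x, g x)) x v = (tangent_map K M f x v, tangent_map K N g x v)"
  unfolding tangent_map_lderiv by (rule lderiv_Pair[OF assms]) (auto simp: M N K)

end

context
  fixes M N K
  assumes M: "smooth_manifold M" and N: "smooth_manifold N" and K: "smooth_manifold K"
begin

text \<open>Chain rule for F after the inclusion of a slice, whose derivative is the inclusion of
  the first summand.\<close>

lemma lderiv_partial_left:
  assumes F: "smooth_map (prod_atlas M N) K F" and u: "u \<in> cimg M a" "w \<in> cimg N b"
    and r: "F (cinv M a u, cinv N b w) \<in> cdom K r"
  shows "lderiv (prod_atlas M N) K (a, b) r F (u, w) (v, 0) = lderiv M K a r (\<lambda>x. F (x, cinv N b w)) u v"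
proof -
  let ?i = "\<lambda>x. (x, cinv N b w)"
  have i: "smooth_map M (prod_atlas M N) ?i"
    by (intro smooth_map_Pair[OF M N M] smooth_map_ident smooth_map_const M N)
  have "lderiv M (prod_atlas M N) a (a, b) ?i u v = (lderiv M M a a (\<lambda>x. x) u v, lderiv M N a b (\<lambda>x. cinv N b w) u v)"
    by (rule lderiv_Pair[OF M N M smooth_map_ident[OF M] smooth_map_const[OF M N]])
      (use u in \<open>auto simp only: rdom_iff[OF M] cinv_in_cdom[OF M] cinv_in_cdom[OF N]\<close>)
  then have "lderiv M (prod_atlas M N) a (a, b) ?i u v = (v, 0)"
    using u transition_self[OF M M u(1)] by (simp add: transition_lderiv lderiv_const[OF M N])
  moreover have "rep M (prod_atlas M N) a (a, b) ?i u = (u, w)" using u by (simp add: M N)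
  moreover have "u \<in> rdom M (prod_atlas M N) a (a, b) ?i"
    unfolding rdom_iff[OF M] using u by (simp add: M N)
  ultimately show ?thesis
    using lderiv_compose[OF M smooth_manifold_prod[OF M N] K i F, of u a "(a, b)" r v] r by simp
qed

lemma lderiv_partial_right:
  assumes F: "smooth_map (prod_atlas M N) K F" and u: "u \<in> cimg M a" "w \<in> cimg N b"
    and r: "F (cinv M a u, cinv N b w) \<in> cdom K r"
  shows "lderiv (prod_atlas M N) K (a, b) r F (u, w) (0, v) = lderiv N K b r (\<lambda>y. F (cinv M a u, y)) w v"
proof -
  let ?i = "\<lambda>y. (cinv M a u, y)"
  have i: "smooth_map N (prod_atlas M N) ?i"
    by (intro smooth_map_Pair[OF M N N] smooth_map_ident smooth_map_const M N)
  have "lderiv N (prod_atlas M N) b (a, b) ?i w v = (lderiv N M b a (\<lambda>x. cinv M a u) w v, lderiv N N b b (\<lambda>x. x) w v)"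
    by (rule lderiv_Pair[OF M N N smooth_map_const[OF N M] smooth_map_ident[OF N]])
      (use u in \<open>auto simp only: rdom_iff[OF N] cinv_in_cdom[OF M] cinv_in_cdom[OF N]\<close>)
  then have "lderiv N (prod_atlas M N) b (a, b) ?i w v = (0, v)"
    using u transition_self[OF N N u(2)] by (simp add: transition_lderiv lderiv_const[OF N M])
  moreover have "rep N (prod_atlas M N) b (a, b) ?i w = (u, w)" using u by (simp add: M N)
  moreover have "w \<in> rdom N (prod_atlas M N) b (a, b) ?i"
    unfolding rdom_iff[OF N] using u by (simp add: M N)
  ultimately show ?thesis
    using lderiv_compose[OF N smooth_manifold_prod[OF M N] K i F, of w b "(a, b)" r v] r by simp
qed

lemma lderiv_partial:
  assumes F: "smooth_map (prod_atlas M N) K F" and u: "u \<in> cimg M a" "w \<in> cimg N b"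
    and r: "F (cinv M a u, cinv N b w) \<in> cdom K r"
  shows "lderiv (prod_atlas M N) K (a, b) r F (u, w) (v1, v2)
    = lderiv M K a r (\<lambda>x. F (x, cinv N b w)) u v1 + lderiv N K b r (\<lambda>y. F (cinv M a u, y)) w v2"
proof -
  note MN = smooth_manifold_prod[OF M N]
  have "(u, w) \<in> rdom (prod_atlas M N) K (a, b) r F"
    unfolding rdom_iff[OF MN] using u r by (auto simp: cimg_prod cinv_prod[OF M N])
  from linear_add[OF lderiv_linear[OF MN K F this], of "(v1, 0)" "(0, v2)"] show ?thesis
    using lderiv_partial_left[OF F u r] lderiv_partial_right[OF F u r] by simp
qed

lemma tangent_map_partial:
  assumes F: "smooth_map (prod_atlas M N) K F"
  shows "tangent_map (prod_atlas M N) K F (x, y) (v1, v2)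
    = tangent_map M K (\<lambda>x. F (x, y)) x v1 + tangent_map N K (\<lambda>y. F (x, y)) y v2"
  unfolding tangent_map_lderiv using lderiv_partial[OF F, of "cmap M x x" x "cmap N y y" y "F (x, y)"]
  by (simp add: M N K)

end

context
  fixes M N
  assumes M: "smooth_manifold M" and N: "smooth_manifold N"
begin

lemma tangent_map_fst: "tangent_map (prod_atlas M N) M fst (x, y) v = fst v"
  using tangent_map_partial[OF M N M smooth_map_fst[OF M N], of x y "fst v" "snd v"]
  by (simp add: tangent_map_ident[OF M M] tangent_map_const[OF N M])

lemma tangent_map_snd: "tangent_map (prod_atlas M N) N snd (x, y) v = snd v"
  using tangent_map_partial[OF M N N smooth_map_snd[OF M N], of x y "fst v" "snd v"]
  by (simp add: tangent_map_ident[OF N N] tangent_map_const[OF M N])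

lemma lderiv_fst:
  assumes "u \<in> cimg M a" "w \<in> cimg N b" "cinv M a u \<in> cdom M c"
  shows "lderiv (prod_atlas M N) M (a, b) c fst (u, w) (v1, v2) = transition M a c u v1"
  using lderiv_partial[OF M N M smooth_map_fst[OF M N] assms(1,2), of c v1 v2] assms
  by (simp add: transition_lderiv lderiv_const[OF N M])

lemma lderiv_snd:
  assumes "u \<in> cimg M a" "w \<in> cimg N b" "cinv N b w \<in> cdom N c"
  shows "lderiv (prod_atlas M N) N (a, b) c snd (u, w) (v1, v2) = transition N b c w v2"
  using lderiv_partial[OF M N N smooth_map_snd[OF M N] assms(1,2), of c v1 v2] assms
  by (simp add: transition_lderiv lderiv_const[OF M N])

lemma transition_prod:
  assumes "u \<in> cimg M a" "w \<in> cimg N b" "cinv M a u \<in> cdom M c" "cinv N b w \<in> cdom N d"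
  shows "transition (prod_atlas M N) (a, b) (c, d) (u, w) (v1, v2) = (transition M a c u v1, transition N b d w v2)"
proof -
  note MN = smooth_manifold_prod[OF M N]
  have in_dom: "(u, w) \<in> rdom (prod_atlas M N) M (a, b) c fst" "(u, w) \<in> rdom (prod_atlas M N) N (a, b) d snd"
    unfolding rdom_iff[OF MN] using assms by (auto simp: cimg_prod cinv_prod[OF M N])
  have "transition (prod_atlas M N) (a, b) (c, d) (u, w) (v1, v2)
      = lderiv (prod_atlas M N) (prod_atlas M N) (a, b) (c, d) (\<lambda>x. (fst x, snd x)) (u, w) (v1, v2)"
    by (simp add: transition_lderiv)
  also have "\<dots> = (lderiv (prod_atlas M N) M (a, b) c fst (u, w) (v1, v2), lderiv (prod_atlas M N) N (a, b) d snd (u, w) (v1, v2))"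
    by (rule lderiv_Pair[OF M N MN smooth_map_fst[OF M N] smooth_map_snd[OF M N] in_dom])
  also have "lderiv (prod_atlas M N) M (a, b) c fst (u, w) (v1, v2) = transition M a c u v1"
    by (rule lderiv_fst) (use assms in auto)
  also have "lderiv (prod_atlas M N) N (a, b) d snd (u, w) (v1, v2) = transition N b d w v2"
    by (rule lderiv_snd) (use assms in auto)
  finally show ?thesis .
qed

end

section \<open>Alternating sums and wedge products\<close>

text \<open>One argument is singled out, with the sign of its position. With \<psi> a covector times
  a form this is a wedge product, with \<psi> a directional derivative it is the exterior
  derivative; treating both alike makes their signs a matter of \<open>alt_sum_swap\<close>.\<close>

definition alt_sum :: "('e \<Rightarrow> 'e list \<Rightarrow> real) \<Rightarrow> 'e list \<Rightarrow> real" where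
  "alt_sum \<psi> vs = (\<Sum>i<length vs. (-1) ^ i * \<psi> (vs ! i) (take i vs @ drop (Suc i) vs))"

lemma alt_sum_Nil [simp]: "alt_sum \<psi> [] = 0"
  by (simp add: alt_sum_def)

lemma alt_sum_Cons [simp]: "alt_sum \<psi> (v # vs) = \<psi> v vs - alt_sum (\<lambda>w r. \<psi> w (v # r)) vs"
  unfolding alt_sum_def by (simp add: sum.lessThan_Suc_shift sum_negf del: sum.lessThan_Suc)

lemma alt_sum_add: "alt_sum (\<lambda>w r. f w r + g w r) vs = alt_sum f vs + alt_sum g vs"
  by (simp add: alt_sum_def distrib_left sum.distrib)

lemma alt_sum_add_fun: "alt_sum (\<lambda>w r. f w r + g w r) = (\<lambda>vs. alt_sum f vs + alt_sum g vs)"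
  by (rule ext) (rule alt_sum_add)

lemma alt_sum_uminus: "alt_sum (\<lambda>w r. - f w r) vs = - alt_sum f vs"
  by (simp add: alt_sum_def sum_negf)

lemma alt_sum_diff: "alt_sum (\<lambda>w r. f w r - g w r) vs = alt_sum f vs - alt_sum g vs"
  using alt_sum_add[of f "\<lambda>w r. - g w r"] by (simp add: alt_sum_uminus)

lemma alt_sum_scale: "alt_sum (\<lambda>w r. c * f w r) vs = c * alt_sum f vs"
  by (simp add: alt_sum_def sum_distrib_left mult_ac)

text \<open>Of two extracted arguments, the later one has its position shifted by one if the earlier
  one is taken out first; reversing the order of extraction therefore costs one sign.\<close>

lemma alt_sum_swap:
  "alt_sum (\<lambda>w. alt_sum (\<lambda>z. \<beta> w z)) vs = - alt_sum (\<lambda>w. alt_sum (\<lambda>z. \<beta> z w)) vs"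
proof (induction vs arbitrary: \<beta>)
  case (Cons v vs)
  show ?case using Cons.IH[of "\<lambda>w z r. \<beta> w z (v # r)"]
    by (simp add: alt_sum_diff)
qed simp

lemma alt_sum_scale_fun: "alt_sum (\<lambda>w r. c * f w r) = (\<lambda>vs. c * alt_sum f vs)"
  by (rule ext) (rule alt_sum_scale)

lemma alt_sum_linear:
  assumes "\<And>w r. linear (\<lambda>y. f y w r)"
  shows "linear (\<lambda>y. alt_sum (f y) vs)"
proof (rule linearI)
  show "alt_sum (f (x + y)) vs = alt_sum (f x) vs + alt_sum (f y) vs" for x y
  proof -
    have "f (x + y) = (\<lambda>w r. f x w r + f y w r)" by (intro ext) (rule linear_add[OF assms])
    then show ?thesis by (simp only: alt_sum_add)
  qed
  show "alt_sum (f (c *\<^sub>R y)) vs = c *\<^sub>R alt_sum (f y) vs" for c y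
  proof -
    have "f (c *\<^sub>R y) = (\<lambda>w r. c * f y w r)" by (intro ext) (simp add: linear_cmul[OF assms])
    then show ?thesis by (simp only: alt_sum_scale real_scaleR_def)
  qed
qed

lemma alt_sum_has_derivative:
  assumes "\<And>z r. ((\<lambda>u. f u z r) has_derivative (\<lambda>w. f' w z r)) (at x)"
  shows "((\<lambda>u. alt_sum (f u) vs) has_derivative (\<lambda>w. alt_sum (f' w) vs)) (at x)"
  unfolding alt_sum_def by (intro has_derivative_sum has_derivative_mult_right assms)

section \<open>Wedge products by recursion on the arguments\<close>

definition wedge_at :: "('u \<Rightarrow> 'v \<Rightarrow> 'w::real_vector) \<Rightarrow> ('e list \<Rightarrow> 'u) \<Rightarrow> ('e list \<Rightarrow> 'v) \<Rightarrow> 'e list \<Rightarrow> 'w" where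
  "wedge_at b p q vs = (\<Sum>S\<in>Pow {..<length vs}.
     (-1) ^ card {(i, j). i < j \<and> i \<in> {..<length vs} - S \<and> j \<in> S} *\<^sub>R b (p (nths vs S)) (q (nths vs (- S))))"

lemma wedge_wedge_at: "wedge b \<phi> \<psi> x vs = wedge_at b (\<phi> x) (\<psi> x) vs"
  by (simp add: wedge_def wedge_at_def)

lemma wedge_at_Nil [simp]: "wedge_at b p q [] = b (p []) (q [])"
  by (simp add: wedge_at_def)

text \<open>Sets of positions are split according to whether they contain the first position, the
  others being shifted by one. This opens the shuffle sum to recursion over the argument
  list.\<close>

lemma sum_Pow_Suc:
  "(\<Sum>S\<in>Pow {..<Suc n}. f S) = (\<Sum>S\<in>Pow {..<n}. f (insert 0 (Suc ` S))) + (\<Sum>S\<in>Pow {..<n}. f (Suc ` S))"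
proof -
  have eq: "Pow {..<Suc n} = (\<lambda>S. insert 0 (Suc ` S)) ` Pow {..<n} \<union> (\<lambda>S. Suc ` S) ` Pow {..<n}"
    (is "_ = ?A \<union> ?B")
  proof -
    have "T \<in> ?A \<union> ?B" if T: "T \<subseteq> {..<Suc n}" for T
    proof -
      let ?S = "{i. Suc i \<in> T}"
      have S: "?S \<in> Pow {..<n}" using T by auto
      have "T = (if 0 \<in> T then insert 0 (Suc ` ?S) else Suc ` ?S)"
        by (auto simp: image_iff) (metis not0_implies_Suc)+
      then show ?thesis using S by (metis (no_types, lifting) UnI1 UnI2 image_eqI)
    qed
    then have "Pow {..<Suc n} \<subseteq> ?A \<union> ?B" by blast
    moreover have "?A \<union> ?B \<subseteq> Pow {..<Suc n}" by auto
    ultimately show ?thesis by (rule equalityI)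
  qed
  have disj: "?A \<inter> ?B = {}" by auto
  have inj: "inj_on (\<lambda>S. insert 0 (Suc ` S)) (Pow {..<n})" "inj_on (\<lambda>S. Suc ` S) (Pow {..<n})"
    by (auto simp: inj_on_def)
  show ?thesis unfolding eq
    by (subst sum.union_disjoint[OF _ _ disj]) (auto simp: sum.reindex[OF inj(1)] sum.reindex[OF inj(2)])
qed

text \<open>The first argument goes either to p, without new inversions, or to q, overtaking every
  argument of p; hence the sign by length. The hypothesis on b lets this sign be absorbed into
  p.\<close>

lemma wedge_at_Cons:
  assumes b: "\<And>x y. b (- x) y = - b x y"
  shows "wedge_at b p q (v # vs) = wedge_at b (\<lambda>r. p (v # r)) q vs
    + wedge_at b (\<lambda>r. if even (length r) then p r else - p r) (\<lambda>r. q (v # r)) vs"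
proof -
  let ?n = "length vs"
  let ?I = "\<lambda>n S. {(i, j). i < j \<and> i \<in> {..<n} - S \<and> j \<in> S}"
  have fin: "finite (?I n S)" if "S \<subseteq> {..<n}" for n and S :: "nat set"
    by (rule finite_subset[of _ "{..<n} \<times> {..<n}"]) (use that in auto)
  have c1: "card (?I (Suc ?n) (insert 0 (Suc ` S))) = card (?I ?n S)" for S
  proof -
    have "?I (Suc ?n) (insert 0 (Suc ` S)) = map_prod Suc Suc ` ?I ?n S"
      by (auto simp: image_iff less_Suc_eq_0_disj)
    then show ?thesis by (simp add: card_image inj_on_def)
  qed
  \<comment> \<open>Position 0 now lies outside the set and precedes all its elements, which adds
    one inversion for each argument of the first factor.\<close>
  have c2: "card (?I (Suc ?n) (Suc ` S)) = card (?I ?n S) + length (nths vs S)" if S: "S \<subseteq> {..<?n}" for S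
  proof -
    have "?I (Suc ?n) (Suc ` S) = map_prod Suc Suc ` ?I ?n S \<union> {0} \<times> Suc ` S"
      by (auto simp: image_iff less_Suc_eq_0_disj)
    moreover have "card (map_prod Suc Suc ` ?I ?n S) = card (?I ?n S)"
      by (simp add: card_image inj_on_def)
    moreover have "card ({0::nat} \<times> Suc ` S) = length (nths vs S)"
    proof -
      have "S = {i. i < ?n \<and> i \<in> S}" using S by auto
      then show ?thesis by (simp add: length_nths card_cartesian_product card_image inj_on_def)
    qed
    moreover have "finite (map_prod Suc Suc ` ?I ?n S)" "finite ({0::nat} \<times> Suc ` S)"
      using fin[OF S] finite_subset[OF S] by auto
    moreover have "map_prod Suc Suc ` ?I ?n S \<inter> {0} \<times> Suc ` S = {}" by auto
    ultimately show ?thesis by (simp add: card_Un_disjoint)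
  qed
  have n: "nths (v # vs) (insert 0 (Suc ` S)) = v # nths vs S" "nths (v # vs) (- insert 0 (Suc ` S)) = nths vs (- S)"
    "nths (v # vs) (Suc ` S) = nths vs S" "nths (v # vs) (- Suc ` S) = v # nths vs (- S)" for S
  proof -
    have "{j. Suc j \<in> insert 0 (Suc ` S)} = S" "{j. Suc j \<in> - insert 0 (Suc ` S)} = - S"
      "{j. Suc j \<in> Suc ` S} = S" "{j. Suc j \<in> - Suc ` S} = - S" by auto
    then show "nths (v # vs) (insert 0 (Suc ` S)) = v # nths vs S" "nths (v # vs) (- insert 0 (Suc ` S)) = nths vs (- S)"
      "nths (v # vs) (Suc ` S) = nths vs S" "nths (v # vs) (- Suc ` S) = v # nths vs (- S)"
      by (auto simp only: nths_Cons) auto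
  qed
  show ?thesis
    unfolding wedge_at_def length_Cons sum_Pow_Suc n c1
    by (intro arg_cong2[of _ _ _ _ "(+)"] refl sum.cong) (simp_all only: Pow_iff c2 power_add, auto simp: b)
qed

text \<open>Only the parity of a degree enters the signs; e says that it is even. Contraction flips
  it, which keeps the notion stable in inductions over the arguments.\<close>

definition parity :: "bool \<Rightarrow> ('e list \<Rightarrow> 'a::zero) \<Rightarrow> bool" where
  "parity e p \<longleftrightarrow> (\<forall>r. p r \<noteq> 0 \<longrightarrow> even (length r) = e)"

lemma parity_Cons: "parity e p \<Longrightarrow> parity (\<not> e) (\<lambda>r. p (v # r))"
  by (auto simp: parity_def)

abbreviation wdg :: "('e list \<Rightarrow> real) \<Rightarrow> ('e list \<Rightarrow> real) \<Rightarrow> 'e list \<Rightarrow> real" where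
  "wdg \<equiv> wedge_at (*)"

lemma wdg_scale_left: "wdg (\<lambda>r. c * p r) q vs = c * wdg p q vs"
  by (simp add: wedge_at_def sum_distrib_left mult_ac)

lemma wdg_add_right: "wdg p (\<lambda>r. q r + q' r) vs = wdg p q vs + wdg p q' vs"
  by (simp add: wedge_at_def distrib_left sum.distrib)

lemma wdg_scale_right: "wdg p (\<lambda>r. c * q r) vs = c * wdg p q vs"
  by (simp add: wedge_at_def sum_distrib_left mult_ac)

lemma wdg_zero_left [simp]: "wdg (\<lambda>r. 0) q vs = 0"
  by (simp add: wedge_at_def)

lemma wdg_Cons:
  assumes "parity e p"
  shows "wdg p q (v # vs) = wdg (\<lambda>r. p (v # r)) q vs + (if e then 1 else -1) * wdg p (\<lambda>r. q (v # r)) vs"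
proof -
  have "(\<lambda>r. if even (length r) then p r else - p r) = (\<lambda>r. (if e then 1 else -1) * p r)"
    using assms by (auto simp: parity_def fun_eq_iff)
  then show ?thesis by (simp add: wedge_at_Cons wdg_scale_left)
qed

text \<open>Graded commutativity of left multiplications. In this form it needs no associativity:
  both sides are expanded by \<open>wdg_Cons\<close>, and contraction changes the parity of one
  factor at a time.\<close>

lemma wdg_commute:
  assumes "parity e a" "parity f b"
  shows "wdg a (wdg b q) vs = (if e \<or> f then 1 else -1) * wdg b (wdg a q) vs"
  using assms
proof (induction vs arbitrary: a b q e f)
  case Nil
  \<comment> \<open>Without arguments the two products coincide, and when the sign is -1 the factor
    a is odd and vanishes there.\<close>
  then have "a [] \<noteq> 0 \<Longrightarrow> e" by (auto simp: parity_def)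
  then show ?case by auto
next
  case (Cons v vs)
  let ?a = "\<lambda>r. a (v # r)" and ?b = "\<lambda>r. b (v # r)" and ?q = "\<lambda>r. q (v # r)"
  note pa = parity_Cons[OF Cons.prems(1), of v] and pb = parity_Cons[OF Cons.prems(2), of v]
  show ?case
    using Cons.IH[OF pa Cons.prems(2), of q] Cons.IH[OF Cons.prems(1) pb, of q]
      Cons.IH[OF Cons.prems, of ?q]
    by (simp add: wdg_Cons[OF Cons.prems(1)] wdg_Cons[OF Cons.prems(2)] wdg_add_right wdg_scale_right
        wdg_scale_right[of _ "-1", simplified])
qed

definition covec :: "('e \<Rightarrow> real) \<Rightarrow> 'e list \<Rightarrow> real" where
  "covec \<alpha> vs = (if length vs = 1 then \<alpha> (hd vs) else 0)"

lemma one_form_covec: "one_form \<alpha> x = covec (\<alpha> x)"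
  by (simp add: one_form_def covec_def fun_eq_iff)

lemma parity_covec: "parity False (covec \<alpha>)"
  by (auto simp: parity_def covec_def)

lemma wdg_scalar: "wdg (\<lambda>r. if r = [] then c else 0) q vs = c * q vs"
proof (induction vs arbitrary: q)
  case (Cons v vs)
  have "parity True (\<lambda>r. if r = [] then c else 0)" by (auto simp: parity_def)
  from wdg_Cons[OF this, of q v vs] show ?case using Cons.IH[of "\<lambda>r. q (v # r)"] by simp
qed simp

text \<open>Both sides obey the same recursion in the first argument, because a covector contracted
  with a vector is a scalar.\<close>

lemma wdg_covec: "wdg (covec \<alpha>) q vs = alt_sum (\<lambda>w r. \<alpha> w * q r) vs"
proof (induction vs arbitrary: q)
  case (Cons v vs)
  have "(\<lambda>r. covec \<alpha> (v # r)) = (\<lambda>r. if r = [] then \<alpha> v else 0)"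
    by (auto simp: covec_def fun_eq_iff)
  then show ?case using wdg_Cons[OF parity_covec, of \<alpha> q v vs] Cons by (simp add: wdg_scalar)
qed (simp add: covec_def)

section \<open>The Courant bracket in a chart\<close>

definition cliff_at :: "('e \<Rightarrow> real) \<Rightarrow> 'e \<Rightarrow> ('e list \<Rightarrow> real) \<Rightarrow> 'e list \<Rightarrow> real" where
  "cliff_at a V \<Phi> vs = alt_sum (\<lambda>z r. a z * \<Phi> r) vs + \<Phi> (V # vs)"

text \<open>The anticommutator of the twisted differential with the section \<open>(V, a)\<close>, at a point: T and \<open>\<beta>\<close>
  are the derivatives of V and a, and \<open>\<delta>\<close> is the derivative of the form \<open>\<Phi>\<close> on which it acts.\<close>

definition lie_at :: "('e \<Rightarrow> 'e) \<Rightarrow> ('e \<Rightarrow> 'e \<Rightarrow> real) \<Rightarrow> ('e list \<Rightarrow> real) \<Rightarrow> 'e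
    \<Rightarrow> ('e list \<Rightarrow> real) \<Rightarrow> ('e \<Rightarrow> 'e list \<Rightarrow> real) \<Rightarrow> 'e list \<Rightarrow> real" where
  "lie_at T \<beta> h V \<Phi> \<delta> vs = \<delta> V vs + alt_sum (\<lambda>w r. \<Phi> (T w # r)) vs
     + alt_sum (\<lambda>w. alt_sum (\<lambda>z r. \<beta> w z * \<Phi> r)) vs + wdg (\<lambda>r. h (V # r)) \<Phi> vs"

lemma cliff_at_linear:
  assumes "\<And>r. linear (\<lambda>w. \<Phi> (w # r))" "\<And>v r. linear (\<lambda>w. \<Phi> (v # w # r))" "linear a"
  shows "linear (\<lambda>w. cliff_at a V \<Phi> (w # r))"
proof -
  have 1: "linear (\<lambda>w. a w * \<Phi> r)"
    using assms(3) by (auto simp: linear_iff distrib_right)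
  have 2: "linear (\<lambda>w. alt_sum (\<lambda>z r. a z * \<Phi> (w # r)) r)"
    using assms(1) by (intro alt_sum_linear) (auto simp: linear_iff distrib_left)
  show ?thesis using assms(2)[of V r] 1 2 by (simp add: cliff_at_def linear_iff algebra_simps)
qed

text \<open>The algebraic core of the Courant bracket. Derivatives of the form occur only as
  \<open>\<delta> V\<close>, and those from the two orders of composition cancel; what remains is
  Clifford multiplication by a single pair. The form \<open>\<delta>\<close> in the first term is
  replaced by what the product rule gives for \<open>cliff_at a' V' \<Phi>\<close>.\<close>

lemma commutator_at:
  fixes \<Phi> :: "'e::real_vector list \<Rightarrow> real"
  assumes skew: "\<And>v w r. \<Phi> (v # w # r) = - \<Phi> (w # v # r)"
    and lin: "\<And>r. linear (\<lambda>w. \<Phi> (w # r))"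
    and h: "\<And>r. length r \<noteq> 3 \<Longrightarrow> h r = 0"
  shows "lie_at T \<beta> h V (cliff_at a' V' \<Phi>)
      (\<lambda>w vs. alt_sum (\<lambda>z r. \<beta>' w z * \<Phi> r + a' z * \<delta> w r) vs + \<delta> w (V' # vs) + \<Phi> (T' w # vs)) vs
    - cliff_at a' V' (lie_at T \<beta> h V \<Phi> \<delta>) vs
    = cliff_at (\<lambda>w. \<beta>' V w + a' (T w) - \<beta> V' w + \<beta> w V' - h [V, V', w]) (T' V - T V') \<Phi> vs"
proof -
  let ?c = "cliff_at a' V'"
  have c_eq: "?c F = (\<lambda>vs. alt_sum (\<lambda>z r. a' z * F r) vs + F (V' # vs))" for F
    by (simp add: cliff_at_def fun_eq_iff)
  \<comment> \<open>The derivative of the vector part acts as a derivation \<open>?\<tau>\<close>;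
    \<open>?\<kappa>\<close> is the wedge with the 2-form obtained by antisymmetrizing \<beta>. The
    commutator splits into the contributions of these two, of \<open>h\<close> and of
    \<open>\<delta> V\<close>.\<close>
  let ?\<tau> = "\<lambda>F. alt_sum (\<lambda>w r. F (T w # r))" and ?\<kappa> = "\<lambda>F. alt_sum (\<lambda>w. alt_sum (\<lambda>z r. \<beta> w z * F r))"
  have \<tau>: "?\<tau> (?c \<Phi>) vs - ?c (?\<tau> \<Phi>) vs = alt_sum (\<lambda>w r. a' (T w) * \<Phi> r) vs - \<Phi> (T V' # vs)"
  proof -
    have "alt_sum (\<lambda>w. alt_sum (\<lambda>z r. a' z * \<Phi> (T w # r))) vs = - alt_sum (\<lambda>z. alt_sum (\<lambda>w r. a' z * \<Phi> (T w # r))) vs"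
      by (rule alt_sum_swap)
    moreover have "alt_sum (\<lambda>w r. \<Phi> (V' # T w # r)) vs = - alt_sum (\<lambda>w r. \<Phi> (T w # V' # r)) vs"
    proof -
      have "(\<lambda>w r. \<Phi> (V' # T w # r)) = (\<lambda>w r. - \<Phi> (T w # V' # r))"
        by (intro ext) (rule skew)
      then show ?thesis by (simp only: alt_sum_uminus)
    qed
    ultimately show ?thesis
      unfolding c_eq by (simp add: alt_sum_add alt_sum_diff alt_sum_scale[symmetric])
  qed
  have \<kappa>: "?\<kappa> (?c \<Phi>) vs - ?c (?\<kappa> \<Phi>) vs = - alt_sum (\<lambda>w r. (\<beta> V' w - \<beta> w V') * \<Phi> r) vs"
  proof -
    let ?F = "\<lambda>w z y s. \<beta> w z * (a' y * \<Phi> s)"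
    have 1: "alt_sum (\<lambda>w. alt_sum (\<lambda>z r. \<beta> w z * alt_sum (\<lambda>y s. a' y * \<Phi> s) r)) vs
        = alt_sum (\<lambda>y r. a' y * alt_sum (\<lambda>w. alt_sum (\<lambda>z s. \<beta> w z * \<Phi> s)) r) vs"
    proof -
      \<comment> \<open>Extraction of y moves past that of z and then past that of w; the two signs
        cancel.\<close>
      have "alt_sum (\<lambda>w. alt_sum (\<lambda>z. alt_sum (?F w z))) vs = alt_sum (\<lambda>w r. - alt_sum (\<lambda>y. alt_sum (\<lambda>z. ?F w z y)) r) vs"
        by (rule arg_cong[where f = "\<lambda>f. alt_sum f vs"], intro ext, rule alt_sum_swap)
      also have "\<dots> = alt_sum (\<lambda>y. alt_sum (\<lambda>w. alt_sum (\<lambda>z. ?F w z y))) vs"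
        unfolding alt_sum_uminus by (subst alt_sum_swap) simp
      finally show ?thesis by (simp add: alt_sum_scale_fun[symmetric] mult.left_commute)
    qed
    show ?thesis
      unfolding c_eq by (simp add: 1 distrib_left alt_sum_add_fun alt_sum_diff left_diff_distrib)
  qed
  have \<eta>: "wdg (\<lambda>r. h (V # r)) (?c \<Phi>) vs - ?c (wdg (\<lambda>r. h (V # r)) \<Phi>) vs
      = - alt_sum (\<lambda>w r. h [V, V', w] * \<Phi> r) vs"
  proof -
    \<comment> \<open>The contraction of h with V has degree 2, so it commutes with the wedge by a
      covector; a further contraction with \<open>V'\<close> leaves the covector
      \<open>h [V, V', w]\<close>.\<close>
    have pe: "parity True (\<lambda>r. h (V # r))"
      unfolding parity_def
    proof (intro allI impI)
      fix r assume "h (V # r) \<noteq> 0"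
      then have "length (V # r) = 3" using h by blast
      then show "even (length r) = True" by simp
    qed
    have cv: "(\<lambda>r. h (V # V' # r)) = covec (\<lambda>w. h [V, V', w])"
    proof
      fix r show "h (V # V' # r) = covec (\<lambda>w. h [V, V', w]) r"
        using h[of "V # V' # r"] by (cases r) (auto simp: covec_def)
    qed
    show ?thesis
      unfolding c_eq wdg_add_right wdg_covec[symmetric] wdg_Cons[OF pe] cv
      using wdg_commute[OF pe parity_covec, of a' \<Phi> vs] by simp
  qed
  have "lie_at T \<beta> h V (?c \<Phi>)
      (\<lambda>w vs. alt_sum (\<lambda>z r. \<beta>' w z * \<Phi> r + a' z * \<delta> w r) vs + \<delta> w (V' # vs) + \<Phi> (T' w # vs)) vs
    - ?c (lie_at T \<beta> h V \<Phi> \<delta>) vs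
    = alt_sum (\<lambda>z r. \<beta>' V z * \<Phi> r) vs + \<Phi> (T' V # vs)
      + (?\<tau> (?c \<Phi>) vs - ?c (?\<tau> \<Phi>) vs) + (?\<kappa> (?c \<Phi>) vs - ?c (?\<kappa> \<Phi>) vs)
      + (wdg (\<lambda>r. h (V # r)) (?c \<Phi>) vs - ?c (wdg (\<lambda>r. h (V # r)) \<Phi>) vs)"
  proof -
    have "?c (lie_at T \<beta> h V \<Phi> \<delta>) vs = ?c (\<delta> V) vs + ?c (?\<tau> \<Phi>) vs + ?c (?\<kappa> \<Phi>) vs + ?c (wdg (\<lambda>r. h (V # r)) \<Phi>) vs"
      unfolding lie_at_def c_eq by (simp only: distrib_left alt_sum_add)
    then show ?thesis
      unfolding lie_at_def[of T \<beta> h V "?c \<Phi>"] by (simp only: alt_sum_add c_eq[of "\<delta> V"])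
  qed
  also have "\<dots> = cliff_at (\<lambda>w. \<beta>' V w + a' (T w) - \<beta> V' w + \<beta> w V' - h [V, V', w]) (T' V - T V') \<Phi> vs"
    unfolding \<tau> \<kappa> \<eta> unfolding cliff_at_def
    by (simp add: linear_diff[OF lin] distrib_right left_diff_distrib alt_sum_add alt_sum_diff)
  finally show ?thesis .
qed

section \<open>Chart representatives of sections and the formula for the bracket\<close>

definition lcov :: "('m, 'e::real_normed_vector) atlas \<Rightarrow> 'm \<Rightarrow> ('m \<Rightarrow> 'e \<Rightarrow> real) \<Rightarrow> 'e \<Rightarrow> 'e \<Rightarrow> real" where
  "lcov M p \<alpha> u w = local_form M p (one_form \<alpha>) u [w]"

lemma lcov_eq: "lcov M p \<alpha> u w = \<alpha> (cinv M p u) (transition M p (cinv M p u) u w)"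
  by (simp add: lcov_def local_form_def one_form_def Let_def)

abbreviation vpart :: "('m, 'e::real_normed_vector) atlas \<Rightarrow> ('m \<Rightarrow> 'e pont) \<Rightarrow> 'm \<Rightarrow> 'e \<Rightarrow> 'e" where
  "vpart M s p \<equiv> local_vf M p (\<lambda>x. fst (s x))"

abbreviation cpart :: "('m, 'e::real_normed_vector) atlas \<Rightarrow> ('m \<Rightarrow> 'e pont) \<Rightarrow> 'm \<Rightarrow> 'e \<Rightarrow> 'e \<Rightarrow> real" where
  "cpart M s p \<equiv> lcov M p (\<lambda>x. snd (s x))"

text \<open>The vector part is the Lie bracket of V1 and V2; the covector part is
  \<open>L_V1 a2 - i_V2 d a1 - i_V2 i_V1 \<eta>\<close> in coordinates. In the last derivative the
  vector \<open>V2 u\<close> is frozen, as in the coordinate expression of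
  \<open>d a1\<close>.\<close>

definition courant :: "('m, 'e::real_normed_vector) atlas \<Rightarrow> ('m, 'e, real) form
    \<Rightarrow> ('m \<Rightarrow> 'e pont) \<Rightarrow> ('m \<Rightarrow> 'e pont) \<Rightarrow> 'm \<Rightarrow> 'e pont" where
  "courant M \<eta> s1 s2 x =
    (let u = cmap M x x; V1 = vpart M s1 x; V2 = vpart M s2 x;
       a1 = cpart M s1 x; a2 = cpart M s2 x in
     (fderiv V2 u (V1 u) - fderiv V1 u (V2 u),
      \<lambda>w. fderiv (\<lambda>u. a2 u w) u (V1 u) + a2 u (fderiv V1 u w) - fderiv (\<lambda>u. a1 u w) u (V2 u)
        + fderiv (\<lambda>y. a1 y (V2 u)) u w - \<eta> x [V1 u, V2 u, w]))"

lemma alt_sum_map: "alt_sum \<psi> (map T vs) = alt_sum (\<lambda>z r. \<psi> (T z) (map T r)) vs"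
  by (simp add: alt_sum_def take_map drop_map)

lemma clifford_cliff_at: "clifford s \<phi> x vs = cliff_at (snd (s x)) (fst (s x)) (\<phi> x) vs"
  by (simp add: clifford_def wedge_wedge_at one_form_covec wdg_covec cliff_at_def contract_def)

lemma ext_d_alt_sum:
  "ext_d M \<omega> x vs = alt_sum (\<lambda>w r. fderiv (\<lambda>u. local_form M x \<omega> u r) (cmap M x x) w) vs"
  by (simp add: ext_d_def alt_sum_def)

lemma alternating_linear_first:
  assumes "alternating \<phi>" shows "linear (\<lambda>w. \<phi> (w # r))"
proof -
  have "0 < length (undefined # r) \<longrightarrow> linear (\<lambda>w. \<phi> ((undefined # r)[0 := w]))"
    using assms unfolding alternating_def by blast
  then show ?thesis by simp
qed

lemma alternating_linear_second:
  assumes "alternating \<phi>" shows "linear (\<lambda>w. \<phi> (v # w # r))"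
proof -
  have "1 < length (v # undefined # r) \<longrightarrow> linear (\<lambda>w. \<phi> ((v # undefined # r)[1 := w]))"
    using assms unfolding alternating_def by blast
  then show ?thesis by simp
qed

lemma alternating_skew:
  assumes "alternating \<phi>" shows "\<phi> (v # w # r) = - \<phi> (w # v # r)"
proof -
  have z: "\<phi> (x # x # r) = 0" for x
  proof -
    have "0 < (1::nat) \<and> 1 < length (x # x # r) \<and> (x # x # r) ! 0 = (x # x # r) ! 1 \<longrightarrow> \<phi> (x # x # r) = 0"
      using assms unfolding alternating_def by blast
    then show ?thesis by simp
  qed
  have "\<phi> ((v + w) # (v + w) # r) = \<phi> (v # v # r) + \<phi> (v # w # r) + (\<phi> (w # v # r) + \<phi> (w # w # r))"
    by (simp add: linear_add[OF alternating_linear_first[OF assms]] linear_add[OF alternating_linear_second[OF assms]])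
  then show ?thesis by (simp add: z)
qed

context
  fixes M :: "('m::{t2_space, second_countable_topology}, 'e::real_inner) atlas"
  assumes M: "smooth_manifold M"
begin

lemma transition_local_vf:
  assumes "u \<in> cimg M p"
  shows "transition M p (cinv M p u) u (local_vf M p X u) = X (cinv M p u)"
  using transition_inverse[OF M M, of "cmap M (cinv M p u) (cinv M p u)" "cinv M p u" p "X (cinv M p u)"] assms
  by (simp add: local_vf_eq[OF M M] M)

lemma lcov_centre [simp]: "lcov M x \<alpha> (cmap M x x) w = \<alpha> x w"
  by (simp add: lcov_eq M transition_centre[OF M M])

lemma local_form_clifford:
  assumes u: "u \<in> cimg M p"
  shows "local_form M p (clifford s \<phi>) u vs
    = cliff_at (cpart M s p u) (vpart M s p u) (local_form M p \<phi> u) vs"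
  using transition_local_vf[OF u, of "\<lambda>y. fst (s y)"]
  by (simp add: local_form_def Let_def clifford_cliff_at cliff_at_def alt_sum_map lcov_eq)

lemma lcov_linear:
  assumes "linear (\<alpha> (cinv M p u))" "u \<in> cimg M p"
  shows "linear (lcov M p \<alpha> u)"
proof -
  have "linear (transition M p (cinv M p u) u)"
    by (rule transition_linear[OF M M]) (use assms(2) in \<open>auto simp: M\<close>)
  moreover have "lcov M p \<alpha> u = \<alpha> (cinv M p u) \<circ> transition M p (cinv M p u) u"
    by (simp add: lcov_eq fun_eq_iff)
  ultimately show ?thesis using linear_compose[OF _ assms(1)] by metis
qed

context
  fixes s :: "'m \<Rightarrow> 'e pont" and x :: 'm and \<psi> :: "('m, 'e, real) form"
  assumes s: "smooth_section_on M UNIV s"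
    and diff: "\<And>vs. (\<lambda>u. local_form M x \<psi> u vs) differentiable (at (cmap M x x))"
    and lin: "\<And>u r. u \<in> cimg M x \<Longrightarrow> linear (\<lambda>w. local_form M x \<psi> u (w # r))"
begin

lemma local_form_clifford_has_derivative:
  "((\<lambda>u. local_form M x (clifford s \<psi>) u vs) has_derivative
    (\<lambda>w. alt_sum (\<lambda>z r. fderiv (\<lambda>u. cpart M s x u z) (cmap M x x) w * \<psi> x r
          + snd (s x) z * fderiv (\<lambda>u. local_form M x \<psi> u r) (cmap M x x) w) vs
      + fderiv (\<lambda>u. local_form M x \<psi> u (fst (s x) # vs)) (cmap M x x) w
      + \<psi> x (fderiv (vpart M s x) (cmap M x x) w # vs))) (at (cmap M x x))"
proof -
  let ?u = "cmap M x x" and ?a = "cpart M s x" and ?V = "vpart M s x"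
    and ?\<Psi> = "local_form M x \<psi>"
  have U: "open (cimg M x)" "?u \<in> cimg M x" using M by (auto simp: open_cimg)
  have V: "(?V has_derivative fderiv ?V ?u) (at ?u)"
    by (rule smooth_on_has_derivative[OF _ U(2)]) (use s in \<open>auto simp: smooth_section_on_def\<close>)
  have a: "((\<lambda>u. ?a u z) has_derivative fderiv (\<lambda>u. ?a u z) ?u) (at ?u)" for z
    unfolding lcov_def
    by (rule smooth_on_has_derivative[OF _ U(2)]) (use s in \<open>auto simp: smooth_section_on_def\<close>)
  have 1: "((\<lambda>u. alt_sum (\<lambda>z r. ?a u z * ?\<Psi> u r) vs) has_derivative
     (\<lambda>w. alt_sum (\<lambda>z r. ?a ?u z * fderiv (\<lambda>u. ?\<Psi> u r) ?u w + fderiv (\<lambda>u. ?a u z) ?u w * ?\<Psi> ?u r) vs)) (at ?u)"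
    by (intro alt_sum_has_derivative has_derivative_mult a fderiv_worksD[OF diff])
  have 2: "((\<lambda>u. ?\<Psi> u (?V u # vs)) has_derivative
      (\<lambda>w. fderiv (\<lambda>u. ?\<Psi> u (?V ?u # vs)) ?u w + ?\<Psi> ?u (fderiv ?V ?u w # vs))) (at ?u)"
    by (rule has_derivative_linear_apply[OF manifold_fin_dim[OF M] U, of "\<lambda>u z. ?\<Psi> u (z # vs)", OF lin diff V])
  have "((\<lambda>u. cliff_at (?a u) (?V u) (?\<Psi> u) vs) has_derivative
    (\<lambda>w. alt_sum (\<lambda>z r. fderiv (\<lambda>u. ?a u z) ?u w * \<psi> x r + snd (s x) z * fderiv (\<lambda>u. ?\<Psi> u r) ?u w) vs
      + fderiv (\<lambda>u. ?\<Psi> u (fst (s x) # vs)) ?u w + \<psi> x (fderiv ?V ?u w # vs))) (at ?u)"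
    using has_derivative_add[OF 1 2]
    by (simp add: cliff_at_def local_form_centre[OF M M] local_vf_centre[OF M M] add_ac)
  then show ?thesis
    by (rule has_derivative_transform_within_open[OF _ U]) (simp add: local_form_clifford)
qed

text \<open>Cartan's formula with twist: d anticommutes with contraction to a Lie derivative and
  with the wedge by a to the wedge by da, while \<eta> anticommutes with the wedge by a to 0 and
  with contraction to the contracted \<eta>. The form \<psi> is only required to be differentiable
  at x and linear in its first argument because it will also be
  \<open>clifford s2 \<phi>\<close>.\<close>

lemma anticommutator_lie_at:
  assumes h: "\<And>r. length r \<noteq> 3 \<Longrightarrow> \<eta> x r = 0"
  shows "anticommutator (twisted_d M \<eta>) (clifford s) \<psi> x vs
    = lie_at (fderiv (vpart M s x) (cmap M x x))
        (\<lambda>w z. fderiv (\<lambda>u. cpart M s x u z) (cmap M x x) w)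
        (\<eta> x) (fst (s x)) (\<psi> x) (\<lambda>w vs. fderiv (\<lambda>u. local_form M x \<psi> u vs) (cmap M x x) w) vs"
proof -
  define V where "V = fst (s x)"
  define a where "a = snd (s x)"
  define T where "T = fderiv (vpart M s x) (cmap M x x)"
  define \<beta> where "\<beta> = (\<lambda>w z. fderiv (\<lambda>u. cpart M s x u z) (cmap M x x) w)"
  define \<delta> where "\<delta> = (\<lambda>w vs. fderiv (\<lambda>u. local_form M x \<psi> u vs) (cmap M x x) w)"
  have td: "twisted_d M \<eta> \<psi> x = (\<lambda>vs. alt_sum \<delta> vs + wdg (\<eta> x) (\<psi> x) vs)"
    by (simp add: twisted_d_def ext_d_alt_sum wedge_wedge_at \<delta>_def fun_eq_iff)
  have c: "clifford s \<omega> x = (\<lambda>vs. wdg (covec a) (\<omega> x) vs + \<omega> x (V # vs))" for \<omega>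
    by (simp add: clifford_cliff_at cliff_at_def wdg_covec V_def a_def fun_eq_iff)
  have dc: "ext_d M (clifford s \<psi>) x vs
    = alt_sum (\<lambda>w vs. alt_sum (\<lambda>z r. \<beta> w z * \<psi> x r + a z * \<delta> w r) vs + \<delta> w (V # vs) + \<psi> x (T w # vs)) vs"
    unfolding ext_d_alt_sum fderiv_eq[OF local_form_clifford_has_derivative]
    by (simp add: V_def a_def T_def \<beta>_def \<delta>_def)
  have odd: "parity False (\<eta> x)"
    unfolding parity_def using h by (metis odd_numeral_BitM numeral_3_eq_3 even_Suc odd_one One_nat_def)
  \<comment> \<open>The derivatives of \<psi> in \<open>d(a \<and> \<psi>)\<close> and in
    \<open>a \<and> d\<psi>\<close> have opposite signs.\<close>
  have sw: "alt_sum (\<lambda>w. alt_sum (\<lambda>z r. a z * \<delta> w r)) vs = - alt_sum (\<lambda>z r. a z * alt_sum \<delta> r) vs"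
  proof -
    have "alt_sum (\<lambda>w. alt_sum (\<lambda>z r. a z * \<delta> w r)) vs = - alt_sum (\<lambda>z. alt_sum (\<lambda>w r. a z * \<delta> w r)) vs"
      by (rule alt_sum_swap)
    moreover have "(\<lambda>z. alt_sum (\<lambda>w r. a z * \<delta> w r)) = (\<lambda>z r. a z * alt_sum \<delta> r)"
      by (intro ext) (rule alt_sum_scale)
    ultimately show ?thesis by simp
  qed
  show ?thesis
    unfolding V_def[symmetric] T_def[symmetric] \<beta>_def[symmetric] \<delta>_def[symmetric]
    unfolding anticommutator_def twisted_d_def[of M \<eta> "clifford s \<psi>"] wedge_wedge_at dc c td
    unfolding wdg_add_right wdg_commute[OF odd parity_covec] wdg_Cons[OF odd] wdg_covec[of a "alt_sum \<delta>"]
    by (simp add: lie_at_def alt_sum_add_fun sw)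
qed

end

lemma local_form_linear_first:
  assumes "alternating (\<phi> (cinv M p u))" "u \<in> cimg M p"
  shows "linear (\<lambda>w. local_form M p \<phi> u (w # r))"
proof -
  have "linear (transition M p (cinv M p u) u)"
    by (rule transition_linear[OF M M]) (use assms(2) in \<open>auto simp: M\<close>)
  from linear_compose[OF this alternating_linear_first[OF assms(1)]] show ?thesis
    by (simp add: local_form_def Let_def o_def)
qed

lemma local_form_linear_second:
  assumes "alternating (\<phi> (cinv M p u))" "u \<in> cimg M p"
  shows "linear (\<lambda>w. local_form M p \<phi> u (v # w # r))"
proof -
  have "linear (transition M p (cinv M p u) u)"
    by (rule transition_linear[OF M M]) (use assms(2) in \<open>auto simp: M\<close>)
  from linear_compose[OF this alternating_linear_second[OF assms(1)]] show ?thesis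
    by (simp add: local_form_def Let_def o_def)
qed

theorem is_courant_bracket_courant:
  assumes s1: "smooth_section_on M UNIV s1" and s2: "smooth_section_on M UNIV s2"
    and \<eta>: "homogeneous 3 \<eta>"
  shows "is_courant_bracket M \<eta> s1 s2 (courant M \<eta> s1 s2)"
  unfolding is_courant_bracket_def
proof (intro ballI ext)
  fix \<phi> x vs assume \<phi>: "\<phi> \<in> Forms M"
  have alt: "alternating (\<phi> y)" for y using \<phi> by (simp add: Forms_def)
  let ?u = "cmap M x x"
  have sm: "smooth_on (cimg M x) (\<lambda>u. local_form M x \<phi> u vs)" for vs using \<phi> by (simp add: Forms_def)
  have diff: "(\<lambda>u. local_form M x \<phi> u vs) differentiable (at ?u)" for vs
    by (rule smooth_on_differentiable[OF sm]) (simp add: M)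
  have lin: "linear (\<lambda>w. local_form M x \<phi> u (w # r))" if "u \<in> cimg M x" for u r
    by (rule local_form_linear_first[OF alt that])
  have diff': "(\<lambda>u. local_form M x (clifford s2 \<phi>) u vs) differentiable (at ?u)" for vs
    using local_form_clifford_has_derivative[OF s2 diff lin] by (auto simp: differentiable_def)
  have lin': "linear (\<lambda>w. local_form M x (clifford s2 \<phi>) u (w # r))" if u: "u \<in> cimg M x" for u r
    unfolding local_form_clifford[OF u]
    by (intro cliff_at_linear local_form_linear_first local_form_linear_second alt u lcov_linear)
      (use s2 in \<open>auto simp: smooth_section_on_def Pont_def\<close>)
  have h: "\<eta> x r = 0" if "length r \<noteq> 3" for r using \<eta> that by (simp add: homogeneous_def)
  have "commutator (anticommutator (twisted_d M \<eta>) (clifford s1)) (clifford s2) \<phi> x vs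
     = anticommutator (twisted_d M \<eta>) (clifford s1) (clifford s2 \<phi>) x vs
       - cliff_at (snd (s2 x)) (fst (s2 x)) (anticommutator (twisted_d M \<eta>) (clifford s1) \<phi> x) vs"
    by (simp add: commutator_def clifford_cliff_at[of s2])
  also have "\<dots> = clifford (courant M \<eta> s1 s2) \<phi> x vs"
  proof -
    have c2: "clifford s2 \<phi> x = cliff_at (snd (s2 x)) (fst (s2 x)) (\<phi> x)"
      by (rule ext) (rule clifford_cliff_at)
    have A: "anticommutator (twisted_d M \<eta>) (clifford s1) \<phi> x
      = lie_at (fderiv (vpart M s1 x) ?u) (\<lambda>w z. fderiv (\<lambda>u. cpart M s1 x u z) ?u w)
          (\<eta> x) (fst (s1 x)) (\<phi> x) (\<lambda>w vs. fderiv (\<lambda>u. local_form M x \<phi> u vs) ?u w)"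
      by (rule ext) (rule anticommutator_lie_at[where \<eta> = \<eta> and x = x, OF s1 diff lin h])
    have A': "anticommutator (twisted_d M \<eta>) (clifford s1) (clifford s2 \<phi>) x vs
      = lie_at (fderiv (vpart M s1 x) ?u) (\<lambda>w z. fderiv (\<lambda>u. cpart M s1 x u z) ?u w)
          (\<eta> x) (fst (s1 x)) (clifford s2 \<phi> x) (\<lambda>w vs. fderiv (\<lambda>u. local_form M x (clifford s2 \<phi>) u vs) ?u w) vs"
      by (rule anticommutator_lie_at[OF s1 diff' lin']) (simp_all add: h)
    have D: "fderiv (\<lambda>u. local_form M x (clifford s2 \<phi>) u vs) ?u
      = (\<lambda>w. alt_sum (\<lambda>z r. fderiv (\<lambda>u. cpart M s2 x u z) ?u w * \<phi> x r
          + snd (s2 x) z * fderiv (\<lambda>u. local_form M x \<phi> u r) ?u w) vs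
        + fderiv (\<lambda>u. local_form M x \<phi> u (fst (s2 x) # vs)) ?u w
        + \<phi> x (fderiv (vpart M s2 x) ?u w # vs))" for vs
      by (rule fderiv_eq, rule local_form_clifford_has_derivative[OF s2 diff lin])
    show ?thesis
      unfolding A A' D c2
      by (subst commutator_at[OF alternating_skew[OF alt] alternating_linear_first[OF alt] h])
        (simp_all add: clifford_cliff_at courant_def Let_def local_vf_centre[OF M M])
  qed
  finally show "clifford (courant M \<eta> s1 s2) \<phi> x vs
    = commutator (anticommutator (twisted_d M \<eta>) (clifford s1)) (clifford s2) \<phi> x vs" by simp
qed

end

section \<open>Lie groups\<close>

text \<open>The opposite group has the same charts, unit and inverses, and its left-invariant
  objects are the right-invariant objects of G. Each result on left translations thus also yields
  its right-handed version.\<close>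

definition lie_op :: "('g, 'e) lie_group \<Rightarrow> ('g, 'e) lie_group" where
  "lie_op G = G\<lparr>mul := \<lambda>a b. mul G b a\<rparr>"

lemma lie_op_simps [simp]:
  "mfd (lie_op G) = mfd G" "mul (lie_op G) a b = mul G b a" "unit (lie_op G) = unit G" "inver (lie_op G) = inver G"
  by (simp_all add: lie_op_def)

lemma lie_op_left [simp]:
  "left_inv_field (lie_op G) = right_inv_field G" "left_MC (lie_op G) = right_MC G"
  by (simp_all add: fun_eq_iff left_inv_field_def right_inv_field_def left_MC_def right_MC_def)

definition local_MC :: "('g, 'e::real_normed_vector) lie_group \<Rightarrow> 'g \<Rightarrow> 'e \<Rightarrow> 'e \<Rightarrow> 'e" where
  "local_MC G p u v = local_form (mfd G) p (one_form (left_MC G)) u [v]"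

lemma local_MC_eq:
  "local_MC G p u v = left_MC G (cinv (mfd G) p u) (transition (mfd G) p (cinv (mfd G) p u) u v)"
  by (simp add: local_MC_def local_form_def one_form_def Let_def)

locale Lie_group =
  fixes G :: "('g::{t2_space, second_countable_topology}, 'e::real_inner) lie_group"
  assumes lie: "is_lie_group G"
begin

abbreviation mult (infixl \<open>\<cdot>\<close> 70) where "a \<cdot> b \<equiv> mul G a b"
abbreviation Mult where "Mult \<equiv> \<lambda>(a, b). a \<cdot> b"
abbreviation iv where "iv \<equiv> inver G"
abbreviation one (\<open>\<one>\<close>) where "\<one> \<equiv> unit G"
abbreviation M where "M \<equiv> mfd G"
abbreviation u1 where "u1 \<equiv> cmap M \<one> \<one>"
abbreviation lvf where "lvf \<equiv> left_inv_field G"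
abbreviation rvf where "rvf \<equiv> right_inv_field G"
abbreviation br where "br \<equiv> lie_alg_bracket G"

sublocale grp: group "mul G" "unit G" "inver G"
  using lie by (simp add: is_lie_group_def)

lemma inv_mult_cancel [simp]: "iv g \<cdot> (g \<cdot> h) = h" "g \<cdot> (iv g \<cdot> h) = h"
  by (simp_all add: grp.assoc[symmetric])

lemma mult_inv_cancel [simp]: "h \<cdot> g \<cdot> iv g = h" "h \<cdot> iv g \<cdot> g = h"
  by (simp_all add: grp.assoc)

lemma mfd: "smooth_manifold M"
  using lie by (simp add: is_lie_group_def)

lemma mfd2: "smooth_manifold (mfd2 G)"
  by (rule smooth_manifold_prod[OF mfd mfd])

lemma fin: "fin_dim TYPE('e)"
  by (rule manifold_fin_dim[OF mfd])

lemma smooth_mult: "smooth_map (mfd2 G) M Mult"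
  using lie by (simp add: is_lie_group_def)

lemma smooth_inv: "smooth_map M M iv"
  using lie by (simp add: is_lie_group_def)

lemma smooth_map_mult:
  fixes K :: "('k::{t2_space, second_countable_topology}, 'h::real_inner) atlas"
  assumes K: "smooth_manifold K" and f: "smooth_map K M f" and g: "smooth_map K M g"
  shows "smooth_map K M (\<lambda>x. f x \<cdot> g x)"
  using smooth_map_compose[OF K mfd2 mfd smooth_map_Pair[OF mfd mfd K f g] smooth_mult] by simp

lemma smooth_left: "smooth_map M M (\<lambda>h. g \<cdot> h)"
  by (intro smooth_map_mult mfd smooth_map_const smooth_map_ident)

lemma smooth_right: "smooth_map M M (\<lambda>h. h \<cdot> g)"
  by (intro smooth_map_mult mfd smooth_map_const smooth_map_ident)

lemma smooth_conj: "smooth_map M M (\<lambda>h. g \<cdot> h \<cdot> k)"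
  by (intro smooth_map_mult mfd smooth_map_const smooth_map_ident)

lemma op: "Lie_group (lie_op G)"
proof
  have "group (\<lambda>a b. b \<cdot> a) \<one> iv"
    by standard (simp_all add: grp.assoc)
  moreover have "smooth_map (mfd2 G) M (\<lambda>x. snd x \<cdot> fst x)"
    by (intro smooth_map_mult mfd2 smooth_map_fst smooth_map_snd mfd)
  moreover have "mul (lie_op G) = (\<lambda>a b. b \<cdot> a)" by (simp add: fun_eq_iff)
  moreover have "(\<lambda>(a, b). b \<cdot> a) = (\<lambda>x. snd x \<cdot> fst x)" by (simp add: fun_eq_iff)
  ultimately show "is_lie_group (lie_op G)"
    using smooth_inv mfd by (simp add: is_lie_group_def)
qed

lemma tangent_comp:
  "smooth_map M M f \<Longrightarrow> smooth_map M M g \<Longrightarrow>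
    tangent_map M M g (f x) (tangent_map M M f x v) = tangent_map M M (\<lambda>x. g (f x)) x v"
  by (rule tangent_map_compose[OF mfd mfd mfd, symmetric])

lemma left_MC_lvf [simp]: "left_MC G g (lvf \<xi> g) = \<xi>"
  unfolding left_MC_def left_inv_field_def
  using tangent_comp[OF smooth_left[of g] smooth_left[of "iv g"], of \<one> \<xi>]
  by (simp add: tangent_map_ident[OF mfd mfd])

lemma lvf_left_MC [simp]: "lvf (left_MC G g v) g = v"
  unfolding left_MC_def left_inv_field_def
  using tangent_comp[OF smooth_left[of "iv g"] smooth_left[of g], of g v]
  by (simp add: tangent_map_ident[OF mfd mfd])

lemma linear_lvf: "linear (\<lambda>\<xi>. lvf \<xi> g)"
  unfolding left_inv_field_def using tangent_map_linear[OF mfd mfd smooth_left, of g \<one>] by simp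

lemma linear_left_MC: "linear (left_MC G g)"
  unfolding left_MC_def by (rule tangent_map_linear[OF mfd mfd smooth_left])

lemma linear_Ad: "linear (Ad G g)"
  unfolding Ad_def by (rule tangent_map_linear[OF mfd mfd smooth_conj])

lemma left_MC_unit [simp]: "left_MC G \<one> v = v"
proof -
  have "iv \<one> = \<one>" using grp.inverse_unique by force
  then show ?thesis by (simp add: left_MC_def tangent_map_ident[OF mfd mfd])
qed

lemma lvf_unit [simp]: "lvf \<xi> \<one> = \<xi>"
  using lvf_left_MC[of \<one> \<xi>] by simp

lemma Ad_unit [simp]: "Ad G \<one> v = v"
proof -
  have "iv \<one> = \<one>" using grp.inverse_unique by force
  then show ?thesis by (simp add: Ad_def tangent_map_ident[OF mfd mfd])
qed

lemma Ad_mult: "Ad G (a \<cdot> b) v = Ad G a (Ad G b v)"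
  unfolding Ad_def
  using tangent_comp[OF smooth_conj[of b "iv b"] smooth_conj[of a "iv a"], of \<one> v]
  by (simp add: grp.assoc grp.inverse_distrib_swap)

lemma Ad_inv [simp]: "Ad G g (Ad G (iv g) v) = v" "Ad G (iv g) (Ad G g v) = v"
  by (simp_all add: Ad_mult[symmetric])

lemma right_MC_eq: "right_MC G g v = Ad G g (left_MC G g v)"
proof -
  have "Ad G g (left_MC G g v) = tangent_map M M (\<lambda>h. g \<cdot> (iv g \<cdot> h) \<cdot> iv g) g v"
    unfolding Ad_def left_MC_def
    using tangent_comp[OF smooth_left[of "iv g"] smooth_conj[of g "iv g"], of g v] by simp
  then show ?thesis by (simp add: right_MC_def)
qed

lemma linear_right_MC: "linear (right_MC G g)"
  unfolding right_MC_def by (rule tangent_map_linear[OF mfd mfd smooth_right])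

lemma right_MC_rvf [simp]: "right_MC G g (rvf \<xi> g) = \<xi>"
  using Lie_group.left_MC_lvf[OF op] by simp

lemma left_MC_rvf: "left_MC G g (rvf \<xi> g) = Ad G (iv g) \<xi>"
  using right_MC_eq[of g "rvf \<xi> g"] by (metis Ad_inv(2) right_MC_rvf)

lemma left_MC_inj: "left_MC G g v = left_MC G g w \<Longrightarrow> v = w"
  by (metis lvf_left_MC)

section \<open>Smoothness of the invariant fields and of the Maurer-Cartan form\<close>

lemma local_MC_lderiv:
  assumes "u \<in> cimg M p"
  shows "local_MC G p u v = lderiv M M p \<one> (\<lambda>h. iv (cinv M p u) \<cdot> h) u v"
  unfolding local_MC_eq left_MC_def
  using tangent_map_transition[OF mfd mfd smooth_left assms, of "iv (cinv M p u)" v] by simp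

lemma local_lvf_lderiv:
  assumes u: "u \<in> cimg M p"
  shows "local_vf M p (lvf \<xi>) u = lderiv M M \<one> p (\<lambda>h. cinv M p u \<cdot> h) u1 \<xi>"
proof -
  let ?x = "cinv M p u"
  have "transition M ?x p (rep M M \<one> ?x (\<lambda>h. ?x \<cdot> h) u1) (lderiv M M \<one> ?x (\<lambda>h. ?x \<cdot> h) u1 \<xi>) = lderiv M M \<one> p (\<lambda>h. ?x \<cdot> h) u1 \<xi>"
    by (rule lderiv_transition_left[OF mfd mfd smooth_left])
      (use u in \<open>auto simp: mfd rdom_iff[OF mfd]\<close>)
  then show ?thesis
    by (simp add: local_vf_eq[OF mfd mfd] left_inv_field_def tangent_map_lderiv mfd)
qed

lemma local_MC_linear:
  assumes "u \<in> cimg M p" shows "linear (local_MC G p u)"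
proof -
  have "linear (lderiv M M p \<one> (\<lambda>h. iv (cinv M p u) \<cdot> h) u)"
    by (rule lderiv_linear[OF mfd mfd smooth_left]) (use assms in \<open>auto simp: mfd rdom_iff[OF mfd]\<close>)
  moreover have "local_MC G p u = lderiv M M p \<one> (\<lambda>h. iv (cinv M p u) \<cdot> h) u"
    using local_MC_lderiv[OF assms] by (rule ext)
  ultimately show ?thesis by simp
qed

lemma local_MC_centre [simp]: "local_MC G p (cmap M p p) v = left_MC G p v"
  by (simp add: local_MC_eq mfd transition_centre[OF mfd mfd])

lemma rdom2_iff:
  "(u, w) \<in> rdom (mfd2 G) M (a, b) r F \<longleftrightarrow> u \<in> cimg M a \<and> w \<in> cimg M b \<and> F (cinv M a u, cinv M b w) \<in> cdom M r"
  unfolding rdom_iff[OF mfd2] cimg_prod by (auto simp: cinv_prod[OF mfd mfd] mfd)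

text \<open>At x the form is the derivative of \<open>y \<mapsto> iv x \<cdot> y\<close> at
  \<open>y = x\<close>, that is, a partial derivative of one smooth map on the product, restricted
  to the diagonal.\<close>

lemma smooth_local_MC: "smooth_on (cimg M p) (\<lambda>u. local_MC G p u v)"
proof -
  let ?F = "\<lambda>x. iv (fst x) \<cdot> snd x"
  have F: "smooth_map (mfd2 G) M ?F"
    by (intro smooth_map_mult mfd2 smooth_map_compose[OF mfd2 mfd mfd _ smooth_inv] smooth_map_fst smooth_map_snd mfd)
  have U: "open (cimg M p)" by (rule open_cimg[OF mfd])
  have "smooth_on (cimg M p) (\<lambda>u. lderiv (mfd2 G) M (p, p) \<one> ?F (u, u) (0, v))"
    by (rule smooth_on_compose[OF manifold_fin_dim[OF mfd2] lderiv_smooth[OF mfd2 mfd F] smooth_on_Pair U open_rdom[OF mfd2 mfd F]])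
      (auto simp: U smooth_on_ident rdom2_iff mfd)
  then show ?thesis
    by (rule smooth_on_cong[OF _ U]) (subst lderiv_partial_right[OF mfd mfd mfd F], auto simp: local_MC_lderiv mfd)
qed

text \<open>The field is a partial derivative of the multiplication in its second argument,
  restricted to points whose second component is the unit.\<close>

lemma smooth_local_lvf: "smooth_on (cimg M p) (local_vf M p (lvf \<xi>))"
proof -
  have U: "open (cimg M p)" by (rule open_cimg[OF mfd])
  have "smooth_on (cimg M p) (\<lambda>u. lderiv (mfd2 G) M (p, \<one>) p Mult (u, u1) (0, \<xi>))"
    by (rule smooth_on_compose[OF manifold_fin_dim[OF mfd2] lderiv_smooth[OF mfd2 mfd smooth_mult] smooth_on_Pair U open_rdom[OF mfd2 mfd smooth_mult]])
      (auto simp: U smooth_on_ident smooth_on_const rdom2_iff mfd)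
  then show ?thesis
    by (rule smooth_on_cong[OF _ U]) (subst lderiv_partial_right[OF mfd mfd mfd smooth_mult], auto simp: local_lvf_lderiv mfd)
qed

lemma smooth_local_rvf: "smooth_on (cimg M p) (local_vf M p (rvf \<xi>))"
  using Lie_group.smooth_local_lvf[OF op] by simp

lemma local_MC_local_lvf: "u \<in> cimg M p \<Longrightarrow> local_MC G p u (local_vf M p (lvf \<xi>) u) = \<xi>"
  using transition_local_vf[OF mfd, of u p "lvf \<xi>"] by (simp add: local_MC_eq)

section \<open>The Maurer-Cartan equation\<close>

lemma centre_in: "cmap M p p \<in> cimg M p"
  by (simp add: mfd)

text \<open>This depends on the chart assigned to p. Intrinsic is its antisymmetrization in X and Y,
  the value of the exterior derivative of the left Maurer-Cartan form.\<close>

definition dMC :: "'g \<Rightarrow> 'e \<Rightarrow> 'e \<Rightarrow> 'e" where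
  "dMC p X Y = fderiv (\<lambda>u. local_MC G p u Y) (cmap M p p) X"

lemma local_MC_has_derivative: "((\<lambda>u. local_MC G p u Y) has_derivative (\<lambda>X. dMC p X Y)) (at (cmap M p p))"
  unfolding dMC_def by (rule smooth_on_has_derivative[OF smooth_local_MC centre_in])

lemma local_MC_apply_has_derivative:
  assumes "(a has_derivative a') (at (cmap M p p))"
  shows "((\<lambda>u. local_MC G p u (a u)) has_derivative (\<lambda>X. dMC p X (a (cmap M p p)) + left_MC G p (a' X))) (at (cmap M p p))"
  using has_derivative_linear_apply[where f = "local_MC G p", OF fin open_cimg[OF mfd] centre_in local_MC_linear _ assms]
    smooth_on_differentiable[OF smooth_local_MC centre_in]
  by (simp add: dMC_def)

text \<open>The Maurer-Cartan form is constant on a left-invariant field; the product rule for this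
  constant exchanges the derivative of the field for that of the form.\<close>

lemma fderiv_local_lvf: "left_MC G p (fderiv (local_vf M p (lvf \<xi>)) (cmap M p p) X) = - dMC p X (lvf \<xi> p)"
proof -
  let ?u = "cmap M p p"
  have "((\<lambda>u. local_MC G p u (local_vf M p (lvf \<xi>) u)) has_derivative (\<lambda>X. dMC p X (lvf \<xi> p) + left_MC G p (fderiv (local_vf M p (lvf \<xi>)) ?u X))) (at ?u)"
    using local_MC_apply_has_derivative[OF smooth_on_has_derivative[OF smooth_local_lvf centre_in]]
    by (simp add: local_vf_centre[OF mfd mfd])
  moreover have "((\<lambda>u. local_MC G p u (local_vf M p (lvf \<xi>) u)) has_derivative (\<lambda>X. 0)) (at ?u)"
    by (rule has_derivative_transform_within_open[OF has_derivative_const[of \<xi>] open_cimg[OF mfd] centre_in])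
      (simp add: local_MC_local_lvf)
  ultimately have "(\<lambda>X. dMC p X (lvf \<xi> p) + left_MC G p (fderiv (local_vf M p (lvf \<xi>)) ?u X)) = (\<lambda>X. 0)"
    by (rule has_derivative_unique)
  then show ?thesis by (metis add_eq_0_iff)
qed

lemma br_eq: "br \<xi> \<zeta> = dMC \<one> \<zeta> \<xi> - dMC \<one> \<xi> \<zeta>"
  using fderiv_local_lvf[of \<one> \<zeta> \<xi>] fderiv_local_lvf[of \<one> \<xi> \<zeta>]
  by (simp add: lie_alg_bracket_def lie_bracket_def)

lemma br_skew: "br \<xi> \<zeta> = - br \<zeta> \<xi>"
  by (simp add: br_eq)

text \<open>The left translation that moves p to the unit, in the charts assigned to these two
  points; it makes sense only near p, on \<open>ltrans_dom p\<close>.\<close>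

definition ltrans :: "'g \<Rightarrow> 'e \<Rightarrow> 'e" where
  "ltrans p = rep M M p \<one> (\<lambda>h. iv p \<cdot> h)"

abbreviation ltrans_dom :: "'g \<Rightarrow> 'e set" where
  "ltrans_dom p \<equiv> rdom M M p \<one> (\<lambda>h. iv p \<cdot> h)"

lemma open_ltrans_dom: "open (ltrans_dom p)"
  by (rule open_rdom[OF mfd mfd smooth_left])

lemma centre_in_ltrans_dom: "cmap M p p \<in> ltrans_dom p"
  unfolding rdom_iff[OF mfd] by (simp add: mfd)

lemma smooth_ltrans: "smooth_on (ltrans_dom p) (ltrans p)"
  unfolding ltrans_def by (rule smooth_on_rep[OF mfd mfd smooth_left])

lemma ltrans_centre [simp]: "ltrans p (cmap M p p) = u1"
  by (simp add: ltrans_def mfd)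

lemma cinv_ltrans: "u \<in> ltrans_dom p \<Longrightarrow> cinv M \<one> (ltrans p u) = iv p \<cdot> cinv M p u"
  unfolding rdom_iff[OF mfd] by (simp add: ltrans_def mfd)

lemma ltrans_in: "u \<in> ltrans_dom p \<Longrightarrow> ltrans p u \<in> cimg M \<one>"
  unfolding rdom_iff[OF mfd] by (simp add: ltrans_def)

lemma ltrans_has_derivative: "(ltrans p has_derivative left_MC G p) (at (cmap M p p))"
proof -
  have "fderiv (ltrans p) (cmap M p p) = left_MC G p"
    by (simp add: left_MC_def tangent_map_def ltrans_def)
  then show ?thesis
    using smooth_on_has_derivative[OF smooth_ltrans centre_in_ltrans_dom[of p]] by simp
qed

lemma local_MC_ltrans:
  assumes u: "u \<in> ltrans_dom p"
  shows "local_MC G p u v = local_MC G \<one> (ltrans p u) (fderiv (ltrans p) u v)"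
proof -
  let ?x = "cinv M p u"
  have up: "u \<in> cimg M p" using u unfolding rdom_iff[OF mfd] by simp
  have "local_MC G p u v = lderiv M M p \<one> (\<lambda>h. iv (iv p \<cdot> ?x) \<cdot> (iv p \<cdot> h)) u v"
    by (simp add: local_MC_lderiv[OF up] grp.inverse_distrib_swap grp.assoc)
  also have "\<dots> = lderiv M M \<one> \<one> (\<lambda>h. iv (iv p \<cdot> ?x) \<cdot> h) (ltrans p u) (fderiv (ltrans p) u v)"
    unfolding ltrans_def lderiv_def[symmetric]
    by (rule lderiv_compose[OF mfd mfd mfd smooth_left smooth_left u]) (simp add: mfd)
  also have "\<dots> = local_MC G \<one> (ltrans p u) (fderiv (ltrans p) u v)"
    by (simp add: local_MC_lderiv[OF ltrans_in[OF u]] cinv_ltrans[OF u])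
  finally show ?thesis .
qed

text \<open>At the unit this is the description of the bracket in \<open>br_eq\<close>. Left
  invariance transports it to p; the pull-back under \<open>ltrans p\<close> brings in a second
  derivative of \<open>ltrans p\<close>, which is symmetric and drops out of the difference.\<close>

theorem maurer_cartan: "dMC p X Y - dMC p Y X = - br (left_MC G p X) (left_MC G p Y)"
proof -
  let ?u = "cmap M p p" and ?\<psi> = "ltrans p"
  have sec: "((\<lambda>u. fderiv ?\<psi> u Y) has_derivative fderiv (\<lambda>u. fderiv ?\<psi> u Y) ?u) (at ?u)" for Y
    by (rule smooth_on_has_derivative[OF smooth_on_fderiv[OF smooth_ltrans] centre_in_ltrans_dom])
  have f: "fderiv ?\<psi> ?u = left_MC G p" by (rule fderiv_eq[OF ltrans_has_derivative])
  have chain: "((\<lambda>u. local_MC G \<one> (?\<psi> u) v) has_derivative (\<lambda>X. dMC \<one> (left_MC G p X) v)) (at ?u)" for v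
    using diff_chain_at[OF ltrans_has_derivative, of "\<lambda>u. local_MC G \<one> u v" "\<lambda>X. dMC \<one> X v"] local_MC_has_derivative[of \<one> v]
    by (simp add: o_def)
  have "((\<lambda>u. local_MC G \<one> (?\<psi> u) (fderiv ?\<psi> u Y)) has_derivative
     (\<lambda>X. fderiv (\<lambda>u. local_MC G \<one> (?\<psi> u) (fderiv ?\<psi> ?u Y)) ?u X + local_MC G \<one> (?\<psi> ?u) (fderiv (\<lambda>u. fderiv ?\<psi> u Y) ?u X))) (at ?u)" for Y
  proof (rule has_derivative_linear_apply[OF fin open_ltrans_dom centre_in_ltrans_dom _ _ sec])
    show "linear (local_MC G \<one> (?\<psi> u))" if "u \<in> ltrans_dom p" for u
      by (rule local_MC_linear[OF ltrans_in[OF that]])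
    show "(\<lambda>u. local_MC G \<one> (?\<psi> u) v) differentiable at ?u" for v
      using chain by (auto simp: differentiable_def)
  qed
  from has_derivative_transform_within_open[OF this open_ltrans_dom centre_in_ltrans_dom local_MC_ltrans[symmetric]]
  have "((\<lambda>u. local_MC G p u Y) has_derivative
     (\<lambda>X. dMC \<one> (left_MC G p X) (left_MC G p Y) + fderiv (\<lambda>u. fderiv ?\<psi> u Y) ?u X)) (at ?u)" for Y
    by (simp add: fderiv_eq[OF chain] f)
  from fderiv_eq[OF this] have "dMC p X Y = dMC \<one> (left_MC G p X) (left_MC G p Y) + fderiv (\<lambda>u. fderiv ?\<psi> u Y) ?u X" for X Y
    by (simp add: dMC_def)
  then show ?thesis
    using fderiv_symmetric[OF open_ltrans_dom[of p] centre_in_ltrans_dom[of p] smooth_ltrans[of p], of Y X] by (simp add: br_eq)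
qed

end

section \<open>The differential of the adjoint representation and its consequences\<close>

context Lie_group
begin

lemma right_MC_unit [simp]: "right_MC G \<one> v = v"
  using Lie_group.left_MC_unit[OF op] by simp

lemma rvf_unit [simp]: "rvf \<xi> \<one> = \<xi>"
  using Lie_group.lvf_unit[OF op] by simp

text \<open>In charts, a left-invariant field is the derivative of the multiplication in the second
  factor while the first one moves, and conversely for a right-invariant field. Both sides are
  therefore the second derivative at the unit in the directions \<open>(\<xi>, 0)\<close> and
  \<open>(0, \<zeta>)\<close>, taken in the two orders.\<close>

lemma fderiv_lvf_rvf_unit:
  "fderiv (local_vf M \<one> (lvf \<zeta>)) u1 \<xi> = fderiv (local_vf M \<one> (rvf \<xi>)) u1 \<zeta>"
proof -
  let ?m = "rep (mfd2 G) M (\<one>, \<one>) \<one> Mult" and ?S = "rdom (mfd2 G) M (\<one>, \<one>) \<one> Mult"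
  have S: "open ?S" by (rule open_rdom[OF mfd2 mfd smooth_mult])
  have in_S: "(u1, u1) \<in> ?S" unfolding rdom2_iff by (simp add: mfd)
  have m: "smooth_on ?S ?m" by (rule smooth_on_rep[OF mfd2 mfd smooth_mult])
  note m' = smooth_on_has_derivative[OF smooth_on_fderiv[OF m] in_S]
  have U: "open (cimg M \<one>)" "u1 \<in> cimg M \<one>" by (auto simp: open_cimg[OF mfd] mfd)
  have "((\<lambda>u. fderiv ?m (u, u1) (0, \<zeta>)) has_derivative (\<lambda>X. fderiv (\<lambda>z. fderiv ?m z (0, \<zeta>)) (u1, u1) (X, 0))) (at u1)"
    using diff_chain_at[OF has_derivative_Pair[OF has_derivative_ident has_derivative_const] m'] by (simp add: o_def)
  then have 1: "(local_vf M \<one> (lvf \<zeta>) has_derivative (\<lambda>X. fderiv (\<lambda>z. fderiv ?m z (0, \<zeta>)) (u1, u1) (X, 0))) (at u1)"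
  proof (rule has_derivative_transform_within_open[OF _ U])
    fix u assume u: "u \<in> cimg M \<one>"
    then show "fderiv ?m (u, u1) (0, \<zeta>) = local_vf M \<one> (lvf \<zeta>) u"
      using lderiv_partial_right[OF mfd mfd mfd smooth_mult u U(2), of \<one> \<zeta>]
      by (simp add: local_lvf_lderiv lderiv_def mfd)
  qed
  have "((\<lambda>u. fderiv ?m (u1, u) (\<xi>, 0)) has_derivative (\<lambda>X. fderiv (\<lambda>z. fderiv ?m z (\<xi>, 0)) (u1, u1) (0, X))) (at u1)"
    using diff_chain_at[OF has_derivative_Pair[OF has_derivative_const has_derivative_ident] m'] by (simp add: o_def)
  then have 2: "(local_vf M \<one> (rvf \<xi>) has_derivative (\<lambda>X. fderiv (\<lambda>z. fderiv ?m z (\<xi>, 0)) (u1, u1) (0, X))) (at u1)"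
  proof (rule has_derivative_transform_within_open[OF _ U])
    fix u assume u: "u \<in> cimg M \<one>"
    then show "fderiv ?m (u1, u) (\<xi>, 0) = local_vf M \<one> (rvf \<xi>) u"
      using lderiv_partial_left[OF mfd mfd mfd smooth_mult U(2) u, of \<one> \<xi>] Lie_group.local_lvf_lderiv[OF op, of u \<one> \<xi>]
      by (simp add: lderiv_def mfd)
  qed
  show ?thesis unfolding fderiv_eq[OF 1] fderiv_eq[OF 2]
    by (rule fderiv_symmetric[OF S in_S m])
qed

text \<open>Ad is the right Maurer-Cartan form evaluated on a left-invariant field, so the product
  rule applies to it.\<close>

lemma local_Ad: "u \<in> cimg M p \<Longrightarrow> Ad G (cinv M p u) \<zeta> = local_MC (lie_op G) p u (local_vf M p (lvf \<zeta>) u)"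
  using transition_local_vf[OF mfd, of u p "lvf \<zeta>"] by (simp add: local_MC_eq right_MC_eq)

text \<open>In the product rule the derivative of the right Maurer-Cartan form is that of a
  right-invariant field up to sign; \<open>fderiv_lvf_rvf_unit\<close> turns the latter into the
  derivative of a left-invariant field, and the two terms form the bracket as in
  \<open>br_eq\<close>.\<close>

lemma Ad_has_derivative_unit: "((\<lambda>u. Ad G (cinv M \<one> u) \<zeta>) has_derivative (\<lambda>X. br X \<zeta>)) (at u1)"
proof -
  note R = Lie_group.local_MC_apply_has_derivative[OF op, of _ _ \<one>, simplified]
  have "((\<lambda>u. local_MC (lie_op G) \<one> u (local_vf M \<one> (lvf \<zeta>) u)) has_derivative
      (\<lambda>X. Lie_group.dMC (lie_op G) \<one> X \<zeta> + fderiv (local_vf M \<one> (lvf \<zeta>)) u1 X)) (at u1)"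
    using R[OF smooth_on_has_derivative[OF smooth_local_lvf centre_in]]
    by (simp add: local_vf_centre[OF mfd mfd])
  moreover have "Lie_group.dMC (lie_op G) \<one> X \<zeta> + fderiv (local_vf M \<one> (lvf \<zeta>)) u1 X = br X \<zeta>" for X
    using Lie_group.fderiv_local_lvf[OF op, of \<one> \<zeta> X] fderiv_local_lvf[of \<one> \<zeta> X]
      fderiv_local_lvf[of \<one> X \<zeta>] fderiv_lvf_rvf_unit[of X \<zeta>]
    by (simp add: br_eq)
  ultimately have "((\<lambda>u. local_MC (lie_op G) \<one> u (local_vf M \<one> (lvf \<zeta>) u)) has_derivative (\<lambda>X. br X \<zeta>)) (at u1)"
    by simp
  then show ?thesis
    by (rule has_derivative_transform_within_open[OF _ open_cimg[OF mfd] centre_in]) (simp add: local_Ad)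
qed

text \<open>Near p, Ad is the constant map \<open>Ad G p\<close> after Ad at the point translated to
  the unit.\<close>

theorem Ad_has_derivative:
  "((\<lambda>u. Ad G (cinv M p u) \<zeta>) has_derivative (\<lambda>X. Ad G p (br (left_MC G p X) \<zeta>))) (at (cmap M p p))"
proof -
  have "((\<lambda>u. Ad G (cinv M \<one> (ltrans p u)) \<zeta>) has_derivative (\<lambda>X. br (left_MC G p X) \<zeta>)) (at (cmap M p p))"
    using diff_chain_at[OF ltrans_has_derivative, of "\<lambda>u. Ad G (cinv M \<one> u) \<zeta>" "\<lambda>X. br X \<zeta>"] Ad_has_derivative_unit[of \<zeta>]
    by (simp add: o_def)
  from bounded_linear.has_derivative[OF bounded_linear_fin_dim[OF fin linear_Ad[of p]] this]
  show ?thesis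
    by (rule has_derivative_transform_within_open[OF _ open_ltrans_dom centre_in_ltrans_dom])
      (simp add: cinv_ltrans Ad_mult[symmetric])
qed

text \<open>A derivative is linear, which settles the first argument; skew symmetry settles the
  second.\<close>

lemma bilinear_br: "bilinear br"
proof -
  have 1: "linear (\<lambda>X. br X \<zeta>)" for \<zeta>
    using has_derivative_linear[OF Ad_has_derivative_unit] .
  have "linear (\<lambda>X. br \<zeta> X)" for \<zeta>
    using linear_compose_neg[OF 1[of \<zeta>]] by (subst br_skew)
  then show ?thesis using 1 by (simp add: bilinear_def)
qed

lemma bounded_bilinear_br: "bounded_bilinear br"
  by (rule bounded_bilinear_fin_dim[OF fin fin bilinear_br])

sublocale br: bounded_bilinear br
  by (rule bounded_bilinear_br)

lemma br_self [simp]: "br \<xi> \<xi> = 0"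
  using br_skew[of \<xi> \<xi>] by (simp add: br_eq)

text \<open>Derivative at \<open>h = \<one>\<close> of
  \<open>Ad (g h g^-1) (Ad g \<zeta>) = Ad g (Ad h \<zeta>)\<close>, conjugation by g having
  derivative \<open>Ad G g\<close> there.\<close>

theorem Ad_br: "Ad G g (br \<xi> \<zeta>) = br (Ad G g \<xi>) (Ad G g \<zeta>)"
proof -
  let ?c = "\<lambda>h. g \<cdot> h \<cdot> iv g"
  let ?S = "rdom M M \<one> \<one> ?c"
  have S: "open ?S" by (rule open_rdom[OF mfd mfd smooth_conj])
  have in_S: "u1 \<in> ?S" unfolding rdom_iff[OF mfd] by (simp add: mfd)
  have "(rep M M \<one> \<one> ?c has_derivative Ad G g) (at u1)"
    using rep_has_derivative[OF mfd mfd smooth_conj in_S] by (simp add: Ad_def tangent_map_lderiv)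
  moreover have "rep M M \<one> \<one> ?c u1 = u1" by (simp add: mfd)
  ultimately have "((\<lambda>u. Ad G (cinv M \<one> (rep M M \<one> \<one> ?c u)) (Ad G g \<zeta>)) has_derivative (\<lambda>X. br (Ad G g X) (Ad G g \<zeta>))) (at u1)"
    using diff_chain_at[of "rep M M \<one> \<one> ?c" "Ad G g" u1 "\<lambda>u. Ad G (cinv M \<one> u) (Ad G g \<zeta>)" "\<lambda>X. br X (Ad G g \<zeta>)"]
      Ad_has_derivative_unit[of "Ad G g \<zeta>"]
    by (simp add: o_def[of "\<lambda>u. Ad G (cinv M \<one> u) (Ad G g \<zeta>)"] o_def[of "\<lambda>X. br X (Ad G g \<zeta>)"])
  moreover have "((\<lambda>u. Ad G (cinv M \<one> (rep M M \<one> \<one> ?c u)) (Ad G g \<zeta>)) has_derivative (\<lambda>X. Ad G g (br X \<zeta>))) (at u1)"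
  proof (rule has_derivative_transform_within_open[OF _ S in_S])
    show "((\<lambda>u. Ad G g (Ad G (cinv M \<one> u) \<zeta>)) has_derivative (\<lambda>X. Ad G g (br X \<zeta>))) (at u1)"
      by (rule bounded_linear.has_derivative[OF bounded_linear_fin_dim[OF fin linear_Ad[of g]] Ad_has_derivative_unit])
    show "Ad G g (Ad G (cinv M \<one> u) \<zeta>) = Ad G (cinv M \<one> (rep M M \<one> \<one> ?c u)) (Ad G g \<zeta>)" if "u \<in> ?S" for u
      using that unfolding rdom_iff[OF mfd] by (simp add: mfd Ad_mult[symmetric])
  qed
  ultimately have "(\<lambda>X. Ad G g (br X \<zeta>)) = (\<lambda>X. br (Ad G g X) (Ad G g \<zeta>))"
    by (rule has_derivative_unique[rotated])
  then show ?thesis by (rule fun_cong)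
qed

text \<open>Infinitesimal form of \<open>Ad_br\<close>: both sides of it are differentiated in the
  group element at the unit.\<close>

theorem jacobi: "br \<rho> (br \<xi> \<zeta>) = br (br \<rho> \<xi>) \<zeta> + br \<xi> (br \<rho> \<zeta>)"
proof -
  have "((\<lambda>u. br (Ad G (cinv M \<one> u) \<xi>) (Ad G (cinv M \<one> u) \<zeta>)) has_derivative (\<lambda>X. br \<xi> (br X \<zeta>) + br (br X \<xi>) \<zeta>)) (at u1)"
    using br.FDERIV[OF Ad_has_derivative_unit Ad_has_derivative_unit, of \<xi> \<zeta>] by (simp add: mfd)
  then have "(\<lambda>X. br \<xi> (br X \<zeta>) + br (br X \<xi>) \<zeta>) = (\<lambda>X. br X (br \<xi> \<zeta>))"
    unfolding Ad_br[symmetric] by (rule has_derivative_unique[OF _ Ad_has_derivative_unit])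
  then show ?thesis by (metis add.commute)
qed

end

locale Lie_group_metric = Lie_group G for G :: "('g::{t2_space, second_countable_topology}, 'e::real_inner) lie_group" +
  fixes B :: "'e \<Rightarrow> 'e \<Rightarrow> real"
  assumes inv_B: "invariant_inner_product G B"
begin

abbreviation cs where "cs \<equiv> cartan_section G B"
abbreviation E where "E \<equiv> cartan_dirac G B"
abbreviation E2 where "E2 \<equiv> bundle_prod E E"
abbreviation cartan (\<open>\<eta>\<close>) where "\<eta> \<equiv> cartan_3form G B"
abbreviation mult2 (\<open>\<varsigma>\<close>) where "\<varsigma> \<equiv> mult_2form G B"

lemma bounded_bilinear_B: "bounded_bilinear B"
  using inv_B by (intro bounded_bilinear_fin_dim fin) (simp add: invariant_inner_product_def)

sublocale B: bounded_bilinear B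
  by (rule bounded_bilinear_B)

lemma B_sym: "B \<xi> \<zeta> = B \<zeta> \<xi>"
  using inv_B unfolding invariant_inner_product_def by blast

lemma B_nondeg: "(\<And>\<zeta>. B \<zeta> \<xi> = 0) \<Longrightarrow> \<xi> = 0"
  using inv_B B_sym unfolding invariant_inner_product_def by metis

lemma B_Ad: "B (Ad G g \<xi>) (Ad G g \<zeta>) = B \<xi> \<zeta>"
  using inv_B unfolding invariant_inner_product_def by blast

lemma B_Ad_left: "B (Ad G g \<xi>) \<zeta> = B \<xi> (Ad G (iv g) \<zeta>)"
  using B_Ad[of g \<xi> "Ad G (iv g) \<zeta>"] by simp

lemma B_eqI: "(\<And>\<zeta>. B \<zeta> \<xi> = B \<zeta> \<xi>') \<Longrightarrow> \<xi> = \<xi>'"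
  using B_nondeg[of "\<xi> - \<xi>'"] by (simp add: B.diff_right)

theorem B_br: "B (br \<xi> \<zeta>) \<psi> = B \<xi> (br \<zeta> \<psi>)"
proof -
  have "((\<lambda>u. B (Ad G (cinv M \<one> u) \<xi>) (Ad G (cinv M \<one> u) \<psi>)) has_derivative (\<lambda>X. B \<xi> (br X \<psi>) + B (br X \<xi>) \<psi>)) (at u1)"
    using B.FDERIV[OF Ad_has_derivative_unit Ad_has_derivative_unit, of \<xi> \<psi>] by (simp add: mfd)
  then have "(\<lambda>X. B \<xi> (br X \<psi>) + B (br X \<xi>) \<psi>) = (\<lambda>X. 0)"
    unfolding B_Ad by (rule has_derivative_unique[OF _ has_derivative_const])
  then have "B \<xi> (br \<zeta> \<psi>) + B (br \<zeta> \<xi>) \<psi> = 0" by (rule fun_cong)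
  then show ?thesis using br_skew[of \<xi> \<zeta>] by (simp add: B.minus_left)
qed

end

section \<open>The Cartan-Dirac structure\<close>

lemma length_nths_compl: "length (nths vs S) + length (nths vs (- S)) = length vs"
proof (induction vs arbitrary: S)
  case (Cons v vs)
  have "{j. Suc j \<in> - S} = - {j. Suc j \<in> S}" by auto
  then show ?case using Cons.IH[of "{j. Suc j \<in> S}"] by (simp add: nths_Cons)
qed simp

lemma wedge_at_degree:
  assumes "\<And>r. length r \<noteq> k \<Longrightarrow> p r = 0" "\<And>r. length r \<noteq> l \<Longrightarrow> q r = 0"
    and b: "\<And>y. b 0 y = 0" "\<And>x. b x 0 = 0" and vs: "length vs \<noteq> k + l"
  shows "wedge_at b p q vs = 0"
  unfolding wedge_at_def
proof (rule sum.neutral, rule ballI)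
  fix S
  have "length (nths vs S) \<noteq> k \<or> length (nths vs (- S)) \<noteq> l"
    using length_nths_compl[of vs S] vs by linarith
  then have "b (p (nths vs S)) (q (nths vs (- S))) = 0" using assms by metis
  then show "(-1) ^ card {(i, j). i < j \<and> i \<in> {..<length vs} - S \<and> j \<in> S} *\<^sub>R b (p (nths vs S)) (q (nths vs (- S))) = 0"
    by simp
qed

lemma length_3_cases:
  assumes "length vs = 3" obtains x y z where "vs = [x, y, z]"
  using assms by (auto simp: length_Suc_conv numeral_3_eq_3)

lemma length_2_cases:
  assumes "length vs = 2" obtains x y where "vs = [x, y]"
  using assms by (auto simp: length_Suc_conv numeral_2_eq_2)

lemma alternating_3I:
  fixes \<phi> :: "'e::real_vector list \<Rightarrow> real"
  assumes deg: "\<And>vs. length vs \<noteq> 3 \<Longrightarrow> \<phi> vs = 0"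
    and lin: "\<And>y z. linear (\<lambda>x. \<phi> [x, y, z])" "\<And>x z. linear (\<lambda>y. \<phi> [x, y, z])" "\<And>x y. linear (\<lambda>z. \<phi> [x, y, z])"
    and alt: "\<And>x z. \<phi> [x, x, z] = 0" "\<And>x y. \<phi> [x, y, x] = 0" "\<And>x y. \<phi> [x, y, y] = 0"
  shows "alternating \<phi>"
  unfolding alternating_def
proof (intro conjI allI impI)
  fix vs :: "'e list" and i :: nat assume i: "i < length vs"
  show "linear (\<lambda>v. \<phi> (vs[i := v]))"
  proof (cases "length vs = 3")
    case True
    then obtain x y z where vs: "vs = [x, y, z]" by (rule length_3_cases)
    from i consider "i = 0" | "i = 1" | "i = 2" unfolding vs by fastforce
    then show ?thesis by cases (use lin vs in auto)
  qed (use deg linear_zero in simp)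
next
  fix vs :: "'e list" and i j :: nat assume ij: "i < j \<and> j < length vs \<and> vs ! i = vs ! j"
  show "\<phi> vs = 0"
  proof (cases "length vs = 3")
    case True
    then obtain x y z where vs: "vs = [x, y, z]" by (rule length_3_cases)
    from ij consider "i = 0" "j = 1" | "i = 0" "j = 2" | "i = 1" "j = 2" unfolding vs by fastforce
    then show ?thesis by cases (use alt vs ij in auto)
  qed (use deg in simp)
qed

lemma alternating_2I:
  fixes \<phi> :: "'e::real_vector list \<Rightarrow> real"
  assumes deg: "\<And>vs. length vs \<noteq> 2 \<Longrightarrow> \<phi> vs = 0"
    and lin: "\<And>y. linear (\<lambda>x. \<phi> [x, y])" "\<And>x. linear (\<lambda>y. \<phi> [x, y])"
    and alt: "\<And>x. \<phi> [x, x] = 0"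
  shows "alternating \<phi>"
  unfolding alternating_def
proof (intro conjI allI impI)
  fix vs :: "'e list" and i :: nat assume i: "i < length vs"
  show "linear (\<lambda>v. \<phi> (vs[i := v]))"
  proof (cases "length vs = 2")
    case True
    then obtain x y where vs: "vs = [x, y]" by (rule length_2_cases)
    from i consider "i = 0" | "i = 1" unfolding vs by fastforce
    then show ?thesis by cases (use lin vs in auto)
  qed (use deg linear_zero in simp)
next
  fix vs :: "'e list" and i j :: nat assume ij: "i < j \<and> j < length vs \<and> vs ! i = vs ! j"
  show "\<phi> vs = 0"
  proof (cases "length vs = 2")
    case True
    then obtain x y where vs: "vs = [x, y]" by (rule length_2_cases)
    from ij have "i = 0" "j = 1" unfolding vs by auto
    then show ?thesis using alt vs ij by auto
  qed (use deg in simp)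
qed

text \<open>A vector outside the range could be added to the image of \<open>onb\<close>, giving an
  independent set larger than the spanning set \<open>onb\<close>.\<close>

lemma inj_linear_imp_surj_fin_dim:
  assumes "fin_dim TYPE('a::real_inner)" "linear (T :: 'a \<Rightarrow> 'a)" "inj T"
  shows "surj T"
proof (rule ccontr)
  assume "\<not> surj T"
  let ?E = "onb :: 'a set"
  have fin: "finite ?E" by (rule onb(1)[OF assms(1)])
  have ind: "independent ?E"
  proof (rule pairwise_orthogonal_independent)
    show "pairwise orthogonal ?E" using onb(2)[OF assms(1)] by (auto simp: pairwise_def orthogonal_def)
    show "0 \<notin> ?E"
    proof
      assume "0 \<in> ?E"
      from onb(2)[OF assms(1) this this] show False by simp
    qed
  qed
  have indT: "independent (T ` ?E)"
    using linear_independent_injective_image[OF assms(2) ind] inj_on_subset[OF assms(3)] by blast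
  have "span (T ` ?E) = range T"
    using linear_span_image[OF assms(2), of ?E] onb(3)[OF assms(1)] by simp
  with \<open>\<not> surj T\<close> obtain x where x: "x \<notin> span (T ` ?E)" by auto
  have "independent (insert x (T ` ?E))" using x indT by (simp add: independent_insert)
  then have "card (insert x (T ` ?E)) \<le> card ?E"
    using independent_span_bound[OF fin] onb(3)[OF assms(1)] by auto
  moreover have "x \<notin> T ` ?E" using x span_base[of x "T ` ?E"] by auto
  moreover have "card (T ` ?E) = card ?E" using assms(3) by (simp add: card_image inj_on_subset)
  ultimately show False using fin by simp
qed

context Lie_group_metric
begin

section \<open>The Cartan 3-form\<close>

lemma one_form_degree: "length r \<noteq> 1 \<Longrightarrow> one_form \<alpha> g r = 0"
  by (simp add: one_form_def)

lemma cartan_3form_degree: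
  assumes "length vs \<noteq> 3" shows "\<eta> g vs = 0"
proof -
  have w: "wedge_at br (one_form (left_MC G) g) (one_form (left_MC G) g) r = 0" if "length r \<noteq> 2" for r
    by (rule wedge_at_degree[of 1 _ 1]) (use that in \<open>auto simp: one_form_degree br.zero_left br.zero_right\<close>)
  have "wedge_at B (one_form (left_MC G) g) (wedge_at br (one_form (left_MC G) g) (one_form (left_MC G) g)) vs = 0"
    by (rule wedge_at_degree[of 1 _ 2]) (use assms in \<open>auto simp: one_form_degree w B.zero_left B.zero_right\<close>)
  moreover have "wedge br (one_form (left_MC G)) (one_form (left_MC G)) g
      = wedge_at br (one_form (left_MC G) g) (one_form (left_MC G) g)"
    by (simp add: wedge_wedge_at fun_eq_iff)
  ultimately show ?thesis by (simp add: cartan_3form_def wedge_wedge_at)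
qed

lemma B_cyclic: "B x (br y z) = B y (br z x)" "B x (br y z) = B z (br x y)"
  by (metis B_br B_sym)+

text \<open>The inner wedge has two shuffles, equal by skew symmetry of the bracket; the outer one
  has three, equal by invariance of B. The factor 6 against 1/12 leaves 1/2.\<close>

lemma cartan_3form_eq:
  "\<eta> g [x, y, z] = 1 / 2 * B (left_MC G g x) (br (left_MC G g y) (left_MC G g z))"
proof -
  let ?f = "one_form (left_MC G) g"
  have 2: "wedge br (one_form (left_MC G)) (one_form (left_MC G)) g = wedge_at br ?f ?f"
    by (simp add: wedge_wedge_at fun_eq_iff)
  let ?x = "left_MC G g x" and ?y = "left_MC G g y" and ?z = "left_MC G g z"
  have w2: "wedge_at br ?f ?f [v, w] = 2 *\<^sub>R br (left_MC G g v) (left_MC G g w)" for v w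
    using br_skew[of "left_MC G g v" "left_MC G g w"]
    by (simp add: wedge_at_Cons[of br, OF br.minus_left] one_form_def br.zero_left br.zero_right br.minus_left scaleR_2)
  have w1: "wedge_at br ?f ?f r = 0" if "length r \<noteq> 2" for r
    by (rule wedge_at_degree[of 1 _ 1]) (use that in \<open>auto simp: one_form_degree br.zero_left br.zero_right\<close>)
  have "wedge_at B ?f (wedge_at br ?f ?f) [x, y, z]
    = 2 * B ?x (br ?y ?z) - 2 * B ?y (br ?x ?z) + 2 * B ?z (br ?x ?y)"
    unfolding wedge_at_Cons[of B, OF B.minus_left] wedge_at_Nil
    by (simp add: one_form_def B.zero_left B.zero_right B.minus_left w2 B.scaleR_right w1)
  also have "B ?y (br ?x ?z) = - B ?x (br ?y ?z)"
    using B_cyclic(1)[of ?x ?y ?z] br_skew[of ?x ?z] by (simp add: B.minus_right)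
  also have "B ?z (br ?x ?y) = B ?x (br ?y ?z)" using B_cyclic(2)[of ?x ?y ?z] by simp
  finally show ?thesis unfolding cartan_3form_def wedge_wedge_at 2 by simp
qed

lemma local_cartan_3form:
  "local_form M p (\<eta>) u [x, y, z]
    = 1 / 2 * B (local_MC G p u x) (br (local_MC G p u y) (local_MC G p u z))"
  by (simp add: local_form_def Let_def cartan_3form_eq local_MC_eq)

lemma local_cartan_3form_degree: "length vs \<noteq> 3 \<Longrightarrow> local_form M p (\<eta>) u vs = 0"
  by (simp add: local_form_def Let_def cartan_3form_degree)

lemma alternating_cartan_3form: "alternating (\<eta> g)"
proof (rule alternating_3I)
  note l = linear_add[OF linear_left_MC] linear_cmul[OF linear_left_MC]
  show "linear (\<lambda>x. \<eta> g [x, y, z])" "linear (\<lambda>x. \<eta> g [y, x, z])"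
    "linear (\<lambda>x. \<eta> g [y, z, x])" for y z
    by (auto intro!: linearI simp: cartan_3form_eq l B.add_left B.add_right br.add_left br.add_right
        B.scaleR_left B.scaleR_right br.scaleR_left br.scaleR_right distrib_left)
  show "\<eta> g [x, x, z] = 0" for x z
    by (simp add: cartan_3form_eq B_br[symmetric] B.zero_left)
  show "\<eta> g [x, y, x] = 0" for x y
    by (subst cartan_3form_eq, subst B_cyclic(1)) (simp add: B.zero_right)
  show "\<eta> g [x, y, y] = 0" for x y
    by (simp add: cartan_3form_eq B.zero_right)
qed (rule cartan_3form_degree)

lemma cartan_3form_kForms: "\<eta> \<in> kForms 3 M"
proof -
  have "smooth_on (cimg M p) (\<lambda>u. local_form M p (\<eta>) u vs)" for p vs
  proof (cases "length vs = 3")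
    case True
    then obtain x y z where vs: "vs = [x, y, z]" by (rule length_3_cases)
    have "smooth_on (cimg M p) (\<lambda>u. 1 / 2 * B (local_MC G p u x) (br (local_MC G p u y) (local_MC G p u z)))"
      by (intro smooth_on_bounded_bilinear[OF bounded_bilinear_mult] smooth_on_bounded_bilinear[OF bounded_bilinear_B]
          smooth_on_bounded_bilinear[OF bounded_bilinear_br] smooth_local_MC open_cimg mfd smooth_on_const)
    then show ?thesis by (simp add: vs local_cartan_3form)
  qed (simp add: local_cartan_3form_degree smooth_on_const)
  then show ?thesis
    by (simp add: kForms_def Forms_def homogeneous_def alternating_cartan_3form cartan_3form_degree)
qed

lemma fderiv_local_cartan_3form:
  "fderiv (\<lambda>u. local_form M p (\<eta>) u [x, y, z]) (cmap M p p) w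
    = 1 / 2 * (B (dMC p w x) (br (left_MC G p y) (left_MC G p z))
      + B (dMC p w y) (br (left_MC G p z) (left_MC G p x)) + B (dMC p w z) (br (left_MC G p x) (left_MC G p y)))"
proof -
  have "((\<lambda>u. 1 / 2 * B (local_MC G p u x) (br (local_MC G p u y) (local_MC G p u z))) has_derivative
    (\<lambda>w. 1 / 2 * (B (left_MC G p x) (br (left_MC G p y) (dMC p w z) + br (dMC p w y) (left_MC G p z))
      + B (dMC p w x) (br (left_MC G p y) (left_MC G p z))))) (at (cmap M p p))"
    using has_derivative_mult_right[OF B.FDERIV[OF local_MC_has_derivative br.FDERIV[OF local_MC_has_derivative local_MC_has_derivative]], of "1 / 2" p x y z]
    by simp
  from fderiv_eq[OF this] show ?thesis
    using B_cyclic(2)[of "left_MC G p x" "left_MC G p y" "dMC p w z"] B_cyclic(1)[of "left_MC G p x" "dMC p w y" "left_MC G p z"]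
    by (simp add: local_cartan_3form B.add_right)
qed

lemma ext_d_degree:
  assumes "\<And>p u r. length r \<noteq> k \<Longrightarrow> local_form M' p \<omega> u r = 0" "length vs \<noteq> Suc k"
  shows "ext_d M' \<omega> x vs = 0"
proof -
  have "(\<lambda>u. local_form M' x \<omega> u (take i vs @ drop (Suc i) vs)) = (\<lambda>u. 0)" if "i < length vs" for i
    by (rule ext, rule assms(1)) (use assms(2) that in auto)
  then show ?thesis by (simp add: ext_d_def)
qed

text \<open>In the alternating sum each \<open>dMC\<close> meets its transpose, so that only
  antisymmetric parts remain. The Maurer-Cartan equation turns these into brackets, leaving the sum
  in \<open>J\<close>.\<close>

lemma closed_cartan_3form: "closed_form M (\<eta>)"
  unfolding closed_form_def
proof (intro ext)
  fix p vs
  show "ext_d M (\<eta>) p vs = 0"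
  proof (cases "length vs = 4")
    case True
    then obtain a b c d where vs: "vs = [a, b, c, d]"
      by (auto simp: length_Suc_conv eval_nat_numeral)
    let ?\<theta> = "left_MC G p"
    have mc: "dMC p y x = dMC p x y + br (?\<theta> x) (?\<theta> y)" for x y
      using maurer_cartan[of p x y] by (simp add: algebra_simps)
    have sk: "br (?\<theta> b) (?\<theta> a) = - br (?\<theta> a) (?\<theta> b)" "br (?\<theta> c) (?\<theta> a) = - br (?\<theta> a) (?\<theta> c)"
      "br (?\<theta> d) (?\<theta> a) = - br (?\<theta> a) (?\<theta> d)" "br (?\<theta> c) (?\<theta> b) = - br (?\<theta> b) (?\<theta> c)"
      "br (?\<theta> d) (?\<theta> b) = - br (?\<theta> b) (?\<theta> d)" "br (?\<theta> d) (?\<theta> c) = - br (?\<theta> c) (?\<theta> d)"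
      by (rule br_skew)+
    \<comment> \<open>Invariance of B moves the value at a out of the first bracket in each term:
      the sum is the Jacobi identity for b, c, d paired with a.\<close>
    have J: "B (br (?\<theta> a) (?\<theta> b)) (br (?\<theta> c) (?\<theta> d)) - B (br (?\<theta> a) (?\<theta> c)) (br (?\<theta> b) (?\<theta> d)) + B (br (?\<theta> a) (?\<theta> d)) (br (?\<theta> b) (?\<theta> c)) = 0"
      unfolding B_br using jacobi[of "?\<theta> b" "?\<theta> c" "?\<theta> d"] br_skew[of "?\<theta> d" "br (?\<theta> b) (?\<theta> c)"]
      by (simp add: B.add_right B.minus_right)
    have "ext_d M (\<eta>) p vs = fderiv (\<lambda>u. local_form M p (\<eta>) u [b, c, d]) (cmap M p p) a
      - fderiv (\<lambda>u. local_form M p (\<eta>) u [a, c, d]) (cmap M p p) b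
      + fderiv (\<lambda>u. local_form M p (\<eta>) u [a, b, d]) (cmap M p p) c
      - fderiv (\<lambda>u. local_form M p (\<eta>) u [a, b, c]) (cmap M p p) d"
      by (simp add: ext_d_alt_sum vs)
    also have "\<dots> = 0"
      unfolding fderiv_local_cartan_3form mc[of b a] mc[of c a] mc[of d a] mc[of c b] mc[of d b] mc[of d c] sk
      using J B_sym[of "br (?\<theta> a) (?\<theta> b)" "br (?\<theta> c) (?\<theta> d)"] B_sym[of "br (?\<theta> a) (?\<theta> c)" "br (?\<theta> b) (?\<theta> d)"]
        B_sym[of "br (?\<theta> a) (?\<theta> d)" "br (?\<theta> b) (?\<theta> c)"]
      by (simp only: B.add_left B.minus_left B.minus_right) (simp add: field_simps)
    finally show ?thesis .
  qed (auto intro: ext_d_degree[of 3] local_cartan_3form_degree)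
qed

section \<open>The Lagrangian property and the parameter of an element\<close>

lemma fst_cartan_section [simp]: "left_MC G g (fst (cs \<xi> g)) = \<xi> - Ad G (iv g) \<xi>"
  by (simp add: cartan_section_def linear_diff[OF linear_left_MC] left_MC_rvf)

lemma snd_cartan_section: "snd (cs \<xi> g) v = 1 / 2 * B (left_MC G g v) (\<xi> + Ad G (iv g) \<xi>)"
  by (simp add: cartan_section_def right_MC_eq B.add_left B.add_right B.scaleR_left B_Ad_left)

lemma cartan_section_eqI:
  assumes "left_MC G g v = \<xi> - Ad G (iv g) \<xi>" "\<And>y. \<alpha> y = 1 / 2 * B (left_MC G g y) (\<xi> + Ad G (iv g) \<xi>)"
  shows "cs \<xi> g = (v, \<alpha>)"
proof (rule prod_eqI)
  show "fst (cs \<xi> g) = fst (v, \<alpha>)"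
    by (rule left_MC_inj[of g]) (simp add: assms(1))
  show "snd (cs \<xi> g) = snd (v, \<alpha>)"
    by (rule ext) (simp add: assms(2) snd_cartan_section)
qed

text \<open>The vector that represents the inner product with e by means of B; for e in
  \<open>onb\<close> these vectors form the basis dual to \<open>onb\<close> under B.\<close>

definition dual_vec :: "'e \<Rightarrow> 'e" where
  "dual_vec e = (SOME m. \<forall>e'\<in>onb. B e' m = e \<bullet> e')"

text \<open>Nondegeneracy makes the endomorphism \<open>?T\<close>, which collects the values of B
  on \<open>onb\<close>, injective and hence surjective.\<close>

lemma dual_vec: "e' \<in> onb \<Longrightarrow> B e' (dual_vec e) = e \<bullet> e'"
proof -
  let ?T = "\<lambda>m. \<Sum>e\<in>onb. B e m *\<^sub>R e"
  have lin: "linear ?T"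
    by (auto intro!: linearI simp: B.add_right B.scaleR_right scaleR_add_left sum.distrib scaleR_sum_right)
  have T: "?T m \<bullet> e' = B e' m" if "e' \<in> onb" for m e'
  proof -
    have "?T m \<bullet> e' = (\<Sum>e\<in>onb. B e m * (if e = e' then 1 else 0))"
      unfolding inner_sum_left by (rule sum.cong) (use onb(2)[OF fin _ that] in auto)
    also have "\<dots> = (\<Sum>e\<in>onb. if e = e' then B e m else 0)" by (rule sum.cong) auto
    finally show ?thesis using that onb(1)[OF fin] by simp
  qed
  have "inj ?T"
  proof (subst linear_injective_0[OF lin], intro allI impI)
    fix m assume m: "?T m = 0"
    have "B e' m = 0" if "e' \<in> onb" for e' using T[OF that, of m] m by simp
    moreover have "linear (\<lambda>\<zeta>. B \<zeta> m)" by (auto intro!: linearI simp: B.add_left B.scaleR_left)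
    ultimately have "B \<zeta> m = 0" for \<zeta>
      using linear_onb_expansion[OF fin, of "\<lambda>\<zeta>. B \<zeta> m" \<zeta>] by (simp add: sum.neutral)
    then show "m = 0" by (rule B_nondeg)
  qed
  from inj_linear_imp_surj_fin_dim[OF fin lin this] obtain m where m: "e = ?T m" by (rule surjE)
  have "\<exists>m. \<forall>e'\<in>onb. B e' m = e \<bullet> e'" by (intro exI[of _ m] ballI) (simp only: m T)
  from someI_ex[OF this] show "e' \<in> onb \<Longrightarrow> B e' (dual_vec e) = e \<bullet> e'"
    by (auto simp: dual_vec_def)
qed

text \<open>Inverse of the isomorphism from vectors to covectors given by B. Being a finite
  combination of constant vectors, it preserves smooth dependence on the covector.\<close>

definition sharp :: "('e \<Rightarrow> real) \<Rightarrow> 'e" where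
  "sharp \<alpha> = (\<Sum>e\<in>onb. \<alpha> e *\<^sub>R dual_vec e)"

lemma B_sharp:
  assumes "linear \<alpha>" shows "B \<zeta> (sharp \<alpha>) = \<alpha> \<zeta>"
proof -
  have on: "B e' (sharp \<alpha>) = \<alpha> e'" if e': "e' \<in> onb" for e'
  proof -
    have "B e' (sharp \<alpha>) = (\<Sum>e\<in>onb. \<alpha> e * (if e = e' then 1 else 0))"
      unfolding sharp_def B.sum_right B.scaleR_right
      by (rule sum.cong) (use dual_vec[OF e'] onb(2)[OF fin _ e'] in auto)
    also have "\<dots> = (\<Sum>e\<in>onb. if e = e' then \<alpha> e else 0)" by (rule sum.cong) auto
    finally show ?thesis using e' onb(1)[OF fin] by simp
  qed
  have l: "linear (\<lambda>\<zeta>. B \<zeta> (sharp \<alpha>))" by (auto intro!: linearI simp: B.add_left B.scaleR_left)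
  show ?thesis
    unfolding linear_onb_expansion[OF fin l, of \<zeta>] linear_onb_expansion[OF fin assms, of \<zeta>]
    by (rule sum.cong) (simp_all add: on)
qed

lemma sharp_B: "sharp (\<lambda>\<zeta>. B \<zeta> m) = m"
proof (rule B_eqI)
  have "linear (\<lambda>\<zeta>. B \<zeta> m)" by (auto intro!: linearI simp: B.add_left B.scaleR_left)
  from B_sharp[OF this] show "B \<zeta> (sharp (\<lambda>\<zeta>. B \<zeta> m)) = B \<zeta> m" for \<zeta> .
qed

text \<open>Half of the vector part \<open>\<xi> - Ad g\<^sup>-\<^sup>1 \<xi>\<close> plus the covector part \<open>(\<xi> + Ad g\<^sup>-\<^sup>1 \<xi>) / 2\<close>.\<close>

definition param :: "'g \<Rightarrow> 'e pont \<Rightarrow> 'e" where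
  "param g w = (1 / 2) *\<^sub>R left_MC G g (fst w) + sharp (\<lambda>\<zeta>. snd w (lvf \<zeta> g))"

lemma param_cartan_section [simp]: "param g (cs \<xi> g) = \<xi>"
proof -
  have "(\<lambda>\<zeta>. snd (cs \<xi> g) (lvf \<zeta> g)) = (\<lambda>\<zeta>. B \<zeta> ((1 / 2) *\<^sub>R (\<xi> + Ad G (iv g) \<xi>)))"
    by (simp add: snd_cartan_section B.scaleR_right fun_eq_iff)
  then show ?thesis
    by (simp add: param_def sharp_B scaleR_add_right[symmetric] scaleR_2[symmetric])
qed

lemma cartan_section_Pont: "cs \<xi> g \<in> Pont"
  by (auto intro!: linearI simp: Pont_def snd_cartan_section linear_add[OF linear_left_MC] linear_cmul[OF linear_left_MC]
      B.add_left B.scaleR_left distrib_left)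

text \<open>With \<open>k = Ad G (iv g)\<close> the mixed terms cancel and
  \<open>B \<xi> \<zeta> - B (k \<xi>) (k \<zeta>)\<close> remains.\<close>

lemma cartan_section_isotropic: "pairing (cs \<xi> g) (cs \<zeta> g) = 0"
proof -
  have "B (Ad G (iv g) x) y = B x (Ad G g y)" for x y using B_Ad_left[of "iv g" x y] by simp
  then show ?thesis
    using B_sym[of \<xi> \<zeta>] B_sym[of "Ad G g \<xi>" \<zeta>] B_sym[of \<xi> "Ad G g \<zeta>"] B_Ad_left[of g \<xi> \<zeta>] B_Ad_left[of g \<zeta> \<xi>]
    by (simp add: pairing_def snd_cartan_section B.diff_left B.add_right B_Ad diff_divide_distrib)
qed

text \<open>Maximality is shown without a dimension count: an element orthogonal to all the sections
  is exhibited as the section whose parameter is the one prescribed by \<open>param\<close>.\<close>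

lemma lagrangian_cartan_dirac: "lagrangian (E g)"
  unfolding lagrangian_def
proof (intro equalityI subsetI)
  fix w assume "w \<in> E g"
  then show "w \<in> {w \<in> Pont. \<forall>w'\<in>E g. pairing w w' = 0}"
    by (auto simp: cartan_dirac_def cartan_section_Pont cartan_section_isotropic)
next
  fix w assume "w \<in> {w \<in> Pont. \<forall>w'\<in>E g. pairing w w' = 0}"
  then obtain v \<alpha> where w: "w = (v, \<alpha>)" "linear \<alpha>" and iso: "\<And>\<xi>. pairing (v, \<alpha>) (cs \<xi> g) = 0"
    by (cases w) (auto simp: cartan_dirac_def Pont_def)
  define a where "a = left_MC G g v"
  define b where "b = sharp (\<lambda>\<zeta>. \<alpha> (lvf \<zeta> g))"
  have "linear (\<lambda>\<zeta>. \<alpha> (lvf \<zeta> g))" using linear_compose[OF linear_lvf w(2)] by (simp add: o_def)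
  from B_sharp[OF this] have "B \<zeta> b = \<alpha> (lvf \<zeta> g)" for \<zeta> by (simp add: b_def)
  then have \<alpha>: "\<alpha> y = B (left_MC G g y) b" for y by (metis lvf_left_MC)
  \<comment> \<open>Orthogonality to the section with parameter \<zeta>, with everything moved to
    the right of \<zeta>. The resulting equation says that \<open>Ad G (iv g)\<close> sends the
    candidate \<open>b + a / 2\<close> to \<open>b - a / 2\<close>; difference and half sum of the
    two are a and b.\<close>
  have "B \<zeta> (b + (1 / 2) *\<^sub>R a) = B \<zeta> (Ad G g (b - (1 / 2) *\<^sub>R a))" for \<zeta>
  proof -
    have "pairing (v, \<alpha>) (cs \<zeta> g) = B \<zeta> b - B \<zeta> (Ad G g b) + 1 / 2 * (B \<zeta> a + B \<zeta> (Ad G g a))"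
      using B_Ad_left[of "iv g" \<zeta> b] B_sym[of \<zeta> a] B_Ad_left[of g a \<zeta>] B_sym[of \<zeta> "Ad G g a"]
      by (simp add: pairing_def snd_cartan_section \<alpha> B.diff_left B.add_right a_def[symmetric])
    then show ?thesis using iso[of \<zeta>]
      by (simp add: B.add_right B.diff_right B.scaleR_right linear_diff[OF linear_Ad] linear_cmul[OF linear_Ad] algebra_simps)
  qed
  then have "b + (1 / 2) *\<^sub>R a = Ad G g (b - (1 / 2) *\<^sub>R a)" by (rule B_eqI)
  then have Ad': "Ad G (iv g) (b + (1 / 2) *\<^sub>R a) = b - (1 / 2) *\<^sub>R a" by simp
  have "cs (b + (1 / 2) *\<^sub>R a) g = (v, \<alpha>)"
  proof (rule cartan_section_eqI)
    show "left_MC G g v = b + (1 / 2) *\<^sub>R a - Ad G (iv g) (b + (1 / 2) *\<^sub>R a)"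
      unfolding Ad' by (simp add: a_def[symmetric] scaleR_2[symmetric])
    show "\<alpha> y = 1 / 2 * B (left_MC G g y) (b + (1 / 2) *\<^sub>R a + Ad G (iv g) (b + (1 / 2) *\<^sub>R a))" for y
      unfolding Ad' by (simp add: \<alpha> B.add_right)
  qed
  then show "w \<in> E g" unfolding w cartan_dirac_def by (metis rangeI)
qed

end

section \<open>Inversion and sections with variable parameter\<close>

lemma has_derivative_chain_at:
  assumes "(g has_derivative g') (at x)" "(f has_derivative f') (at y)" "g x = y"
  shows "((\<lambda>x. f (g x)) has_derivative (\<lambda>v. f' (g' v))) (at x)"
  using diff_chain_at[of g g' x f f'] assms by (simp add: o_def)

context Lie_group
begin

text \<open>Differentiation of \<open>g \<cdot> iv g = \<one>\<close>, as a map of two variables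
  restricted to the diagonal.\<close>

lemma left_MC_inv: "left_MC G (iv g) (tangent_map M M iv g v) = - right_MC G g v"
proof -
  let ?F = "\<lambda>z. fst z \<cdot> iv (snd z)"
  have F: "smooth_map (mfd2 G) M ?F"
    by (intro smooth_map_mult mfd2 smooth_map_compose[OF mfd2 mfd mfd _ smooth_inv] smooth_map_fst smooth_map_snd mfd)
  have diag: "smooth_map M (mfd2 G) (\<lambda>x. (x, x))"
    by (intro smooth_map_Pair mfd smooth_map_ident)
  have "tangent_map M M (\<lambda>x. ?F (x, x)) g v = tangent_map (mfd2 G) M ?F (g, g) (v, v)"
    using tangent_map_compose[OF mfd mfd2 mfd diag F, of g v]
      tangent_map_Pair[OF mfd mfd mfd smooth_map_ident[OF mfd] smooth_map_ident[OF mfd], of g v]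
    by (simp add: tangent_map_ident[OF mfd mfd])
  also have "\<dots> = right_MC G g v + tangent_map M M (\<lambda>y. g \<cdot> iv y) g v"
    using tangent_map_partial[OF mfd mfd mfd F, of g g v v] by (simp add: right_MC_def)
  also have "tangent_map M M (\<lambda>y. g \<cdot> iv y) g v = left_MC G (iv g) (tangent_map M M iv g v)"
    using tangent_comp[OF smooth_inv smooth_left[of g], of g v] by (simp add: left_MC_def)
  finally have "right_MC G g v + left_MC G (iv g) (tangent_map M M iv g v) = 0"
    by (simp add: tangent_map_const[OF mfd mfd])
  then show ?thesis by (simp add: eq_neg_iff_add_eq_0 add.commute)
qed

text \<open>Chain rule with the inversion: by \<open>left_MC_inv\<close> it brings in the negative
  of the right Maurer-Cartan form, which \<open>Ad G (iv p)\<close> turns into the left one.\<close>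

lemma Ad_inv_has_derivative:
  "((\<lambda>u. Ad G (iv (cinv M p u)) \<zeta>) has_derivative (\<lambda>X. - br (left_MC G p X) (Ad G (iv p) \<zeta>))) (at (cmap M p p))"
proof -
  let ?r = "rep M M p (iv p) iv" and ?S = "rdom M M p (iv p) iv"
  have in_S: "cmap M p p \<in> ?S" unfolding rdom_iff[OF mfd] by (simp add: mfd)
  have r: "(?r has_derivative tangent_map M M iv p) (at (cmap M p p))"
    using rep_has_derivative[OF mfd mfd smooth_inv in_S] by (simp add: tangent_map_lderiv)
  have c: "?r (cmap M p p) = cmap M (iv p) (iv p)" by (simp add: mfd)
  have eq: "Ad G (iv p) (br (left_MC G (iv p) (tangent_map M M iv p X)) \<zeta>) = - br (left_MC G p X) (Ad G (iv p) \<zeta>)" for X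
    by (simp add: left_MC_inv right_MC_eq Ad_br linear_neg[OF linear_Ad] br.minus_left)
  have "((\<lambda>u. Ad G (cinv M (iv p) (?r u)) \<zeta>) has_derivative
      (\<lambda>X. Ad G (iv p) (br (left_MC G (iv p) (tangent_map M M iv p X)) \<zeta>))) (at (cmap M p p))"
    by (rule has_derivative_chain_at[OF r Ad_has_derivative c])
  then show ?thesis unfolding eq
    by (rule has_derivative_transform_within_open[OF _ open_rdom[OF mfd mfd smooth_inv] in_S])
      (unfold rdom_iff[OF mfd], simp add: mfd)
qed

definition smooth_fn :: "('g \<Rightarrow> 'e) \<Rightarrow> bool" where
  "smooth_fn f \<longleftrightarrow> (\<forall>p. smooth_on (cimg M p) (\<lambda>u. f (cinv M p u)))"

definition fn_deriv :: "('g \<Rightarrow> 'e) \<Rightarrow> 'g \<Rightarrow> 'e \<Rightarrow> 'e" where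
  "fn_deriv f x = fderiv (\<lambda>u. f (cinv M x u)) (cmap M x x)"

lemma fn_has_derivative:
  "smooth_fn f \<Longrightarrow> ((\<lambda>u. f (cinv M x u)) has_derivative fn_deriv f x) (at (cmap M x x))"
  unfolding fn_deriv_def smooth_fn_def using smooth_on_has_derivative centre_in by blast

text \<open>\<open>fn_deriv\<close> uses a different chart at each point; this reads it in a single
  chart, where its smoothness can be seen.\<close>

lemma fn_deriv_chart:
  assumes f: "smooth_fn f" and u: "u \<in> cimg M p"
  shows "fn_deriv f (cinv M p u) (transition M p (cinv M p u) u w) = fderiv (\<lambda>u. f (cinv M p u)) u w"
proof -
  let ?x = "cinv M p u"
  let ?S = "rdom M M p ?x (\<lambda>x. x)"
  have in_S: "u \<in> ?S" unfolding rdom_iff[OF mfd] using u by (simp add: mfd)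
  have "(rep M M p ?x (\<lambda>x. x) has_derivative transition M p ?x u) (at u)"
    unfolding transition_lderiv by (rule rep_has_derivative[OF mfd mfd smooth_map_ident[OF mfd] in_S])
  from has_derivative_chain_at[OF this fn_has_derivative[OF f, of ?x]]
  have "((\<lambda>u. f (cinv M ?x (rep M M p ?x (\<lambda>x. x) u))) has_derivative
      (\<lambda>w. fn_deriv f ?x (transition M p ?x u w))) (at u)"
    by simp
  then have "((\<lambda>u. f (cinv M p u)) has_derivative (\<lambda>w. fn_deriv f ?x (transition M p ?x u w))) (at u)"
    by (rule has_derivative_transform_within_open[OF _ open_rdom[OF mfd mfd smooth_map_ident[OF mfd]] in_S])
      (unfold rdom_iff[OF mfd], simp add: mfd)
  from fderiv_eq[OF this] show ?thesis by simp
qed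

lemma smooth_fn_deriv:
  assumes f: "smooth_fn f" and X: "\<And>p. smooth_on (cimg M p) (local_vf M p X)"
  shows "smooth_fn (\<lambda>x. fn_deriv f x (X x))"
  unfolding smooth_fn_def
proof
  fix p
  note U = open_cimg[OF mfd, of p]
  have fp: "smooth_on (cimg M p) (\<lambda>u. f (cinv M p u))" using f by (simp add: smooth_fn_def)
  have "smooth_on (cimg M p) (\<lambda>u. fderiv (\<lambda>u. f (cinv M p u)) u (local_vf M p X u))"
    by (rule smooth_on_linear_apply[where f = "\<lambda>u. fderiv (\<lambda>u. f (cinv M p u)) u", OF fin U _ _ X])
      (auto intro: linear_frechet_derivative smooth_on_differentiable[OF fp] smooth_on_fderiv[OF fp])
  then show "smooth_on (cimg M p) (\<lambda>u. fn_deriv f (cinv M p u) (X (cinv M p u)))"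
    by (rule smooth_on_cong[OF _ U])
      (metis fn_deriv_chart[OF f] transition_local_vf[OF mfd])
qed

end

context Lie_group_metric
begin

lemma smooth_cartan_section:
  assumes f: "smooth_fn f"
  shows "smooth_section_on M UNIV (\<lambda>x. cs (f x) x)"
  unfolding smooth_section_on_def Int_UNIV_right
proof (intro conjI allI ballI cartan_section_Pont)
  fix p v
  let ?f = "\<lambda>u. f (cinv M p u)"
  note U = open_cimg[OF mfd, of p]
  have fp: "smooth_on (cimg M p) ?f" using f by (simp add: smooth_fn_def)
  have lin_tr: "linear (transition M (cinv M p u) p (cmap M (cinv M p u) (cinv M p u)))" if "u \<in> cimg M p" for u
    by (rule transition_linear[OF mfd mfd]) (use that in \<open>auto simp: mfd\<close>)
  have lin: "linear (\<lambda>\<xi>. local_vf M p (lvf \<xi>) u)" "linear (\<lambda>\<xi>. local_vf M p (rvf \<xi>) u)" if "u \<in> cimg M p" for u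
    using linear_compose[OF linear_lvf lin_tr[OF that]] linear_compose[OF Lie_group.linear_lvf[OF op] lin_tr[OF that]]
    by (simp_all add: local_vf_eq[OF mfd mfd] o_def)
  have "smooth_on (cimg M p) (\<lambda>u. local_vf M p (lvf (?f u)) u - local_vf M p (rvf (?f u)) u)"
    by (rule smooth_on_diff[OF U smooth_on_linear_apply[where f = "\<lambda>u \<xi>. local_vf M p (lvf \<xi>) u", OF fin U _ _ fp]
          smooth_on_linear_apply[where f = "\<lambda>u \<xi>. local_vf M p (rvf \<xi>) u", OF fin U _ _ fp]])
      (simp_all add: lin smooth_local_lvf smooth_local_rvf)
  then show "smooth_on (cimg M p) (local_vf M p (\<lambda>x. fst (cs (f x) x)))"
    by (rule smooth_on_cong[OF _ U]) (simp add: local_vf_eq[OF mfd mfd] cartan_section_def linear_diff[OF lin_tr])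
  have "smooth_on (cimg M p) (\<lambda>u. B ((1 / 2) *\<^sub>R (local_MC G p u v + local_MC (lie_op G) p u v)) (?f u))"
    using Lie_group.smooth_local_MC[OF op, of p v]
    by (intro smooth_on_bounded_bilinear[OF bounded_bilinear_B] smooth_on_bounded_linear_compose[OF bounded_linear_scaleR_right]
        smooth_on_add U smooth_local_MC fp) simp
  then show "smooth_on (cimg M p) (\<lambda>u. local_form M p (one_form (\<lambda>x. snd (cs (f x) x))) u [v])"
    by (rule smooth_on_cong[OF _ U]) (simp add: local_form_def one_form_def Let_def local_MC_eq cartan_section_def)
qed

text \<open>Converse of \<open>smooth_cartan_section\<close>: together they identify all smooth
  sections of the bundle with smooth parameters, as required for closure under the bracket.\<close>

lemma smooth_param:
  assumes s: "smooth_section_on M UNIV s"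
  shows "smooth_fn (\<lambda>x. param x (s x))"
  unfolding smooth_fn_def
proof
  fix p
  note U = open_cimg[OF mfd, of p]
  let ?V = "vpart M s p" and ?a = "cpart M s p"
  have V: "smooth_on (cimg M p) ?V" and a: "smooth_on (cimg M p) (\<lambda>u. ?a u v)" for v
    using s by (auto simp: smooth_section_on_def lcov_def)
  have lin: "linear (?a u)" if "u \<in> cimg M p" for u
    by (rule lcov_linear[OF mfd _ that]) (use s in \<open>auto simp: smooth_section_on_def Pont_def\<close>)
  have 1: "smooth_on (cimg M p) (\<lambda>u. local_MC G p u (?V u))"
    by (rule smooth_on_linear_apply[where f = "local_MC G p", OF fin U local_MC_linear smooth_local_MC V])
  have 2: "smooth_on (cimg M p) (\<lambda>u. ?a u (local_vf M p (lvf e) u))" for e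
    by (rule smooth_on_linear_apply[where f = ?a, OF fin U lin a smooth_local_lvf])
  have "smooth_on (cimg M p) (\<lambda>u. (1 / 2) *\<^sub>R local_MC G p u (?V u) + (\<Sum>e\<in>onb. ?a u (local_vf M p (lvf e) u) *\<^sub>R dual_vec e))"
    by (intro smooth_on_add smooth_on_sum U smooth_on_bounded_linear_compose[OF bounded_linear_scaleR_right]
      smooth_on_bounded_linear_compose[OF bounded_linear_scaleR_left] 1 2)
  then show "smooth_on (cimg M p) (\<lambda>u. param (cinv M p u) (s (cinv M p u)))"
    by (rule smooth_on_cong[OF _ U]) (simp add: param_def sharp_def local_MC_eq lcov_eq transition_local_vf[OF mfd])
qed

lemma cartan_dirac_param: "w \<in> E g \<Longrightarrow> cs (param g w) g = w"
  by (auto simp: cartan_dirac_def)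

text \<open>In the two identities below, \<open>k\<^sub>i\<close> stands for \<open>Ad g\<^sup>-\<^sup>1 f\<^sub>i\<close> and \<open>f\<^sub>i - k\<^sub>i\<close> is the vector part of the section
  with parameter \<open>f\<^sub>i\<close>, read in the left trivialization.\<close>

lemma courant_vector_identity:
  assumes "m12 - m21 = - br (f1 - k1) (f2 - k2)"
  shows "p2 - (Kp2 - br (f1 - k1) k2) - m12 - (p1 - (Kp1 - br (f2 - k2) k1) - m21)
    = br f1 f2 + p2 - p1 - (br k1 k2 + Kp2 - Kp1)"
proof -
  \<comment> \<open>\<open>m12\<close> and \<open>m21\<close> stand for \<open>dMC\<close> on the
    two vector parts in either order, \<open>p2\<close> for the derivative of the second parameter
    along the first vector part, \<open>p1\<close> for that of the first along the second, and
    \<open>Kp2\<close>, \<open>Kp1\<close> for their images under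
    \<open>Ad G (iv x)\<close>.\<close>
  have m: "m12 = m21 - br (f1 - k1) (f2 - k2)" using assms by (simp add: algebra_simps)
  show ?thesis
    unfolding m using br_skew[of f2 k1] br_skew[of k2 k1]
    by (simp add: br.diff_left br.diff_right algebra_simps)
qed

lemma courant_covector_identity:
  assumes "d1y = dy1 - br (f1 - k1) y" "d2y = dy2 - br (f2 - k2) y" and K: "B Kq k2 = B q f2"
  shows "1 / 2 * B d1y (f2 + k2) + 1 / 2 * B y (p2 + (Kp2 - br (f1 - k1) k2))
    + 1 / 2 * B (q - (Kq - br y k1) - dy1) (f2 + k2)
    - (1 / 2 * B d2y (f1 + k1) + 1 / 2 * B y (p1 + (Kp1 - br (f2 - k2) k1)))
    + (1 / 2 * B dy2 (f1 + k1) + 1 / 2 * B (f2 - k2) (q + (Kq - br y k1)))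
    - 1 / 2 * B (f1 - k1) (br (f2 - k2) y)
    = 1 / 2 * B y (br f1 f2 + p2 - p1 + (br k1 k2 + Kp2 - Kp1))"
proof -
  \<comment> \<open>Invariance of B moves y out of every bracket, so that both sides become
    combinations of values \<open>B y (br a b)\<close>. Here \<open>q\<close> is the derivative of
    the first parameter in the direction that y represents.\<close>
  have R: "B (br y a) b = B y (br a b)" "B a (br y b) = B y (br b a)" "B a (br b y) = B y (br a b)"
    "B (br a y) b = - B y (br a b)" for a b
    using B_br[of y a b] B_cyclic(1)[of a y b] B_cyclic(2)[of a b y] br_skew[of a y]
    by (simp_all add: B.minus_left)
  have sk: "br f2 f1 = - br f1 f2" "br f2 k1 = - br k1 f2" "br k2 f1 = - br f1 k2" "br k2 k1 = - br k1 k2"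
    by (rule br_skew)+
  show ?thesis
    unfolding assms(1,2) using K B_sym[of f2 q] B_sym[of f2 Kq] B_sym[of k2 q] B_sym[of k2 Kq]
    by (simp add: B.add_left B.add_right B.diff_left B.diff_right br.add_left br.add_right br.diff_left br.diff_right
        R sk B.minus_right field_simps)
qed

section \<open>Courant brackets of sections of the Cartan-Dirac structure\<close>

context
  fixes f :: "'g \<Rightarrow> 'e" and x :: 'g
  assumes f: "smooth_fn f"
begin

definition twist_deriv :: "'e \<Rightarrow> 'e" where
  "twist_deriv X = Ad G (iv x) (fn_deriv f x X) - br (left_MC G x X) (Ad G (iv x) (f x))"

lemma twist_has_derivative:
  "((\<lambda>u. Ad G (iv (cinv M x u)) (f (cinv M x u))) has_derivative twist_deriv) (at (cmap M x x))"
  using has_derivative_linear_apply[where f = "\<lambda>u. Ad G (iv (cinv M x u))", OF fin open_cimg[OF mfd] centre_in linear_Ad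
      differentiableI[OF Ad_inv_has_derivative] fn_has_derivative[OF f, of x]]
  by (simp add: fderiv_eq[OF Ad_inv_has_derivative] twist_deriv_def[abs_def] mfd)

text \<open>The Maurer-Cartan form takes the vector part to \<open>f - Ad g^-1 f\<close>; both sides
  are differentiated, and the derivative of the form contributes the \<open>dMC\<close>
  term.\<close>

lemma fderiv_local_vf_cartan_section:
  "left_MC G x (fderiv (local_vf M x (\<lambda>x. fst (cs (f x) x))) (cmap M x x) X)
    = fn_deriv f x X - twist_deriv X - dMC x X (fst (cs (f x) x))"
proof -
  let ?V = "local_vf M x (\<lambda>x. fst (cs (f x) x))" and ?u = "cmap M x x"
  have "smooth_on (cimg M x) ?V"
    using smooth_cartan_section[OF f] by (simp add: smooth_section_on_def)
  from smooth_on_has_derivative[OF this centre_in]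
  have 1: "((\<lambda>u. local_MC G x u (?V u)) has_derivative (\<lambda>X. dMC x X (?V ?u) + left_MC G x (fderiv ?V ?u X))) (at ?u)"
    by (rule local_MC_apply_has_derivative)
  have "((\<lambda>u. local_MC G x u (?V u)) has_derivative (\<lambda>X. fn_deriv f x X - twist_deriv X)) (at ?u)"
    by (rule has_derivative_transform_within_open[OF has_derivative_diff[OF fn_has_derivative[OF f] twist_has_derivative]
          open_cimg[OF mfd] centre_in]) (simp add: local_MC_eq transition_local_vf[OF mfd])
  from fun_cong[OF has_derivative_unique[OF 1 this], of X] show ?thesis
    by (simp add: local_vf_centre[OF mfd mfd] algebra_simps)
qed

lemma fderiv_lcov_cartan_section:
  "fderiv (\<lambda>u. lcov M x (\<lambda>x. snd (cs (f x) x)) u y) (cmap M x x) X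
    = 1 / 2 * B (dMC x X y) (f x + Ad G (iv x) (f x)) + 1 / 2 * B (left_MC G x y) (fn_deriv f x X + twist_deriv X)"
proof -
  have "((\<lambda>u. 1 / 2 * B (local_MC G x u y) (f (cinv M x u) + Ad G (iv (cinv M x u)) (f (cinv M x u)))) has_derivative
    (\<lambda>X. 1 / 2 * (B (left_MC G x y) (fn_deriv f x X + twist_deriv X) + B (dMC x X y) (f x + Ad G (iv x) (f x))))) (at (cmap M x x))"
    using has_derivative_mult_right[OF B.FDERIV[OF local_MC_has_derivative has_derivative_add[OF fn_has_derivative[OF f] twist_has_derivative]], of "1 / 2" y]
    by (simp add: mfd)
  then have "((\<lambda>u. lcov M x (\<lambda>x. snd (cs (f x) x)) u y) has_derivative
    (\<lambda>X. 1 / 2 * (B (left_MC G x y) (fn_deriv f x X + twist_deriv X) + B (dMC x X y) (f x + Ad G (iv x) (f x))))) (at (cmap M x x))"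
    by (rule has_derivative_transform_within_open[OF _ open_cimg[OF mfd] centre_in])
      (simp add: lcov_eq snd_cartan_section local_MC_eq)
  from fderiv_eq[OF this] show ?thesis by (simp add: algebra_simps)
qed

end

text \<open>Sections are compared by the Maurer-Cartan form on vector parts and by representing
  vectors on covector parts. The chart-dependent terms \<open>dMC\<close> then pair off into
  differences, to which the Maurer-Cartan equation applies.\<close>

theorem courant_cartan_section:
  assumes f1: "smooth_fn f1" and f2: "smooth_fn f2"
  defines "s1 \<equiv> \<lambda>x. cs (f1 x) x" and "s2 \<equiv> \<lambda>x. cs (f2 x) x"
  shows "courant M (\<eta>) s1 s2 x
    = cs (br (f1 x) (f2 x) + fn_deriv f2 x (fst (s1 x)) - fn_deriv f1 x (fst (s2 x))) x"
proof -
  let ?u = "cmap M x x" and ?\<theta> = "left_MC G x" and ?K = "Ad G (iv x)"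
  define V1 where "V1 = fst (s1 x)"
  define V2 where "V2 = fst (s2 x)"
  let ?h = "br (f1 x) (f2 x) + fn_deriv f2 x V1 - fn_deriv f1 x V2"
  have V: "?\<theta> V1 = f1 x - ?K (f1 x)" "?\<theta> V2 = f2 x - ?K (f2 x)"
    by (simp_all add: V1_def V2_def s1_def s2_def)
  have Kh: "?K ?h = br (?K (f1 x)) (?K (f2 x)) + ?K (fn_deriv f2 x V1) - ?K (fn_deriv f1 x V2)"
    by (simp add: linear_add[OF linear_Ad] linear_diff[OF linear_Ad] Ad_br)
  have dV1: "?\<theta> (fderiv (vpart M s1 x) ?u X) = fn_deriv f1 x X - twist_deriv f1 x X - dMC x X V1" for X
    using fderiv_local_vf_cartan_section[OF f1, of x X] by (simp add: s1_def V1_def)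
  have dV2: "?\<theta> (fderiv (vpart M s2 x) ?u X) = fn_deriv f2 x X - twist_deriv f2 x X - dMC x X V2" for X
    using fderiv_local_vf_cartan_section[OF f2, of x X] by (simp add: s2_def V2_def)
  have da1: "fderiv (\<lambda>u. cpart M s1 x u y) ?u X
      = 1 / 2 * B (dMC x X y) (f1 x + ?K (f1 x)) + 1 / 2 * B (?\<theta> y) (fn_deriv f1 x X + twist_deriv f1 x X)" for X y
    using fderiv_lcov_cartan_section[OF f1, of x y X] by (simp add: s1_def)
  have da2: "fderiv (\<lambda>u. cpart M s2 x u y) ?u X
      = 1 / 2 * B (dMC x X y) (f2 x + ?K (f2 x)) + 1 / 2 * B (?\<theta> y) (fn_deriv f2 x X + twist_deriv f2 x X)" for X y
    using fderiv_lcov_cartan_section[OF f2, of x y X] by (simp add: s2_def)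
  have a2: "snd (s2 x) y = 1 / 2 * B (?\<theta> y) (f2 x + ?K (f2 x))" for y
    by (simp add: s2_def snd_cartan_section)
  have "cs ?h x
    = (fderiv (vpart M s2 x) ?u V1 - fderiv (vpart M s1 x) ?u V2,
      \<lambda>w. fderiv (\<lambda>u. cpart M s2 x u w) ?u V1 + snd (s2 x) (fderiv (vpart M s1 x) ?u w)
        - fderiv (\<lambda>u. cpart M s1 x u w) ?u V2
        + fderiv (\<lambda>u. cpart M s1 x u V2) ?u w - \<eta> x [V1, V2, w])"
  proof (rule cartan_section_eqI)
    show "?\<theta> (fderiv (vpart M s2 x) ?u V1 - fderiv (vpart M s1 x) ?u V2) = ?h - ?K ?h"
      unfolding Kh linear_diff[OF linear_left_MC] dV1 dV2 twist_deriv_def[OF f1] twist_deriv_def[OF f2] V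
      by (rule courant_vector_identity) (simp add: maurer_cartan V)
  next
    fix y
    have m: "dMC x V1 y = dMC x y V1 - br (f1 x - ?K (f1 x)) (?\<theta> y)" "dMC x V2 y = dMC x y V2 - br (f2 x - ?K (f2 x)) (?\<theta> y)"
      using maurer_cartan[of x V1 y] maurer_cartan[of x V2 y] V by (simp_all add: algebra_simps)
    have K: "B (?K (fn_deriv f1 x y)) (?K (f2 x)) = B (fn_deriv f1 x y) (f2 x)" by (rule B_Ad)
    show "fderiv (\<lambda>u. cpart M s2 x u y) ?u V1 + snd (s2 x) (fderiv (vpart M s1 x) ?u y)
        - fderiv (\<lambda>u. cpart M s1 x u y) ?u V2
        + fderiv (\<lambda>u. cpart M s1 x u V2) ?u y - \<eta> x [V1, V2, y]
      = 1 / 2 * B (?\<theta> y) (?h + ?K ?h)"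
      unfolding Kh da1 da2 a2 dV1 twist_deriv_def[OF f1] twist_deriv_def[OF f2] cartan_3form_eq V
      by (rule courant_covector_identity[OF m K])
  qed
  then show ?thesis
    by (simp add: courant_def Let_def local_vf_centre[OF mfd mfd] lcov_centre[OF mfd] V1_def V2_def)
qed

lemma courant_closed:
  assumes s: "s1 \<in> sections M (E)" "s2 \<in> sections M (E)"
  shows "\<exists>s3\<in>sections M (E). is_courant_bracket M (\<eta>) s1 s2 s3"
proof -
  define f1 where "f1 = (\<lambda>x. param x (s1 x))"
  define f2 where "f2 = (\<lambda>x. param x (s2 x))"
  have sm: "smooth_section_on M UNIV s1" "smooth_section_on M UNIV s2" using s by (auto simp: sections_def)
  have f: "smooth_fn f1" "smooth_fn f2" using sm by (simp_all add: f1_def f2_def smooth_param)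
  have eq: "s1 = (\<lambda>x. cs (f1 x) x)" "s2 = (\<lambda>x. cs (f2 x) x)"
    using s by (auto simp: fun_eq_iff f1_def f2_def sections_def cartan_dirac_param)
  define h where "h = (\<lambda>x. br (f1 x) (f2 x) + fn_deriv f2 x (fst (s1 x)) - fn_deriv f1 x (fst (s2 x)))"
  have V: "smooth_on (cimg M p) (vpart M s1 p)" "smooth_on (cimg M p) (vpart M s2 p)" for p
    using sm by (auto simp: smooth_section_on_def)
  have d: "smooth_fn (\<lambda>x. fn_deriv f2 x (fst (s1 x)))" "smooth_fn (\<lambda>x. fn_deriv f1 x (fst (s2 x)))"
    by (intro smooth_fn_deriv f V)+
  have "smooth_fn h"
    using f d unfolding smooth_fn_def h_def
    by (auto intro!: smooth_on_diff smooth_on_add smooth_on_bounded_bilinear[OF bounded_bilinear_br] open_cimg mfd)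
  then have "smooth_section_on M UNIV (\<lambda>x. cs (h x) x)" by (rule smooth_cartan_section)
  moreover have "courant M (\<eta>) s1 s2 = (\<lambda>x. cs (h x) x)"
    unfolding h_def eq by (rule ext) (rule courant_cartan_section[OF f])
  ultimately have "courant M (\<eta>) s1 s2 \<in> sections M (E)"
    by (simp add: sections_def cartan_dirac_def)
  moreover have "is_courant_bracket M (\<eta>) s1 s2 (courant M (\<eta>) s1 s2)"
    using cartan_3form_kForms by (intro is_courant_bracket_courant mfd sm) (simp add: kForms_def)
  ultimately show ?thesis by blast
qed

lemma cartan_section_sum:
  "cs (\<Sum>i<n. c i *\<^sub>R b i) x
    = (\<Sum>i<n. c i *\<^sub>R fst (cs (b i) x), \<lambda>v. \<Sum>i<n. c i * snd (cs (b i) x) v)"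
  by (rule cartan_section_eqI)
    (simp_all add: linear_sum[OF linear_left_MC] linear_cmul[OF linear_left_MC] linear_sum[OF linear_Ad] linear_cmul[OF linear_Ad]
      scaleR_diff_right sum_subtractf snd_cartan_section B.add_right B.sum_right B.scaleR_right sum_distrib_left distrib_left sum.distrib mult_ac)

text \<open>Constant parameters from a basis give a frame over the whole group, and injectivity of
  the trivialization comes from \<open>param\<close>.\<close>

lemma smooth_subbundle_cartan_dirac: "smooth_subbundle M (E)"
proof -
  let ?n = "card (onb :: 'e set)"
  obtain b where b: "bij_betw b {0..<?n} (onb :: 'e set)"
    using ex_bij_betw_nat_finite[OF onb(1)[OF fin]] by blast
  have b_in: "b i \<in> onb" if "i < ?n" for i using bij_betwE[OF b] that by auto
  have b_inner: "b i \<bullet> b j = (if i = j then 1 else 0)" if "i < ?n" "j < ?n" for i j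
    using onb(2)[OF fin b_in[OF that(1)] b_in[OF that(2)]] bij_betw_imp_inj_on[OF b] that by (auto simp: inj_on_eq_iff)
  have expand: "(\<Sum>i<?n. (w \<bullet> b i) *\<^sub>R b i) = w" for w
    using sum.reindex_bij_betw[OF b, of "\<lambda>e. (w \<bullet> e) *\<^sub>R e"] onb_expansion[OF fin, of w] by (simp add: atLeast0LessThan)
  have bij1: "bij_betw (\<lambda>c. \<Sum>i<?n. c i *\<^sub>R b i) ({..<?n} \<rightarrow>\<^sub>E UNIV) UNIV"
  proof (rule bij_betw_byWitness[where f' = "\<lambda>w. restrict (\<lambda>i. w \<bullet> b i) {..<?n}"])
    show "\<forall>c\<in>{..<?n} \<rightarrow>\<^sub>E UNIV. restrict (\<lambda>i. (\<Sum>i<?n. c i *\<^sub>R b i) \<bullet> b i) {..<?n} = c"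
    proof
      fix c :: "nat \<Rightarrow> real" assume c: "c \<in> {..<?n} \<rightarrow>\<^sub>E UNIV"
      have "(\<Sum>i<?n. c i *\<^sub>R b i) \<bullet> b j = c j" if "j < ?n" for j
      proof -
        have "(\<Sum>i<?n. c i *\<^sub>R b i) \<bullet> b j = (\<Sum>i<?n. if i = j then c i else 0)"
          unfolding inner_sum_left by (rule sum.cong) (use b_inner that in auto)
        then show ?thesis using that by simp
      qed
      then show "restrict (\<lambda>i. (\<Sum>i<?n. c i *\<^sub>R b i) \<bullet> b i) {..<?n} = c"
        using c by (auto simp: restrict_def PiE_def extensional_def)
    qed
  qed (use expand in \<open>auto split: if_splits\<close>)
  have bij2: "bij_betw (\<lambda>\<xi>. cs \<xi> x) UNIV (E x)" for x
    unfolding bij_betw_def cartan_dirac_def by (metis inj_onI param_cartan_section)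
  have "bij_betw (\<lambda>c. (\<Sum>i<?n. c i *\<^sub>R fst (cs (b i) x), \<lambda>v. \<Sum>i<?n. c i * snd (cs (b i) x) v))
      ({..<?n} \<rightarrow>\<^sub>E UNIV) (E x)" for x
    using bij_betw_trans[OF bij1 bij2[of x]] by (simp add: o_def cartan_section_sum)
  moreover have "smooth_section_on M UNIV (\<lambda>x. cs (b i) x)" for i
    by (rule smooth_cartan_section) (simp add: smooth_fn_def smooth_on_const)
  ultimately have "open UNIV \<and> p \<in> UNIV \<and> (\<forall>i<?n. smooth_section_on M UNIV (\<lambda>x. cs (b i) x)) \<and>
      (\<forall>x\<in>UNIV. bij_betw (\<lambda>c. (\<Sum>i<?n. c i *\<^sub>R fst (cs (b i) x), \<lambda>v. \<Sum>i<?n. c i * snd (cs (b i) x) v))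
      ({..<?n} \<rightarrow>\<^sub>E UNIV) (E x))" for p :: 'g
    by simp
  then show ?thesis unfolding smooth_subbundle_def
    by (intro allI exI[of _ UNIV] exI[of _ ?n] exI[of _ "\<lambda>i x. cs (b i) x"])
qed

theorem dirac_manifold_cartan: "dirac_manifold M (E) (\<eta>)"
  unfolding dirac_manifold_def
  using mfd smooth_subbundle_cartan_dirac lagrangian_cartan_dirac cartan_3form_kForms closed_cartan_3form courant_closed
  by blast

end

section \<open>The square of a Lie group\<close>

definition lie_square :: "('g, 'e) lie_group \<Rightarrow> ('g \<times> 'g, 'e \<times> 'e) lie_group" where
  "lie_square G = \<lparr>mfd = mfd2 G, mul = \<lambda>x y. (mul G (fst x) (fst y), mul G (snd x) (snd y)),
     unit = (unit G, unit G), inver = \<lambda>x. (inver G (fst x), inver G (snd x))\<rparr>"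

lemma lie_square_simps [simp]:
  "mfd (lie_square G) = mfd2 G" "mul (lie_square G) x y = (mul G (fst x) (fst y), mul G (snd x) (snd y))"
  "unit (lie_square G) = (unit G, unit G)" "inver (lie_square G) x = (inver G (fst x), inver G (snd x))"
  by (simp_all add: lie_square_def)

definition square_form :: "('e \<Rightarrow> 'e \<Rightarrow> real) \<Rightarrow> 'e \<times> 'e \<Rightarrow> 'e \<times> 'e \<Rightarrow> real" where
  "square_form B v w = B (fst v) (fst w) + B (snd v) (snd w)"

context Lie_group
begin

text \<open>By the symmetry in \<open>fderiv_lvf_rvf_unit\<close>, the derivative of the right
  Maurer-Cartan form at the unit is the transpose of that of the left one.\<close>

lemma lie_alg_bracket_op: "lie_alg_bracket (lie_op G) \<xi> \<zeta> = - br \<xi> \<zeta>"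
proof -
  have "Lie_group.dMC (lie_op G) \<one> X Y = dMC \<one> Y X" for X Y
    using Lie_group.fderiv_local_lvf[OF op, of \<one> Y X] fderiv_local_lvf[of \<one> X Y] fderiv_lvf_rvf_unit[of X Y]
    by simp
  then show ?thesis using Lie_group.br_eq[OF op, of \<xi> \<zeta>] by (simp add: br_eq)
qed

lemma right_maurer_cartan:
  "Lie_group.dMC (lie_op G) p X Y - Lie_group.dMC (lie_op G) p Y X = br (right_MC G p X) (right_MC G p Y)"
  using Lie_group.maurer_cartan[OF op, of p X Y] by (simp add: lie_alg_bracket_op)

lemma Lie_group_square: "Lie_group (lie_square G)"
proof
  have K: "smooth_manifold (prod_atlas (mfd2 G) (mfd2 G))" by (rule smooth_manifold_prod[OF mfd2 mfd2])
  note fs = smooth_map_fst[OF mfd2 mfd2] smooth_map_snd[OF mfd2 mfd2]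
  have "group (mul (lie_square G)) (unit (lie_square G)) (inver (lie_square G))"
    by standard (simp_all add: grp.assoc)
  moreover have "smooth_map (prod_atlas (mfd2 G) (mfd2 G)) (mfd2 G)
      (\<lambda>z. (fst (fst z) \<cdot> fst (snd z), snd (fst z) \<cdot> snd (snd z)))"
    by (intro smooth_map_Pair[OF mfd mfd K] smooth_map_mult[OF K]
        smooth_map_compose[OF K mfd2 mfd fs(1) smooth_map_fst[OF mfd mfd]] smooth_map_compose[OF K mfd2 mfd fs(2) smooth_map_fst[OF mfd mfd]]
        smooth_map_compose[OF K mfd2 mfd fs(1) smooth_map_snd[OF mfd mfd]] smooth_map_compose[OF K mfd2 mfd fs(2) smooth_map_snd[OF mfd mfd]])
  moreover have "(\<lambda>(x, y). mul (lie_square G) x y) = (\<lambda>z. (fst (fst z) \<cdot> fst (snd z), snd (fst z) \<cdot> snd (snd z)))"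
    by (simp add: fun_eq_iff)
  moreover have "smooth_map (mfd2 G) (mfd2 G) (\<lambda>x. (iv (fst x), iv (snd x)))"
    by (intro smooth_map_Pair[OF mfd mfd mfd2] smooth_map_compose[OF mfd2 mfd mfd _ smooth_inv] smooth_map_fst smooth_map_snd mfd)
  moreover have "inver (lie_square G) = (\<lambda>x. (iv (fst x), iv (snd x)))" by (simp add: fun_eq_iff)
  ultimately show "is_lie_group (lie_square G)"
    using mfd2 by (simp only: is_lie_group_def lie_square_simps)
qed

lemma tangent_map_prod_map:
  assumes f: "smooth_map M M f" and g: "smooth_map M M g"
  shows "tangent_map (mfd2 G) (mfd2 G) (\<lambda>x. (f (fst x), g (snd x))) z v
    = (tangent_map M M f (fst z) (fst v), tangent_map M M g (snd z) (snd v))"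
proof -
  note fs = smooth_map_fst[OF mfd mfd] smooth_map_snd[OF mfd mfd]
  have fg: "smooth_map (mfd2 G) M (\<lambda>x. f (fst x))" "smooth_map (mfd2 G) M (\<lambda>x. g (snd x))"
    by (rule smooth_map_compose[OF mfd2 mfd mfd fs(1) f], rule smooth_map_compose[OF mfd2 mfd mfd fs(2) g])
  show ?thesis
    unfolding tangent_map_Pair[OF mfd mfd mfd2 fg] tangent_map_compose[OF mfd2 mfd mfd fs(1) f] tangent_map_compose[OF mfd2 mfd mfd fs(2) g]
    using tangent_map_fst[OF mfd mfd, of "fst z" "snd z"] tangent_map_snd[OF mfd mfd, of "fst z" "snd z"] by simp
qed

lemma square_fields [simp]:
  "left_inv_field (lie_square G) \<xi> z = (lvf (fst \<xi>) (fst z), lvf (snd \<xi>) (snd z))"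
  "right_inv_field (lie_square G) \<xi> z = (rvf (fst \<xi>) (fst z), rvf (snd \<xi>) (snd z))"
  "left_MC (lie_square G) z v = (left_MC G (fst z) (fst v), left_MC G (snd z) (snd v))"
  "right_MC (lie_square G) z v = (right_MC G (fst z) (fst v), right_MC G (snd z) (snd v))"
  "Ad (lie_square G) z v = (Ad G (fst z) (fst v), Ad G (snd z) (snd v))"
  by (simp_all add: left_inv_field_def right_inv_field_def left_MC_def right_MC_def Ad_def
      tangent_map_prod_map[OF smooth_left smooth_left] tangent_map_prod_map[OF smooth_right smooth_right]
      tangent_map_prod_map[OF smooth_conj smooth_conj])

text \<open>The bracket is read off from the differential of Ad, which on the square is visibly
  computed by components; this avoids differentiating invariant fields in product charts.\<close>

lemma square_bracket: "lie_alg_bracket (lie_square G) \<xi> \<zeta> = (br (fst \<xi>) (fst \<zeta>), br (snd \<xi>) (snd \<zeta>))"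
proof -
  have "((\<lambda>u. (Ad G (cinv M \<one> (fst u)) (fst \<zeta>), Ad G (cinv M \<one> (snd u)) (snd \<zeta>))) has_derivative
      (\<lambda>X. (br (fst X) (fst \<zeta>), br (snd X) (snd \<zeta>)))) (at (u1, u1))"
    by (intro has_derivative_Pair has_derivative_chain_at[OF has_derivative_fst[OF has_derivative_ident] Ad_has_derivative_unit]
        has_derivative_chain_at[OF has_derivative_snd[OF has_derivative_ident] Ad_has_derivative_unit]) simp_all
  then have "((\<lambda>u. Ad (lie_square G) (cinv (mfd2 G) (\<one>, \<one>) u) \<zeta>) has_derivative
      (\<lambda>X. (br (fst X) (fst \<zeta>), br (snd X) (snd \<zeta>)))) (at (u1, u1))"
    by (rule has_derivative_transform_within_open[OF _ open_cimg[OF mfd2, of "(\<one>, \<one>)"]])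
      (auto simp: cimg_prod cinv_prod[OF mfd mfd] mfd)
  moreover have "((\<lambda>u. Ad (lie_square G) (cinv (mfd2 G) (\<one>, \<one>) u) \<zeta>) has_derivative
      (\<lambda>X. lie_alg_bracket (lie_square G) X \<zeta>)) (at (u1, u1))"
    using Lie_group.Ad_has_derivative_unit[OF Lie_group_square, of \<zeta>] by simp
  ultimately show ?thesis using has_derivative_unique by (metis (no_types, lifting))
qed

text \<open>The slices of the multiplication are the right translation by b and the left translation
  by a. The common factor \<open>Ad G (iv b)\<close> disappears from all invariant expressions, and
  what is left are the two 1-forms that occur in \<open>\<varsigma>\<close>.\<close>

lemma tangent_mult:
  "left_MC G (a \<cdot> b) (tangent_map (mfd2 G) M Mult (a, b) v)
    = Ad G (iv b) (left_MC G a (fst v) + right_MC G b (snd v))"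
proof -
  have "tangent_map (mfd2 G) M Mult (a, b) v
      = tangent_map M M (\<lambda>x. x \<cdot> b) a (fst v) + tangent_map M M (\<lambda>y. a \<cdot> y) b (snd v)"
    using tangent_map_partial[OF mfd mfd mfd smooth_mult, of a b "fst v" "snd v"] by simp
  moreover have "left_MC G (a \<cdot> b) (tangent_map M M (\<lambda>x. x \<cdot> b) a (fst v)) = Ad G (iv b) (left_MC G a (fst v))"
    using tangent_comp[OF smooth_right[of b] smooth_left[of "iv (a \<cdot> b)"], of a "fst v"]
      tangent_comp[OF smooth_left[of "iv a"] smooth_conj[of "iv b" "iv (iv b)"], of a "fst v"]
    by (simp add: left_MC_def Ad_def grp.inverse_distrib_swap grp.assoc)
  moreover have "left_MC G (a \<cdot> b) (tangent_map M M (\<lambda>y. a \<cdot> y) b (snd v)) = Ad G (iv b) (right_MC G b (snd v))"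
    using tangent_comp[OF smooth_left[of a] smooth_left[of "iv (a \<cdot> b)"], of b "snd v"]
    by (simp add: right_MC_eq left_MC_def[of G b] left_MC_def[of G "a \<cdot> b"] grp.inverse_distrib_swap grp.assoc)
  ultimately show ?thesis by (simp add: linear_add[OF linear_left_MC] linear_add[OF linear_Ad])
qed

end

context Lie_group_metric
begin

lemma invariant_square: "invariant_inner_product (lie_square G) (square_form B)"
proof -
  have "bilinear (square_form B)"
    by (auto intro!: linearI simp: bilinear_def square_form_def B.add_left B.add_right B.scaleR_left B.scaleR_right distrib_left)
  moreover have "v = 0" if z: "\<And>w. square_form B v w = 0" for v
  proof -
    have "B \<zeta> (fst v) = 0" "B \<zeta> (snd v) = 0" for \<zeta>
      using z[of "(\<zeta>, 0)"] z[of "(0, \<zeta>)"] B_sym[of \<zeta>] by (simp_all add: square_form_def B.zero_right)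
    then show ?thesis using B_nondeg[of "fst v"] B_nondeg[of "snd v"] by (simp add: prod_eq_iff)
  qed
  moreover have "square_form B v w = square_form B w v" for v w
    using B_sym by (simp add: square_form_def)
  ultimately show ?thesis by (auto simp: invariant_inner_product_def square_form_def B_Ad)
qed

lemma square: "Lie_group_metric (lie_square G) (square_form B)"
  using Lie_group_square invariant_square by (simp add: Lie_group_metric_def Lie_group_metric_axioms_def)

lemma cartan_section_square:
  "cartan_section (lie_square G) (square_form B) (\<xi>, \<zeta>) (a, b) = pont_prod (cs \<xi> a) (cs \<zeta> b)"
  by (simp add: cartan_section_def pont_prod_def square_form_def fun_eq_iff)

lemma cartan_dirac_square:
  "cartan_dirac (lie_square G) (square_form B) = E2"
proof
  fix z :: "'g \<times> 'g"
  obtain a b where z: "z = (a, b)" by (cases z)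
  show "cartan_dirac (lie_square G) (square_form B) z = E2 z"
    unfolding z
  proof (intro equalityI subsetI)
    fix w assume "w \<in> cartan_dirac (lie_square G) (square_form B) (a, b)"
    then obtain \<xi> where "w = cartan_section (lie_square G) (square_form B) (fst \<xi>, snd \<xi>) (a, b)"
      by (auto simp: cartan_dirac_def)
    then show "w \<in> E2 (a, b)"
      unfolding cartan_section_square bundle_prod_def cartan_dirac_def by blast
  next
    fix w assume "w \<in> E2 (a, b)"
    then obtain \<xi> \<zeta> where "w = pont_prod (cs \<xi> a) (cs \<zeta> b)"
      unfolding bundle_prod_def cartan_dirac_def by blast
    then show "w \<in> cartan_dirac (lie_square G) (square_form B) (a, b)"
      unfolding cartan_section_square[symmetric] cartan_dirac_def by blast
  qed
qed

lemma cartan_3form_square: "cartan_3form (lie_square G) (square_form B) = sum_3form G B"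
proof (intro ext)
  fix z :: "'g \<times> 'g" and vs :: "('e \<times> 'e) list"
  obtain a b where z: "z = (a, b)" by (cases z)
  show "cartan_3form (lie_square G) (square_form B) z vs = sum_3form G B z vs"
  proof (cases "length vs = 3")
    case True
    then obtain v w y where vs: "vs = [v, w, y]" by (rule length_3_cases)
    show ?thesis
      by (simp add: vs z sum_3form_def pullback_def Lie_group_metric.cartan_3form_eq[OF square] cartan_3form_eq square_bracket
          square_form_def tangent_map_fst[OF mfd mfd] tangent_map_snd[OF mfd mfd] distrib_left add_divide_distrib)
  qed (simp add: sum_3form_def pullback_def Lie_group_metric.cartan_3form_degree[OF square] cartan_3form_degree)
qed

theorem dirac_manifold_square:
  "dirac_manifold (mfd2 G) (E2) (sum_3form G B)"
  using Lie_group_metric.dirac_manifold_cartan[OF square] by (simp add: cartan_dirac_square cartan_3form_square)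

section \<open>Multiplication\<close>

lemma mult_2form_eq:
  "\<varsigma> z [v, w] = - (1 / 2) * (B (left_MC G (fst z) (fst v)) (right_MC G (snd z) (snd w))
    - B (left_MC G (fst z) (fst w)) (right_MC G (snd z) (snd v)))"
proof -
  obtain a b where z: "z = (a, b)" by (cases z)
  have "pullback (mfd2 G) M fst (one_form (left_MC G)) z = (\<lambda>vs. if length vs = 1 then left_MC G a (fst (hd vs)) else 0)"
    "pullback (mfd2 G) M snd (one_form (right_MC G)) z = (\<lambda>vs. if length vs = 1 then right_MC G b (snd (hd vs)) else 0)"
    by (auto simp: pullback_def one_form_def z tangent_map_fst[OF mfd mfd] tangent_map_snd[OF mfd mfd] fun_eq_iff hd_map length_Suc_conv)
  then show ?thesis
    by (simp add: mult_2form_def wedge_wedge_at wedge_at_Cons[of B, OF B.minus_left] z B.zero_left B.zero_right B.minus_left)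
qed

lemma mult_2form_degree:
  assumes "length vs \<noteq> 2" shows "\<varsigma> z vs = 0"
proof -
  have "wedge_at B (pullback (mfd2 G) M fst (one_form (left_MC G)) z) (pullback (mfd2 G) M snd (one_form (right_MC G)) z) vs = 0"
    by (rule wedge_at_degree[of 1 _ 1]) (use assms in \<open>auto simp: pullback_def one_form_def B.zero_left B.zero_right\<close>)
  then show ?thesis by (simp add: mult_2form_def wedge_wedge_at)
qed

lemma local_mult_2form:
  assumes "z \<in> cimg (mfd2 G) (p, q)"
  shows "local_form (mfd2 G) (p, q) (\<varsigma>) z [v, w]
    = - (1 / 2) * (B (local_MC G p (fst z) (fst v)) (local_MC (lie_op G) q (snd z) (snd w))
      - B (local_MC G p (fst z) (fst w)) (local_MC (lie_op G) q (snd z) (snd v)))"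
proof -
  obtain u u' where z: "z = (u, u')" by (cases z)
  then have u: "u \<in> cimg M p" "u' \<in> cimg M q" using assms by (auto simp: cimg_prod)
  have "transition (mfd2 G) (p, q) (cinv M p u, cinv M q u') (u, u') v
      = (transition M p (cinv M p u) u (fst v), transition M q (cinv M q u') u' (snd v))" for v
    using transition_prod[OF mfd mfd u, of "cinv M p u" "cinv M q u'" "fst v" "snd v"] by (simp add: mfd)
  then show ?thesis
    by (simp add: local_form_def Let_def z cinv_prod[OF mfd mfd u] mult_2form_eq local_MC_eq)
qed

lemma local_mult_2form_degree: "length vs \<noteq> 2 \<Longrightarrow> local_form (mfd2 G) p (\<varsigma>) u vs = 0"
  by (simp add: local_form_def Let_def mult_2form_degree)

lemma mult_2form_kForms: "\<varsigma> \<in> kForms 2 (mfd2 G)"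
proof -
  have "alternating (\<varsigma> z)" for z
  proof (rule alternating_2I)
    note l = linear_add[OF linear_left_MC] linear_cmul[OF linear_left_MC] linear_add[OF linear_right_MC] linear_cmul[OF linear_right_MC]
    show "linear (\<lambda>x. \<varsigma> z [x, y])" "linear (\<lambda>x. \<varsigma> z [y, x])" for y
      by (auto intro!: linearI simp: mult_2form_eq l B.add_left B.add_right B.scaleR_left B.scaleR_right field_simps)
  qed (simp_all add: mult_2form_degree mult_2form_eq)
  moreover have "smooth_on (cimg (mfd2 G) p) (\<lambda>u. local_form (mfd2 G) p (\<varsigma>) u vs)" for p vs
  proof (cases "length vs = 2")
    case True
    then obtain v w where vs: "vs = [v, w]" by (rule length_2_cases)
    obtain a b where p: "p = (a, b)" by (cases p)
    note U = open_cimg[OF mfd2, of "(a, b)"]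
    have L: "smooth_on (cimg (mfd2 G) (a, b)) (\<lambda>z. local_MC G a (fst z) v)" for v
      by (rule smooth_on_compose[OF fin smooth_local_MC smooth_on_bounded_linear[OF bounded_linear_fst U] U open_cimg[OF mfd]])
        (auto simp: cimg_prod)
    have R: "smooth_on (cimg (mfd2 G) (a, b)) (\<lambda>z. local_MC (lie_op G) b (snd z) v)" for v
      by (rule smooth_on_compose[OF fin _ smooth_on_bounded_linear[OF bounded_linear_snd U] U open_cimg[OF mfd, of b]])
        (use Lie_group.smooth_local_MC[OF op, of b v] in \<open>auto simp: cimg_prod\<close>)
    have "smooth_on (cimg (mfd2 G) (a, b)) (\<lambda>z. - (1 / 2) * (B (local_MC G a (fst z) (fst v)) (local_MC (lie_op G) b (snd z) (snd w))
      - B (local_MC G a (fst z) (fst w)) (local_MC (lie_op G) b (snd z) (snd v))))"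
      by (intro smooth_on_bounded_bilinear[OF bounded_bilinear_mult] smooth_on_diff U smooth_on_const
          smooth_on_bounded_bilinear[OF bounded_bilinear_B] L R)
    then show ?thesis unfolding vs p
      by (rule smooth_on_cong[OF _ U]) (simp only: local_mult_2form)
  qed (simp add: local_mult_2form_degree smooth_on_const)
  ultimately show ?thesis by (simp add: kForms_def Forms_def homogeneous_def mult_2form_degree del: split_paired_All)
qed

lemma fderiv_local_mult_2form:
  "fderiv (\<lambda>u. local_form (mfd2 G) (a, b) (\<varsigma>) u [v, w]) (cmap (mfd2 G) (a, b) (a, b)) x
    = - (1 / 2) * (B (dMC a (fst x) (fst v)) (right_MC G b (snd w))
      + B (left_MC G a (fst v)) (Lie_group.dMC (lie_op G) b (snd x) (snd w))
      - B (dMC a (fst x) (fst w)) (right_MC G b (snd v))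
      - B (left_MC G a (fst w)) (Lie_group.dMC (lie_op G) b (snd x) (snd v)))"
proof -
  let ?z = "(cmap M a a, cmap M b b)" and ?dR = "Lie_group.dMC (lie_op G) b"
  note U = open_cimg[OF mfd2, of "(a, b)"]
  have L: "((\<lambda>z. local_MC G a (fst z) v) has_derivative (\<lambda>x. dMC a (fst x) v)) (at ?z)" for v
    by (rule has_derivative_chain_at[OF has_derivative_fst[OF has_derivative_ident] local_MC_has_derivative]) simp
  have R: "((\<lambda>z. local_MC (lie_op G) b (snd z) v) has_derivative (\<lambda>x. ?dR (snd x) v)) (at ?z)" for v
    by (rule has_derivative_chain_at[OF has_derivative_snd[OF has_derivative_ident] Lie_group.local_MC_has_derivative[OF op]]) simp
  have R0: "local_MC (lie_op G) b (cmap M b b) v = right_MC G b v" for v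
    using Lie_group.local_MC_centre[OF op, of b v] by simp
  have "((\<lambda>z. - (1 / 2) * (B (local_MC G a (fst z) (fst v)) (local_MC (lie_op G) b (snd z) (snd w))
      - B (local_MC G a (fst z) (fst w)) (local_MC (lie_op G) b (snd z) (snd v)))) has_derivative
    (\<lambda>x. - (1 / 2) * ((B (left_MC G a (fst v)) (?dR (snd x) (snd w)) + B (dMC a (fst x) (fst v)) (right_MC G b (snd w)))
      - (B (left_MC G a (fst w)) (?dR (snd x) (snd v)) + B (dMC a (fst x) (fst w)) (right_MC G b (snd v)))))) (at ?z)"
    using has_derivative_mult_right[OF has_derivative_diff[OF B.FDERIV[OF L[of "fst v"] R[of "snd w"]] B.FDERIV[OF L[of "fst w"] R[of "snd v"]]], of "- (1 / 2)"]
    by (simp add: R0)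
  then have "((\<lambda>u. local_form (mfd2 G) (a, b) (\<varsigma>) u [v, w]) has_derivative
    (\<lambda>x. - (1 / 2) * ((B (left_MC G a (fst v)) (?dR (snd x) (snd w)) + B (dMC a (fst x) (fst v)) (right_MC G b (snd w)))
      - (B (left_MC G a (fst w)) (?dR (snd x) (snd v)) + B (dMC a (fst x) (fst w)) (right_MC G b (snd v)))))) (at ?z)"
  proof (rule has_derivative_transform_within_open[OF _ U])
    show "?z \<in> cimg (mfd2 G) (a, b)" unfolding cimg_prod by (simp add: mfd)
  qed (simp only: local_mult_2form)
  from fderiv_eq[OF this] show ?thesis by (simp add: algebra_simps)
qed

text \<open>In the pull-back of \<eta> the terms involving a single factor give the sum of the two
  3-forms. The mixed terms are the differential of \<open>\<varsigma>\<close>, by the left and the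
  right Maurer-Cartan equation, whose signs are opposite.\<close>

theorem mult_3form:
  "sum_3form G B z vs + ext_d (mfd2 G) (\<varsigma>) z vs = pullback (mfd2 G) M Mult (\<eta>) z vs"
proof (cases "length vs = 3")
  case True
  then obtain x y w where vs: "vs = [x, y, w]" by (rule length_3_cases)
  obtain a b where z: "z = (a, b)" by (cases z)
  let ?p = "\<lambda>v. left_MC G a (fst v)" and ?q = "\<lambda>v. right_MC G b (snd v)" and ?dR = "Lie_group.dMC (lie_op G) b"
  have s: "sum_3form G B z vs = 1 / 2 * B (?p x) (br (?p y) (?p w)) + 1 / 2 * B (?q x) (br (?q y) (?q w))"
    by (simp add: vs z sum_3form_def pullback_def cartan_3form_eq tangent_map_fst[OF mfd mfd] tangent_map_snd[OF mfd mfd]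
        right_MC_eq Ad_br[symmetric] B_Ad)
  have pb: "pullback (mfd2 G) M Mult (\<eta>) z vs
      = 1 / 2 * B (?p x + ?q x) (br (?p y + ?q y) (?p w + ?q w))"
    by (simp add: vs z pullback_def cartan_3form_eq tangent_mult Ad_br[symmetric] B_Ad)
  have mcL: "dMC a (fst v) (fst u) = dMC a (fst u) (fst v) + br (?p u) (?p v)" for u v
    using maurer_cartan[of a "fst u" "fst v"] by (simp add: algebra_simps)
  have mcR: "?dR (snd v) (snd u) = ?dR (snd u) (snd v) - br (?q u) (?q v)" for u v
    using right_maurer_cartan[of b "snd u" "snd v"] by (simp add: algebra_simps)
  have "ext_d (mfd2 G) (\<varsigma>) z vs
    = fderiv (\<lambda>u. local_form (mfd2 G) (a, b) (\<varsigma>) u [y, w]) (cmap (mfd2 G) (a, b) (a, b)) x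
    - fderiv (\<lambda>u. local_form (mfd2 G) (a, b) (\<varsigma>) u [x, w]) (cmap (mfd2 G) (a, b) (a, b)) y
    + fderiv (\<lambda>u. local_form (mfd2 G) (a, b) (\<varsigma>) u [x, y]) (cmap (mfd2 G) (a, b) (a, b)) w"
    by (simp add: ext_d_alt_sum vs z)
  also have "\<dots> = 1 / 2 * (B (br (?p x) (?p y)) (?q w) - B (br (?p x) (?p w)) (?q y) + B (br (?p y) (?p w)) (?q x)
      + B (?p x) (br (?q y) (?q w)) - B (?p y) (br (?q x) (?q w)) + B (?p w) (br (?q x) (?q y)))"
    unfolding fderiv_local_mult_2form mcL[of y x] mcL[of w x] mcL[of w y] mcR[of y x] mcR[of w x] mcR[of w y]
    by (simp only: B.add_left B.diff_right) (simp add: field_simps)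
  finally have d: "ext_d (mfd2 G) (\<varsigma>) z vs
    = 1 / 2 * (B (br (?p x) (?p y)) (?q w) - B (br (?p x) (?p w)) (?q y) + B (br (?p y) (?p w)) (?q x)
      + B (?p x) (br (?q y) (?q w)) - B (?p y) (br (?q x) (?q w)) + B (?p w) (br (?q x) (?q y)))" .
  \<comment> \<open>Invariance of B brings the mixed terms to the shape in which they occur when the
    pull-back is expanded.\<close>
  have c: "B (br (?p x) (?p y)) (?q w) = B (?p x) (br (?p y) (?q w))" "B (br (?p x) (?p w)) (?q y) = - B (?p x) (br (?q y) (?p w))"
    "B (br (?p y) (?p w)) (?q x) = B (?q x) (br (?p y) (?p w))" "B (?p y) (br (?q x) (?q w)) = - B (?q x) (br (?p y) (?q w))"
    "B (?p w) (br (?q x) (?q y)) = B (?q x) (br (?q y) (?p w))"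
    using B_br[of "?p x" "?p y" "?q w"] B_br[of "?p x" "?p w" "?q y"] br_skew[of "?p w" "?q y"] B_sym[of "br (?p y) (?p w)" "?q x"]
      B_cyclic(1)[of "?p y" "?q x" "?q w"] br_skew[of "?q w" "?p y"] B_cyclic(2)[of "?q x" "?q y" "?p w"]
    by (simp_all add: B.minus_right)
  show ?thesis unfolding s d pb c
    by (simp add: B.add_left B.add_right br.add_left br.add_right field_simps)
next
  case False
  then show ?thesis
    using ext_d_degree[of 2 "mfd2 G" "\<varsigma>" vs z] local_mult_2form_degree
    by (simp add: sum_3form_def pullback_def cartan_3form_degree split_beta)
qed

section \<open>Elements related by the multiplication\<close>

lemma param_zero: "param g (0, \<lambda>v. 0) = 0"
  by (simp add: param_def sharp_def linear_0[OF linear_left_MC])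

lemma cartan_section_zero: "cs 0 g = (0, \<lambda>v. 0)"
  by (rule cartan_section_eqI) (simp_all add: linear_0[OF linear_left_MC] linear_0[OF linear_Ad] B.zero_right)

abbreviation mult_related :: "'g \<times> 'g \<Rightarrow> ('e \<times> 'e) pont \<Rightarrow> 'e pont \<Rightarrow> bool" where
  "mult_related \<equiv> dirac_related (mfd2 G) M Mult (\<varsigma>)"

abbreviation section_pair :: "'e \<Rightarrow> 'e \<Rightarrow> 'g \<Rightarrow> 'g \<Rightarrow> ('e \<times> 'e) pont" where
  "section_pair \<xi> \<zeta> a b \<equiv> pont_prod (cs \<xi> a) (cs \<zeta> b)"

lemma right_MC_fst_cartan_section [simp]: "right_MC G g (fst (cs \<xi> g)) = Ad G g \<xi> - \<xi>"
  by (simp add: right_MC_eq linear_diff[OF linear_Ad])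

text \<open>Coefficients of the two 1-forms from \<open>tangent_mult\<close>. They agree exactly
  when \<xi> and \<zeta> do, and only then does the covector factor through the derivative of the
  multiplication.\<close>

lemma section_pair_covector:
  "snd (section_pair \<xi> \<zeta> a b) v + \<varsigma> (a, b) [fst (section_pair \<xi> \<zeta> a b), v]
    = 1 / 2 * B (left_MC G a (fst v)) (\<xi> + Ad G (iv a) \<xi> + Ad G b \<zeta> - \<zeta>)
      + 1 / 2 * B (right_MC G b (snd v)) (Ad G b \<zeta> + \<zeta> - \<xi> + Ad G (iv a) \<xi>)"
proof -
  have "B (left_MC G b (snd v)) \<zeta> = B (right_MC G b (snd v)) (Ad G b \<zeta>)"
    "B (left_MC G b (snd v)) (Ad G (iv b) \<zeta>) = B (right_MC G b (snd v)) \<zeta>"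
    by (simp_all add: right_MC_eq B_Ad B_Ad_left)
  then show ?thesis
    using B_sym[of \<xi> "right_MC G b (snd v)"] B_sym[of "Ad G (iv a) \<xi>" "right_MC G b (snd v)"]
    by (simp add: pont_prod_def snd_cartan_section mult_2form_eq B.add_right B.diff_right B.diff_left field_simps)
qed

lemma mult_related_diagonal: "mult_related (a, b) (section_pair \<xi> \<xi> a b) (cs \<xi> (a \<cdot> b))"
  unfolding dirac_related_def
proof (intro conjI allI)
  let ?T = "tangent_map (mfd2 G) M Mult (a, b)"
  have Ad_ab: "Ad G (iv (a \<cdot> b)) \<xi> = Ad G (iv b) (Ad G (iv a) \<xi>)"
    by (simp add: grp.inverse_distrib_swap Ad_mult)
  show "fst (cs \<xi> (a \<cdot> b)) = ?T (fst (section_pair \<xi> \<xi> a b))"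
    by (rule left_MC_inj[of "a \<cdot> b"])
      (simp add: tangent_mult pont_prod_def Ad_ab linear_diff[OF linear_Ad] linear_add[OF linear_Ad])
  show "snd (cs \<xi> (a \<cdot> b)) (?T v)
      = snd (section_pair \<xi> \<xi> a b) v + \<varsigma> (a, b) [fst (section_pair \<xi> \<xi> a b), v]" for v
    unfolding section_pair_covector snd_cartan_section tangent_mult Ad_ab
    by (simp add: B_Ad_left B_Ad linear_add[OF linear_Ad] B.add_left B.add_right B.diff_right field_simps)
qed

lemma mult_related_unique:
  assumes w: "w \<in> Pont" and rel: "mult_related (a, b) (section_pair \<xi> \<zeta> a b) w"
  shows "\<zeta> = \<xi>" "w = cs \<xi> (a \<cdot> b)"
proof -
  let ?T = "tangent_map (mfd2 G) M Mult (a, b)"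
  have snd_w: "snd w (?T v) = snd (section_pair \<xi> \<zeta> a b) v + \<varsigma> (a, b) [fst (section_pair \<xi> \<zeta> a b), v]" for v
    using rel unfolding dirac_related_def by blast
  have "B \<psi> (\<xi> - \<zeta>) = 0" for \<psi>
  proof -
    \<comment> \<open>Velocity of the curve \<open>(a exp(t \<psi>), exp(-t \<psi>) b)\<close>,
      along which the product is constant.\<close>
    let ?v = "(lvf \<psi> a, rvf (- \<psi>) b)"
    have "?T ?v = 0"
      by (rule left_MC_inj[of "a \<cdot> b"]) (simp add: tangent_mult linear_0[OF linear_Ad] linear_0[OF linear_left_MC])
    then have "snd w (?T ?v) = 0" using w by (simp add: Pont_def linear_0)
    then show ?thesis unfolding snd_w section_pair_covector
      by (simp add: B.minus_left B.add_right B.diff_right field_simps)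
  qed
  then show eq: "\<zeta> = \<xi>" using B_nondeg[of "\<xi> - \<zeta>"] by simp
  have rel': "mult_related (a, b) (section_pair \<xi> \<xi> a b) w" using rel eq by simp
  note diag = mult_related_diagonal[of a b \<xi>]
  show "w = cs \<xi> (a \<cdot> b)"
  proof (rule prod_eqI)
    show "fst w = fst (cs \<xi> (a \<cdot> b))"
      using rel' diag by (simp add: dirac_related_def)
    show "snd w = snd (cs \<xi> (a \<cdot> b))"
    proof
      fix y
      \<comment> \<open>A preimage of y that moves only the second factor; a covector is thus
        determined by its values on the range of \<open>?T\<close>.\<close>
      have y: "?T (0, lvf (left_MC G (a \<cdot> b) y) b) = y"
        by (rule left_MC_inj[of "a \<cdot> b"]) (simp add: tangent_mult linear_0[OF linear_left_MC] right_MC_eq)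
      have "snd w (?T v) = snd (cs \<xi> (a \<cdot> b)) (?T v)" for v
        using rel' diag unfolding dirac_related_def by presburger
      from this[of "(0, lvf (left_MC G (a \<cdot> b) y) b)"]
      show "snd w y = snd (cs \<xi> (a \<cdot> b)) y" unfolding y .
    qed
  qed
qed

lemma bundle_prod_cases:
  assumes "w \<in> E2 (a, b)"
  obtains \<xi> \<zeta> where "w = section_pair \<xi> \<zeta> a b"
  using assms unfolding bundle_prod_def cartan_dirac_def by blast

lemma section_pair_in: "section_pair \<xi> \<zeta> a b \<in> E2 (a, b)"
  unfolding bundle_prod_def cartan_dirac_def by blast

theorem strong_dirac_morphism_mult:
  "strong_dirac_morphism (mfd2 G) (E2) (sum_3form G B)
     M (E) (\<eta>) Mult (\<varsigma>)"
  unfolding strong_dirac_morphism_def dirac_morphism_def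
proof (intro conjI allI ballI impI)
  show "(\<lambda>z vs. sum_3form G B z vs + ext_d (mfd2 G) (\<varsigma>) z vs)
      = pullback (mfd2 G) M Mult (\<eta>)"
    by (intro ext) (rule mult_3form)
next
  fix z :: "'g \<times> 'g"
  obtain a b where z: "z = (a, b)" by (cases z)
  show "E (Mult z)
      = {w' \<in> Pont. \<exists>w\<in>E2 z. mult_related z w w'}"
  proof (intro equalityI subsetI)
    fix w' assume "w' \<in> E (Mult z)"
    then obtain \<xi> where w': "w' = cs \<xi> (a \<cdot> b)" by (auto simp: cartan_dirac_def z)
    show "w' \<in> {w' \<in> Pont. \<exists>w\<in>E2 z. mult_related z w w'}"
      using mult_related_diagonal[of a b \<xi>] section_pair_in[of \<xi> a \<xi> b] cartan_section_Pont unfolding z w' by blast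
  next
    fix w' assume "w' \<in> {w' \<in> Pont. \<exists>w\<in>E2 z. mult_related z w w'}"
    then obtain w where w: "w' \<in> Pont" "w \<in> E2 (a, b)" "mult_related (a, b) w w'"
      unfolding z by blast
    obtain \<xi> \<zeta> where "w = section_pair \<xi> \<zeta> a b" using w(2) by (rule bundle_prod_cases)
    from mult_related_unique(2)[OF w(1) w(3)[unfolded this]]
    show "w' \<in> E (Mult z)" by (simp add: z cartan_dirac_def)
  qed
next
  fix z :: "'g \<times> 'g" and w
  assume w: "w \<in> E2 z" and rel: "mult_related z w (0, \<lambda>v. 0)"
  obtain a b where z: "z = (a, b)" by (cases z)
  obtain \<xi> \<zeta> where w': "w = section_pair \<xi> \<zeta> a b" using w unfolding z by (rule bundle_prod_cases)
  have "(0, \<lambda>v. 0) \<in> (Pont :: 'e pont set)" by (simp add: Pont_def linear_zero)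
  note u = mult_related_unique[OF this rel[unfolded z w']]
  have "\<xi> = 0" using arg_cong[OF u(2), of "param (a \<cdot> b)"] by (simp add: param_zero)
  then show "w = (0, \<lambda>v. 0)" using u(1) by (simp add: w' cartan_section_zero pont_prod_def zero_prod_def)
qed (rule dirac_manifold_square dirac_manifold_cartan smooth_mult mult_2form_kForms)+

theorem dirac_hat_mult:
  "dirac_hat (mfd2 G) (E2) M Mult (\<varsigma>)
     (a, b) (cs \<xi> (a \<cdot> b)) = section_pair \<xi> \<xi> a b"
  unfolding dirac_hat_def
proof (rule the_equality)
  show "section_pair \<xi> \<xi> a b \<in> E2 (a, b) \<and>
      mult_related (a, b) (section_pair \<xi> \<xi> a b) (cs \<xi> (a \<cdot> b))"
    using section_pair_in mult_related_diagonal by blast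
next
  fix w assume w: "w \<in> E2 (a, b) \<and>
      mult_related (a, b) w (cs \<xi> (a \<cdot> b))"
  then obtain \<alpha> \<beta> where w': "w = section_pair \<alpha> \<beta> a b" by (metis bundle_prod_cases)
  note u = mult_related_unique[OF cartan_section_Pont, of a b \<alpha> \<beta> \<xi> "a \<cdot> b"]
  have "\<beta> = \<alpha>" "cs \<xi> (a \<cdot> b) = cs \<alpha> (a \<cdot> b)"
    using u w w' by blast+
  then show "w = section_pair \<xi> \<xi> a b" by (metis param_cartan_section w')
qed

section \<open>Inversion\<close>

lemma metric_minus: "Lie_group_metric G (\<lambda>\<xi> \<zeta>. - B \<xi> \<zeta>)"
proof
  have "bilinear (\<lambda>\<xi> \<zeta>. - B \<xi> \<zeta>)"
    by (auto intro!: linearI simp: bilinear_def B.add_left B.add_right B.scaleR_left B.scaleR_right)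
  then show "invariant_inner_product G (\<lambda>\<xi> \<zeta>. - B \<xi> \<zeta>)"
    using inv_B by (simp add: invariant_inner_product_def)
qed

lemma cartan_section_minus: "cartan_section G (\<lambda>\<xi> \<zeta>. - B \<xi> \<zeta>) \<xi> g = (fst (cs \<xi> g), \<lambda>v. - snd (cs \<xi> g) v)"
  by (simp add: cartan_section_def)

lemma cartan_dirac_minus: "cartan_dirac G (\<lambda>\<xi> \<zeta>. - B \<xi> \<zeta>) = bundle_transpose (E)"
  by (simp add: cartan_dirac_def bundle_transpose_def cartan_section_minus fun_eq_iff image_image)

lemma cartan_3form_minus: "cartan_3form G (\<lambda>\<xi> \<zeta>. - B \<xi> \<zeta>) = (\<lambda>g vs. - \<eta> g vs)"
proof (intro ext)
  fix g and vs :: "'e list"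
  show "cartan_3form G (\<lambda>\<xi> \<zeta>. - B \<xi> \<zeta>) g vs = - \<eta> g vs"
  proof (cases "length vs = 3")
    case True
    then obtain x y z where "vs = [x, y, z]" by (rule length_3_cases)
    then show ?thesis by (simp add: cartan_3form_eq Lie_group_metric.cartan_3form_eq[OF metric_minus])
  qed (simp add: cartan_3form_degree Lie_group_metric.cartan_3form_degree[OF metric_minus])
qed

lemma tangent_inv_inv: "tangent_map M M iv (iv g) (tangent_map M M iv g v) = v"
  using tangent_comp[OF smooth_inv smooth_inv, of g v] by (simp add: tangent_map_ident[OF mfd mfd])

lemma tangent_inv_inv': "tangent_map M M iv g (tangent_map M M iv (iv g) v) = v"
  using tangent_inv_inv[of "iv g" v] by simp

text \<open>Inversion takes a left-invariant field to the negative of the right-invariant one and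
  conversely, so it preserves the vector parts. It reverses the sign of the sum of the two
  Maurer-Cartan forms, which the passage to \<open>- B\<close> compensates.\<close>

lemma inv_related:
  "dirac_related M M iv (\<lambda>g vs. 0) g (cs \<xi> g) (cartan_section G (\<lambda>\<xi> \<zeta>. - B \<xi> \<zeta>) \<xi> (iv g))"
  unfolding dirac_related_def
proof (intro conjI allI)
  let ?T = "tangent_map M M iv g"
  show "fst (cartan_section G (\<lambda>\<xi> \<zeta>. - B \<xi> \<zeta>) \<xi> (iv g)) = ?T (fst (cs \<xi> g))"
    by (rule left_MC_inj[of "iv g"]) (simp add: cartan_section_minus left_MC_inv)
  show "snd (cartan_section G (\<lambda>\<xi> \<zeta>. - B \<xi> \<zeta>) \<xi> (iv g)) (?T v) = snd (cs \<xi> g) v + 0" for v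
    by (simp add: cartan_section_minus snd_cartan_section left_MC_inv right_MC_eq B.minus_left B.add_right B_Ad_left field_simps)
qed

theorem dirac_morphism_inv:
  "dirac_morphism M (E) (\<eta>)
     M (bundle_transpose (E)) (\<lambda>g vs. - \<eta> g vs) iv (\<lambda>g vs. 0)"
  unfolding dirac_morphism_def
proof (intro conjI allI)
  show "dirac_manifold M (bundle_transpose (E)) (\<lambda>g vs. - \<eta> g vs)"
    using Lie_group_metric.dirac_manifold_cartan[OF metric_minus] by (simp add: cartan_dirac_minus cartan_3form_minus)
  show "(\<lambda>g vs. 0) \<in> kForms 2 M"
    by (auto simp: kForms_def Forms_def homogeneous_def alternating_def local_form_def smooth_on_const linear_zero)
  show "(\<lambda>x vs. \<eta> x vs + ext_d M (\<lambda>g vs. 0) x vs) = pullback M M iv (\<lambda>g vs. - \<eta> g vs)"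
  proof (intro ext)
    fix g and vs :: "'e list"
    have "ext_d M (\<lambda>g vs. 0) g vs = 0" by (simp add: ext_d_def local_form_def)
    moreover have "\<eta> g vs = pullback M M iv (\<lambda>g vs. - \<eta> g vs) g vs"
    proof (cases "length vs = 3")
      case True
      then obtain x y z where "vs = [x, y, z]" by (rule length_3_cases)
      \<comment> \<open>\<open>left_MC_inv\<close> contributes three signs, which together cancel
        the one in front of \<open>\<eta>\<close>.\<close>
      then show ?thesis
        by (simp add: pullback_def cartan_3form_eq left_MC_inv br.minus_left br.minus_right B.minus_left right_MC_eq Ad_br[symmetric] B_Ad)
    qed (simp add: pullback_def cartan_3form_degree)
    ultimately show "\<eta> g vs + ext_d M (\<lambda>g vs. 0) g vs = pullback M M iv (\<lambda>g vs. - \<eta> g vs) g vs"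
      by simp
  qed
  fix g
  show "bundle_transpose (E) (iv g) = {w' \<in> Pont. \<exists>w\<in>E g. dirac_related M M iv (\<lambda>g vs. 0) g w w'}"
  proof (intro equalityI subsetI)
    fix w' assume "w' \<in> bundle_transpose (E) (iv g)"
    then obtain \<xi> where w': "w' = cartan_section G (\<lambda>\<xi> \<zeta>. - B \<xi> \<zeta>) \<xi> (iv g)"
      unfolding cartan_dirac_minus[symmetric] cartan_dirac_def by blast
    then show "w' \<in> {w' \<in> Pont. \<exists>w\<in>E g. dirac_related M M iv (\<lambda>g vs. 0) g w w'}"
      using inv_related[of g \<xi>] Lie_group_metric.cartan_section_Pont[OF metric_minus] by (auto simp: cartan_dirac_def)
  next
    fix w' assume "w' \<in> {w' \<in> Pont. \<exists>w\<in>E g. dirac_related M M iv (\<lambda>g vs. 0) g w w'}"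
    then obtain \<xi> where rel: "dirac_related M M iv (\<lambda>g vs. 0) g (cs \<xi> g) w'"
      by (auto simp: cartan_dirac_def)
    note rel' = inv_related[of g \<xi>]
    have "w' = cartan_section G (\<lambda>\<xi> \<zeta>. - B \<xi> \<zeta>) \<xi> (iv g)"
    proof (rule prod_eqI)
      show "fst w' = fst (cartan_section G (\<lambda>\<xi> \<zeta>. - B \<xi> \<zeta>) \<xi> (iv g))"
        using rel rel' by (simp add: dirac_related_def)
      show "snd w' = snd (cartan_section G (\<lambda>\<xi> \<zeta>. - B \<xi> \<zeta>) \<xi> (iv g))"
      proof
        fix y
        have "snd w' (tangent_map M M iv g v) = snd (cartan_section G (\<lambda>\<xi> \<zeta>. - B \<xi> \<zeta>) \<xi> (iv g)) (tangent_map M M iv g v)" for v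
          using rel rel' by (simp add: dirac_related_def)
        \<comment> \<open>Inversion is an involution, so y is the image of its own image under the
          derivative at the inverse point.\<close>
        from this[of "tangent_map M M iv (iv g) y"]
        show "snd w' y = snd (cartan_section G (\<lambda>\<xi> \<zeta>. - B \<xi> \<zeta>) \<xi> (iv g)) y"
          by (simp only: tangent_inv_inv')
      qed
    qed
    then show "w' \<in> bundle_transpose (E) (iv g)"
      unfolding cartan_dirac_minus[symmetric] cartan_dirac_def by blast
  qed
qed (rule dirac_manifold_cartan smooth_inv)+

end

theorem theorem3p9:
  fixes G :: "('g::{t2_space, second_countable_topology}, 'e::real_inner) lie_group"
    and B :: "'e \<Rightarrow> 'e \<Rightarrow> real"
  assumes "is_lie_group G"
    and "invariant_inner_product G B"
  shows "strong_dirac_morphism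
           (mfd2 G) (bundle_prod (cartan_dirac G B) (cartan_dirac G B)) (sum_3form G B)
           (mfd G) (cartan_dirac G B) (cartan_3form G B)
           (\<lambda>(a, b). mul G a b) (mult_2form G B)
       \<and> (\<forall>a b \<xi>.
            dirac_hat
              (mfd2 G) (bundle_prod (cartan_dirac G B) (cartan_dirac G B)) (mfd G)
              (\<lambda>(a, b). mul G a b) (mult_2form G B)
              (a, b) (cartan_section G B \<xi> (mul G a b))
            = pont_prod (cartan_section G B \<xi> a) (cartan_section G B \<xi> b))
       \<and> dirac_morphism
           (mfd G) (cartan_dirac G B) (cartan_3form G B)
           (mfd G) (bundle_transpose (cartan_dirac G B)) (\<lambda>g vs. - cartan_3form G B g vs)
           (inver G) (\<lambda>g vs. 0)"
proof -
  interpret Lie_group_metric G B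
    using assms by unfold_locales
  show ?thesis
    using strong_dirac_morphism_mult dirac_hat_mult dirac_morphism_inv by blast
qed

end
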